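(* Let $f$ be a transcendental entire function and let $U$ be an unbounded component of $F(f)$. (a) If there exists $r>0$ with $m^n(r)\to\infty$ as $n\to\infty$, then $U\cap V^{+}(f)\ne\emptyset$, and hence $U$ is either a Baker domain (or preimage of a Baker domain) or a wandering domain. If, in addition, $$\liminf_{r\to\infty}\frac{\widetilde m(r)}{r}>1,$$ then $U\subset V^{+}(f)$. (b) If $$\lim_{r\to\infty}\frac{\widetilde m(r)}{r}=\infty,$$ then $U$ is a wandering domain and $U\subset V^{+}(f)$. (c) If $$\lim_{r\to\infty}\frac{\log\widetilde m(r)}{\log r}=\infty,$$ then $U$ is a wandering domain and $U\subset V^{+}(f)\subset Z^{+}(f)$.
   Context: For the entire function $f$: $m(r)=\min_{|z|=r}|f(z)|$, $\widetilde m(r)=\max_{0\le s\le r}m(s)$; $m^n,\widetilde m^{\,n},f^n$ denote $n$th iterates; $\mathbb{N}=\{1,2,\dots\}$, $\mathbb{N}_0=\mathbb{N}\cup\{0\}$. The Fatou set $F(f)$ is the set of $z\in\mathbb{C}$ such that $\{f^n:n\in\mathbb{N}\}$ is normal in some neighbourhood of $z$. For a Fatou component (connected component of $F(f)$) $U=U_0$, for each $n\in\mathbb{N}$ let $U_n$ be the Fatou component containing $f^n(U)$. $U$ is a wandering domain if $U_m\ne U_n$ for $m\ne n$. $U$ is a Baker domain if it is periodic ($U_p=U$ for some $p\ge1$) and $f^n(z)\to\infty$ as $n\to\infty$ for $z\in U$. $U$ is a preimage of a Baker domain if $U_k$ is a Baker domain for some $k\in\mathbb{N}$. Whenever there is $R>0$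 such that $\widetilde m(r)>r$ for $r\ge R$ (equivalently, there exists $r>0$ with $m^n(r)\to\infty$), define $$V^{+}(f)=\bigcup_{\ell\in\mathbb{N}_0}f^{-\ell}(V_R^{+}(f)),\qquad V_R^{+}(f)=\{z:\exists\,(n_j)\text{ such that }|f^{n_j}(z)|\ge\widetilde m^{\,n_j}(R),\text{ for }j\in\mathbb{N}\},$$ for any such $R$; this is independent of the choice of such $R$. Also $$Z^{+}(f)=\left\{z:\exists\,(n_j)\text{ such that }\frac{\log^+\log^+|f^{n_j}(z)|}{n_j}\to\infty\text{ as }j\to\infty\right\}.$$ In both definitions $(n_j)$ is a strictly increasing sequence of positive integers that may depend on $z$. Here $\log^+t=\max(\log t,0)$ for $t>0$ and $\log^+0=0$. *)

theory Defs
  imports "HOL-Complex_Analysis.Complex_Analysis"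
begin

definition transcendental_entire :: "(complex \<Rightarrow> complex) \<Rightarrow> bool" where
  "transcendental_entire f \<longleftrightarrow> f holomorphic_on UNIV \<and> (\<nexists>p :: complex poly. \<forall>z. f z = poly p z)"

section \<open>Fatou components\<close>

text \<open>Normality with \<open>\<infinity>\<close> admitted as a limit, i.e. as a family of maps into the Riemann sphere.
  The dichotomy between a finite limit and the limit \<open>\<infinity>\<close> is the right one for
  holomorphic functions on a connected open set \<open>S\<close>; only such sets are used below.\<close>

definition normal_on :: "complex set \<Rightarrow> (complex \<Rightarrow> complex) set \<Rightarrow> bool" where
  "normal_on S \<F> \<longleftrightarrow>
     (\<forall>F :: nat \<Rightarrow> complex \<Rightarrow> complex. range F \<subseteq> \<F> \<longrightarrow>
       (\<exists>\<rho> :: nat \<Rightarrow> nat. strict_mono \<rho> \<and>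
         ((\<exists>g. \<forall>K. compact K \<and> K \<subseteq> S \<longrightarrow> uniform_limit K (\<lambda>k. F (\<rho> k)) g sequentially) \<or>
          (\<forall>K. compact K \<and> K \<subseteq> S \<longrightarrow>
             (\<forall>B. \<forall>\<^sub>F k in sequentially. \<forall>z\<in>K. B \<le> cmod (F (\<rho> k) z))))))"

definition fatou_set :: "(complex \<Rightarrow> complex) \<Rightarrow> complex set" where
  "fatou_set f = {z. \<exists>S. open S \<and> connected S \<and> z \<in> S \<and> normal_on S {f ^^ n | n. n \<ge> 1}}"

definition fatou_iterate :: "(complex \<Rightarrow> complex) \<Rightarrow> complex set \<Rightarrow> nat \<Rightarrow> complex set" where
  "fatou_iterate f U n = (THE V. V \<in> components (fatou_set f) \<and> (f ^^ n) ` U \<subseteq> V)"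

definition wandering_domain :: "(complex \<Rightarrow> complex) \<Rightarrow> complex set \<Rightarrow> bool" where
  "wandering_domain f U \<longleftrightarrow> U \<in> components (fatou_set f) \<and>
     (\<forall>m n. m \<noteq> n \<longrightarrow> fatou_iterate f U m \<noteq> fatou_iterate f U n)"

definition baker_domain :: "(complex \<Rightarrow> complex) \<Rightarrow> complex set \<Rightarrow> bool" where
  "baker_domain f U \<longleftrightarrow> U \<in> components (fatou_set f) \<and>
     (\<exists>p\<ge>1. fatou_iterate f U p = U) \<and>
     (\<forall>z\<in>U. filterlim (\<lambda>n. (f ^^ n) z) at_infinity sequentially)"

definition preimage_of_baker_domain :: "(complex \<Rightarrow> complex) \<Rightarrow> complex set \<Rightarrow> bool" where
  "preimage_of_baker_domain f U \<longleftrightarrow> U \<in> components (fatou_set f) \<and>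
     (\<exists>k\<ge>1. baker_domain f (fatou_iterate f U k))"

section \<open>Minimum modulus\<close>

text \<open>For entire \<open>f\<close> and \<open>r \<ge> 0\<close> the infimum and the supremum below are attained.\<close>

definition min_modulus :: "(complex \<Rightarrow> complex) \<Rightarrow> real \<Rightarrow> real" where
  "min_modulus f r = (INF z\<in>sphere 0 r. cmod (f z))"

definition max_min_modulus :: "(complex \<Rightarrow> complex) \<Rightarrow> real \<Rightarrow> real" where
  "max_min_modulus f r = (SUP s\<in>{0..r}. min_modulus f s)"

section \<open>The sets \<open>V\<^sup>+(f)\<close> and \<open>Z\<^sup>+(f)\<close>\<close>

definition admissible_radius :: "(complex \<Rightarrow> complex) \<Rightarrow> real \<Rightarrow> bool" where
  "admissible_radius f R \<longleftrightarrow> R > 0 \<and> (\<forall>r\<ge>R. max_min_modulus f r > r)"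

definition VR_plus :: "(complex \<Rightarrow> complex) \<Rightarrow> real \<Rightarrow> complex set" where
  "VR_plus f R = {z. \<exists>\<nu> :: nat \<Rightarrow> nat. strict_mono \<nu> \<and> (\<forall>j. \<nu> j \<ge> 1) \<and>
     (\<forall>j. cmod ((f ^^ \<nu> j) z) \<ge> (max_min_modulus f ^^ \<nu> j) R)}"

text \<open>Meaningful only if an admissible radius exists; the choice is then irrelevant by
  \<open>V_plus_eq\<close> below.\<close>

definition V_plus :: "(complex \<Rightarrow> complex) \<Rightarrow> complex set" where
  "V_plus f = (\<Union>l :: nat. (f ^^ l) -` VR_plus f (SOME R. admissible_radius f R))"

definition log_plus :: "real \<Rightarrow> real" where
  "log_plus t = (if t > 0 then max (ln t) 0 else 0)"

definition Z_plus :: "(complex \<Rightarrow> complex) \<Rightarrow> complex set" where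
  "Z_plus f = {z. \<exists>\<nu> :: nat \<Rightarrow> nat. strict_mono \<nu> \<and> (\<forall>j. \<nu> j \<ge> 1) \<and>
     filterlim (\<lambda>j. log_plus (log_plus (cmod ((f ^^ \<nu> j) z))) / real (\<nu> j)) at_top sequentially}"

section \<open>Independence of \<open>V\<^sup>+(f)\<close> from the admissible radius\<close>

lemma min_modulus_le: "cmod z = r \<Longrightarrow> min_modulus f r \<le> cmod (f z)"
  unfolding min_modulus_def by (rule cINF_lower) (auto intro!: bdd_belowI2[where m = 0])

lemma bdd_above_min_modulus:
  assumes "continuous_on UNIV f"
  shows "bdd_above (min_modulus f ` {0..r})"
proof -
  have "compact ((\<lambda>s. cmod (f (of_real s))) ` {0..r})"
    by (intro compact_continuous_image continuous_intros continuous_on_compose2[OF assms]) auto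
  then have "bdd_above ((\<lambda>s. cmod (f (of_real s))) ` {0..r})"
    by (simp add: bounded_imp_bdd_above compact_imp_bounded)
  then obtain B where B: "\<And>s. s \<in> {0..r} \<Longrightarrow> cmod (f (of_real s)) \<le> B"
    unfolding bdd_above_def by blast
  show ?thesis
  proof (rule bdd_aboveI2)
    fix s assume s: "s \<in> {0..r}"
    then have "min_modulus f s \<le> cmod (f (of_real s))"
      by (intro min_modulus_le) auto
    with B[OF s] show "min_modulus f s \<le> B" by linarith
  qed
qed

lemma min_modulus_le_max_min_modulus:
  assumes "continuous_on UNIV f" "0 \<le> s" "s \<le> r"
  shows "min_modulus f s \<le> max_min_modulus f r"
  unfolding max_min_modulus_def
  using assms by (intro cSUP_upper bdd_above_min_modulus) auto

lemma max_min_modulus_mono: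
  assumes "continuous_on UNIV f" "0 \<le> s" "s \<le> r"
  shows "max_min_modulus f s \<le> max_min_modulus f r"
  unfolding max_min_modulus_def
  using assms by (intro cSUP_subset_mono bdd_above_min_modulus) auto

lemma min_modulus_left_lower:
  assumes f: "continuous_on UNIV f" and L: "0 < L" "c < min_modulus f L"
  obtains s where "0 < s" "s < L" "c < min_modulus f s"
proof -
  define e where "e = (min_modulus f L - c) / 2"
  have e: "e > 0" using L by (simp add: e_def)
  have "uniformly_continuous_on (cball 0 L) f"
    by (intro compact_uniformly_continuous continuous_on_subset[OF f]) auto
  then obtain d where d: "d > 0"
    "\<And>x y. x \<in> cball 0 L \<Longrightarrow> y \<in> cball 0 L \<Longrightarrow> dist y x < d \<Longrightarrow> dist (f y) (f x) < e"
    using e unfolding uniformly_continuous_on_def by metis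
  define s where "s = max (L / 2) (L - d / 2)"
  have s: "0 < s" "s < L" "L - s < d" using L d by (auto simp: s_def)
  have "min_modulus f L - e \<le> min_modulus f s"
    unfolding min_modulus_def[of f s]
  proof (rule cINF_greatest)
    show "sphere (0::complex) s \<noteq> {}" using s by simp
    fix z :: complex assume "z \<in> sphere 0 s"
    then have z: "cmod z = s" by simp
    define w where "w = of_real (L / s) * z"
    have w: "cmod w = L" using s z by (simp add: w_def norm_mult norm_divide)
    have "w - z = of_real (L / s - 1) * z" by (simp add: w_def algebra_simps)
    then have "dist w z = \<bar>L / s - 1\<bar> * s"
      by (simp only: dist_norm norm_mult norm_of_real z)
    also have "\<dots> = L - s" using s by (simp add: field_simps)
    finally have "dist (f w) (f z) < e" using d(2)[of z w] s z w by simp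
    then have "cmod (f w) - cmod (f z) < e"
      using norm_triangle_ineq2[of "f w" "f z"] by (simp add: dist_norm)
    then show "min_modulus f L - e \<le> cmod (f z)"
      using min_modulus_le[OF w, of f] by linarith
  qed
  moreover have "c < min_modulus f L - e" using L by (simp add: e_def field_simps)
  ultimately show ?thesis using that[OF s(1,2)] by linarith
qed

lemma admissible_iterates_ge:
  assumes "admissible_radius f R"
  shows "R \<le> (max_min_modulus f ^^ n) R"
proof (induction n)
  case (Suc n)
  then have "(max_min_modulus f ^^ n) R < max_min_modulus f ((max_min_modulus f ^^ n) R)"
    using assms by (simp add: admissible_radius_def)
  with Suc show ?case by simp
qed simp

lemma admissible_iterates_unbounded:
  assumes f: "continuous_on UNIV f" and R: "admissible_radius f R"
  obtains k where "B \<le> (max_min_modulus f ^^ k) R"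
proof (rule ccontr)
  define x where "x = (\<lambda>n. (max_min_modulus f ^^ n) R)"
  assume "\<not> thesis"
  then have B: "x n \<le> B" for n
    using that[of n] unfolding x_def by linarith
  have xR: "R \<le> x n" for n using admissible_iterates_ge[OF R] by (simp add: x_def)
  have x_Suc: "x (Suc n) = max_min_modulus f (x n)" for n by (simp add: x_def)
  define L where "L = (SUP n. x n)"
  have bdd: "bdd_above (range x)" using B by (intro bdd_aboveI2)
  have xL: "x n \<le> L" for n unfolding L_def by (intro cSUP_upper bdd) auto
  have "R \<le> L" "R > 0" using xR[of 0] xL[of 0] R by (auto simp: admissible_radius_def)
  then have L: "L > 0" "max_min_modulus f L > L" using R by (auto simp: admissible_radius_def)
  have "\<exists>s\<in>{0..L}. L < min_modulus f s"
    using L less_cSUP_iff[OF _ bdd_above_min_modulus[OF f], of L L]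
    by (simp add: max_min_modulus_def)
  then obtain s where s: "0 \<le> s" "s \<le> L" "L < min_modulus f s" by auto
  obtain t where t: "0 \<le> t" "t < L" "L < min_modulus f t"
  proof (cases "s = L")
    case True
    then have "L < min_modulus f L" using s by simp
    with L(1) obtain t where "0 < t" "t < L" "L < min_modulus f t"
      using min_modulus_left_lower[OF f] by blast
    with that[of t] show ?thesis by simp
  next
    case False
    with s that[of s] show ?thesis by simp
  qed
  obtain n where "t < x n"
    using t(2) less_cSUP_iff[OF _ bdd] unfolding L_def by auto
  then have "min_modulus f t \<le> x (Suc n)"
    unfolding x_Suc using min_modulus_le_max_min_modulus[OF f] t by simp
  with xL[of "Suc n"] t show False by linarith
qed

lemma max_min_modulus_iterates_mono:
  assumes f: "continuous_on UNIV f" and R: "admissible_radius f R" "R \<le> S"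
  shows "(max_min_modulus f ^^ n) R \<le> (max_min_modulus f ^^ n) S"
proof (induction n)
  case (Suc n)
  have "0 \<le> (max_min_modulus f ^^ n) R"
    using admissible_iterates_ge[OF R(1), of n] R(1) by (simp add: admissible_radius_def)
  with Suc show ?case using max_min_modulus_mono[OF f] by simp
qed (use R in auto)

lemma VR_plus_subset:
  assumes f: "continuous_on UNIV f" and R: "admissible_radius f R" and S: "admissible_radius f S"
  shows "(\<Union>l. (f ^^ l) -` VR_plus f R) \<subseteq> (\<Union>l. (f ^^ l) -` VR_plus f S)"
proof clarify
  fix z l assume "(f ^^ l) z \<in> VR_plus f R"
  then obtain \<nu> :: "nat \<Rightarrow> nat" where \<nu>: "strict_mono \<nu>"
    "\<And>j. (max_min_modulus f ^^ \<nu> j) R \<le> cmod ((f ^^ \<nu> j) ((f ^^ l) z))"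
    unfolding VR_plus_def by blast
  obtain k where k: "S \<le> (max_min_modulus f ^^ k) R"
    using admissible_iterates_unbounded[OF f R] by blast
  define \<mu> where "\<mu> j = \<nu> (j + Suc k) - k" for j
  have ge: "Suc k + j \<le> \<nu> (j + Suc k)" for j
    using strict_mono_imp_increasing[OF \<nu>(1), of "j + Suc k"] by simp
  have \<mu>: "\<mu> j + k = \<nu> (j + Suc k)" "\<mu> j \<ge> 1" for j
    using ge[of j] by (auto simp: \<mu>_def)
  have "strict_mono \<mu>"
  proof (rule strict_monoI)
    fix i j :: nat assume "i < j"
    then have "\<nu> (i + Suc k) < \<nu> (j + Suc k)" using \<nu>(1) by (simp add: strict_mono_def)
    then show "\<mu> i < \<mu> j" using \<mu>(1)[of i] \<mu>(1)[of j] by linarith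
  qed
  moreover have "(max_min_modulus f ^^ \<mu> j) S \<le> cmod ((f ^^ \<mu> j) ((f ^^ (k + l)) z))" for j
  proof -
    have "(max_min_modulus f ^^ \<mu> j) S \<le> (max_min_modulus f ^^ \<mu> j) ((max_min_modulus f ^^ k) R)"
      by (rule max_min_modulus_iterates_mono[OF f S k])
    also have "\<dots> = (max_min_modulus f ^^ \<nu> (j + Suc k)) R"
      unfolding \<mu>(1)[symmetric] by (simp add: funpow_add)
    also have "\<dots> \<le> cmod ((f ^^ \<nu> (j + Suc k)) ((f ^^ l) z))" by (rule \<nu>(2))
    also have "\<dots> = cmod ((f ^^ \<mu> j) ((f ^^ (k + l)) z))"
      unfolding \<mu>(1)[symmetric] by (simp add: funpow_add)
    finally show ?thesis .
  qed
  ultimately have "(f ^^ (k + l)) z \<in> VR_plus f S"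
    using \<mu>(2) unfolding VR_plus_def mem_Collect_eq by (intro exI[of _ \<mu>] conjI allI)
  then show "z \<in> (\<Union>l. (f ^^ l) -` VR_plus f S)" by blast
qed

lemma V_plus_eq:
  assumes "continuous_on UNIV f" "admissible_radius f R"
  shows "V_plus f = (\<Union>l. (f ^^ l) -` VR_plus f R)"
proof -
  have "admissible_radius f (SOME R. admissible_radius f R)"
    by (rule someI[of "admissible_radius f", OF assms(2)])
  then show ?thesis
    unfolding V_plus_def using assms by (intro equalityI VR_plus_subset)
qed

end

theory Submission
  imports Defs "HOL-Library.Diagonal_Subsequence"
begin

text \<open>
  Write \<open>rad n\<close> for the iterates \<open>m~^n(R)\<close> of the maximal minimum modulus. A continuum whose
  image under \<open>f ^^ n\<close> contains a point of modulus at most \<open>rad n\<close> and one of modulus at least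
  \<open>rad (n + 1)\<close> is stretched by \<open>f\<close>: its image under \<open>f ^^ (n + 1)\<close> contains a point of modulus
  at least \<open>rad (n + 2)\<close>. With the Baire category theorem this crossing property alone shows that
  every unbounded domain meets \<open>V\<^sup>+(f)\<close>.

  An unbounded Fatou component contains no large circle about the origin: otherwise, in the manner
  of Baker, it would be forward invariant and Harnack's inequality would force \<open>f\<close> to be a
  polynomial. Hence a branch of \<open>log (f ^^ n)\<close> on a disc in an unbounded component \<open>U\<close> covers no large
  disc, and Bloch's theorem bounds \<open>\<bar>f ^^ n\<bar>\<close> at one point of \<open>U\<close> by a constant multiple of
  \<open>max 1 \<bar>f ^^ n\<bar>\<close> at another, uniformly in \<open>n\<close>. If \<open>m~(r) \<ge> c r\<close> with \<open>c > 1\<close>, the constant costs only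
  boundedly many steps of \<open>rad\<close>, so \<open>U \<subseteq> V\<^sup>+(f)\<close>; on an eventually periodic component the bound gives
  exponential growth of orbits, which rules out \<open>m~(r) / r \<rightarrow> \<infinity>\<close>.

  A periodic component met by \<open>V\<^sup>+(f)\<close> has unbounded orbits. Its finite limit functions are
  constant, because a nonconstant one makes \<open>f ^^ p\<close> an automorphism of the component with iterates
  tending to the identity, against the crossing property. Constant finite limits are fixed points of
  \<open>f ^^ p\<close> and hence isolated, so the orbits escape to infinity.
\<close>

section \<open>Crossing property of the iterated minimum modulus\<close>

lemma min_modulus_nonneg: "0 \<le> r \<Longrightarrow> 0 \<le> min_modulus f r"
  unfolding min_modulus_def by (rule cINF_greatest) auto

text \<open>If \<open>max_min_modulus f t \<le> t\<close> held for some \<open>t \<ge> r\<close>,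
  then \<open>min_modulus f\<close> would map \<open>{0..t}\<close> into itself and its iterates
  starting at \<open>r\<close> would stay bounded.\<close>

lemma admissible_radius_if_min_modulus_iterates:
  assumes f: "continuous_on UNIV f" and r: "0 < r"
    and lim: "filterlim (\<lambda>n. (min_modulus f ^^ n) r) at_top sequentially"
  shows "admissible_radius f r"
  unfolding admissible_radius_def
proof (intro conjI allI impI r)
  fix t assume "r \<le> t"
  show "t < max_min_modulus f t"
  proof (rule ccontr)
    assume "\<not> t < max_min_modulus f t"
    then have le: "max_min_modulus f t \<le> t" by simp
    have "0 \<le> (min_modulus f ^^ n) r \<and> (min_modulus f ^^ n) r \<le> t" for n
    proof (induction n)
      case (Suc n)
      then show ?case
        using min_modulus_le_max_min_modulus[OF f, of "(min_modulus f ^^ n) r" t] le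
          min_modulus_nonneg[of "(min_modulus f ^^ n) r" f] by simp
    qed (use r \<open>r \<le> t\<close> in auto)
    moreover obtain n where "t + 1 \<le> (min_modulus f ^^ n) r"
      using lim unfolding filterlim_at_top eventually_sequentially by blast
    ultimately show False by (metis add_le_same_cancel1 not_one_le_zero order_trans)
  qed
qed

lemma admissible_radius_if_eventually:
  assumes "\<forall>\<^sub>F r in at_top. r < max_min_modulus f r"
  obtains R where "admissible_radius f R"
proof -
  obtain N where N: "\<And>r. r \<ge> N \<Longrightarrow> r < max_min_modulus f r"
    using assms unfolding eventually_at_top_linorder by blast
  have "admissible_radius f (max N 1)"
    unfolding admissible_radius_def using N by auto
  then show ?thesis by (rule that)
qed

lemma continuous_on_funpow:
  fixes f :: "'a::topological_space \<Rightarrow> 'a"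
  assumes "continuous_on UNIV f"
  shows "continuous_on S (f ^^ n)"
proof (induction n)
  case (Suc n)
  have "continuous_on S (f \<circ> (f ^^ n))"
    by (rule continuous_on_compose[OF Suc continuous_on_subset[OF assms]]) simp
  then show ?case by simp
qed (simp add: id_def)

locale min_modulus_growth =
  fixes f :: "complex \<Rightarrow> complex" and R :: real
  assumes cont: "continuous_on UNIV f"
    and adm: "admissible_radius f R"
begin

definition rad :: "nat \<Rightarrow> real" where
  "rad n = (max_min_modulus f ^^ n) R"

lemma rad_Suc: "rad (Suc n) = max_min_modulus f (rad n)"
  by (simp add: rad_def)

lemma R_pos: "0 < R"
  using adm by (simp add: admissible_radius_def)

lemma R_le_rad: "R \<le> rad n"
  unfolding rad_def by (rule admissible_iterates_ge[OF adm])

lemma rad_pos: "0 < rad n"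
  using R_pos R_le_rad[of n] by linarith

lemma rad_less_Suc: "rad n < rad (Suc n)"
  using adm R_le_rad[of n] by (simp add: rad_Suc admissible_radius_def)

lemma strict_mono_rad: "strict_mono rad"
  by (simp add: strict_mono_Suc_iff rad_less_Suc)

lemma rad_mono: "m \<le> n \<Longrightarrow> rad m \<le> rad n"
  using strict_mono_rad by (simp add: strict_mono_less_eq)

lemma filterlim_rad: "filterlim rad at_top sequentially"
  unfolding filterlim_at_top eventually_sequentially
proof
  fix B
  obtain k where "B \<le> rad k"
    using admissible_iterates_unbounded[OF cont adm] unfolding rad_def by blast
  then show "\<exists>N. \<forall>n\<ge>N. B \<le> rad n" using rad_mono order_trans by blast
qed

text \<open>Let \<open>w\<close> maximise \<open>cmod (f w)\<close> on the continuum. Circles of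
  radius between \<open>rad n\<close> and \<open>rad (Suc n)\<close> meet the continuum, so their
  minimum modulus is at most \<open>cmod (f w)\<close>. Smaller circles contribute at most
  \<open>rad (Suc n)\<close>, which is too little to produce the supremum
  \<open>rad (Suc (Suc n))\<close>.\<close>

lemma crossing_step:
  assumes "compact \<Gamma>" "connected \<Gamma>" "x \<in> \<Gamma>" "y \<in> \<Gamma>"
    and x: "cmod x \<le> rad n" and y: "rad (Suc n) \<le> cmod y"
  shows "\<exists>w\<in>\<Gamma>. rad (Suc (Suc n)) \<le> cmod (f w)"
proof -
  have "compact ((\<lambda>w. cmod (f w)) ` \<Gamma>)"
    by (intro compact_continuous_image continuous_intros assms(1) continuous_on_compose2[OF cont]) auto
  then obtain w where w: "w \<in> \<Gamma>" and max: "\<And>v. v \<in> \<Gamma> \<Longrightarrow> cmod (f v) \<le> cmod (f w)"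
    using compact_attains_sup[of "(\<lambda>w. cmod (f w)) ` \<Gamma>"] assms(3) by fastforce
  have hit: "min_modulus f s \<le> cmod (f w)" if "rad n \<le> s" "s \<le> rad (Suc n)" for s
  proof -
    have "connected (cmod ` \<Gamma>)"
      by (intro connected_continuous_image continuous_intros assms(2))
    then have "s \<in> cmod ` \<Gamma>"
      by (rule connectedD_interval[of _ "cmod x" "cmod y"]) (use assms that in auto)
    then obtain v where v: "v \<in> \<Gamma>" "cmod v = s" by auto
    then show ?thesis using min_modulus_le[OF v(2), of f] max[OF v(1)] by linarith
  qed
  have "max_min_modulus f (rad (Suc n)) \<le> max (rad (Suc n)) (cmod (f w))"
    unfolding max_min_modulus_def
  proof (rule cSUP_least)
    show "{0..rad (Suc n)} \<noteq> {}" using rad_pos[of "Suc n"] by simp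
    fix s assume s: "s \<in> {0..rad (Suc n)}"
    show "min_modulus f s \<le> max (rad (Suc n)) (cmod (f w))"
    proof (cases "rad n \<le> s")
      case True
      then show ?thesis using hit s by fastforce
    next
      case False
      then have "min_modulus f s \<le> max_min_modulus f (rad n)"
        using s by (intro min_modulus_le_max_min_modulus cont) auto
      then show ?thesis by (simp add: rad_Suc)
    qed
  qed
  then have "rad (Suc (Suc n)) \<le> cmod (f w)"
    using rad_less_Suc[of "Suc n"] by (simp add: rad_Suc[of "Suc n"])
  with w show ?thesis by blast
qed

text \<open>The low point \<open>x\<close> is kept throughout, while the high point may change at
  every step. The offset \<open>k\<close> lets the levels run ahead of the iterates.\<close>

lemma crossing:
  assumes "compact \<Gamma>" "connected \<Gamma>" "x \<in> \<Gamma>" "y \<in> \<Gamma>"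
    and y: "rad (Suc (k + m)) \<le> cmod ((f ^^ m) y)" and "m \<le> n"
    and x: "\<And>i. m \<le> i \<Longrightarrow> i < n \<Longrightarrow> cmod ((f ^^ i) x) \<le> rad (k + i)"
  shows "\<exists>w\<in>\<Gamma>. rad (Suc (k + n)) \<le> cmod ((f ^^ n) w)"
  using \<open>m \<le> n\<close> x
proof (induction n rule: dec_induct)
  case base
  then show ?case using y assms(4) by blast
next
  case (step n)
  then obtain w where w: "w \<in> \<Gamma>" "rad (Suc (k + n)) \<le> cmod ((f ^^ n) w)" by fastforce
  have "\<exists>v \<in> (f ^^ n) ` \<Gamma>. rad (Suc (Suc (k + n))) \<le> cmod (f v)"
  proof (rule crossing_step)
    show "compact ((f ^^ n) ` \<Gamma>)" "connected ((f ^^ n) ` \<Gamma>)"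
      by (auto intro!: compact_continuous_image connected_continuous_image continuous_on_funpow[OF cont] assms)
    show "cmod ((f ^^ n) x) \<le> rad (k + n)" using step by simp
  qed (use assms w in auto)
  then show ?case by simp
qed

text \<open>The argument of \<open>crossing_step\<close> for an unbounded connected set, which meets
  every circle of radius at least \<open>rad k\<close>: a bounded image would force
  \<open>max_min_modulus f (rad (Suc k)) \<le> rad (Suc k)\<close>.\<close>

lemma unbounded_image:
  assumes "connected U" "\<not> bounded U"
  shows "\<not> bounded (f ` U)"
proof
  assume "bounded (f ` U)"
  then obtain B where B: "\<And>z. z \<in> U \<Longrightarrow> cmod (f z) \<le> B"
    unfolding bounded_iff by auto
  obtain x where x: "x \<in> U" using assms(2) by fastforce
  obtain k where "max B (cmod x) \<le> rad k"
    using filterlim_rad unfolding filterlim_at_top eventually_sequentially by blast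
  then have k: "B \<le> rad k" "cmod x \<le> rad k" by auto
  have "connected (cmod ` U)"
    by (intro connected_continuous_image continuous_intros assms(1))
  have "min_modulus f s \<le> max (rad (Suc k)) B" if s: "s \<in> {0..rad (Suc k)}" for s
  proof (cases "rad k \<le> s")
    case True
    obtain y where y: "y \<in> U" "\<not> cmod y \<le> s"
      using assms(2) unfolding bounded_iff by blast
    have "s \<in> cmod ` U"
      by (rule connectedD_interval[OF \<open>connected (cmod ` U)\<close>, of "cmod x" "cmod y"])
        (use x y k True in auto)
    then obtain v where v: "v \<in> U" "cmod v = s" by auto
    then show ?thesis using min_modulus_le[OF v(2), of f] B[OF v(1)] by linarith
  next
    case False
    then have "min_modulus f s \<le> max_min_modulus f (rad k)"
      using s by (intro min_modulus_le_max_min_modulus cont) auto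
    then show ?thesis by (simp add: rad_Suc)
  qed
  then have "max_min_modulus f (rad (Suc k)) \<le> max (rad (Suc k)) B"
    unfolding max_min_modulus_def using rad_pos[of "Suc k"] by (intro cSUP_least) auto
  then show False
    using rad_less_Suc[of "Suc k"] k rad_less_Suc[of k] by (simp add: rad_Suc)
qed

lemma unbounded_funpow_image:
  assumes "connected U" "\<not> bounded U"
  shows "\<not> bounded ((f ^^ n) ` U)"
proof (induction n)
  case (Suc n)
  have "\<not> bounded (f ` (f ^^ n) ` U)"
    by (intro unbounded_image Suc connected_continuous_image continuous_on_funpow[OF cont] assms)
  then show ?case by (simp add: image_comp)
qed (use assms in simp)

text \<open>Infinitely many violations for one shift \<open>l\<close> can be enumerated increasingly
  into a sequence that witnesses \<open>(f ^^ l) z \<in> VR_plus f R\<close>.\<close>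

lemma eventually_low:
  assumes "z \<notin> V_plus f"
  shows "\<exists>N. \<forall>n\<ge>N. cmod ((f ^^ (n + l)) z) < rad n"
proof (rule ccontr)
  define S where "S = {n. 1 \<le> n \<and> rad n \<le> cmod ((f ^^ (n + l)) z)}"
  assume "\<not> ?thesis"
  then have "\<forall>N. \<exists>n\<ge>max N 1. rad n \<le> cmod ((f ^^ (n + l)) z)" by (meson not_less)
  then have "infinite S"
    unfolding infinite_nat_iff_unbounded_le S_def by (metis (mono_tags) max.boundedE mem_Collect_eq)
  then have en: "strict_mono (enumerate S)" "\<And>j. enumerate S j \<in> S"
    using strict_mono_enumerate enumerate_in_set by auto
  have "(f ^^ l) z \<in> VR_plus f R"
    unfolding VR_plus_def mem_Collect_eq
  proof (intro exI[of _ "enumerate S"] conjI allI)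
    fix j
    show "1 \<le> enumerate S j" using en(2)[of j] by (simp add: S_def)
    show "(max_min_modulus f ^^ enumerate S j) R \<le> cmod ((f ^^ enumerate S j) ((f ^^ l) z))"
      using en(2)[of j] by (simp add: S_def rad_def funpow_add)
  qed (rule en)
  then show False using assms V_plus_eq[OF cont adm] by blast
qed

lemma V_plus_high:
  assumes "z \<in> V_plus f"
  obtains l where "\<And>N. \<exists>n\<ge>N. rad n \<le> cmod ((f ^^ (n + l)) z)"
proof -
  obtain l where "(f ^^ l) z \<in> VR_plus f R"
    using assms V_plus_eq[OF cont adm] by auto
  then obtain \<nu> :: "nat \<Rightarrow> nat" where \<nu>: "strict_mono \<nu>"
    "\<And>j. rad (\<nu> j) \<le> cmod ((f ^^ \<nu> j) ((f ^^ l) z))"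
    unfolding VR_plus_def rad_def by blast
  have "\<exists>n\<ge>N. rad n \<le> cmod ((f ^^ (n + l)) z)" for N
    using \<nu>(2)[of N] strict_mono_imp_increasing[OF \<nu>(1), of N] by (auto simp: funpow_add)
  then show ?thesis by (rule that)
qed

lemma V_plus_iff:
  "z \<in> V_plus f \<longleftrightarrow> (\<exists>l. \<forall>N. \<exists>n\<ge>N. rad n \<le> cmod ((f ^^ (n + l)) z))"
  using V_plus_high eventually_low by (metis linorder_not_le)

text \<open>Suppose \<open>U\<close> misses \<open>V\<^sup>+(f)\<close>. Let \<open>E\<close> be the set of points without a neighbourhood on which
  \<open>\<bar>f ^^ n\<bar> < rad (n + 1)\<close> for all large \<open>n\<close>. By Baire some portion of \<open>E\<close> satisfies \<open>\<bar>f ^^ n\<bar> \<le> rad n\<close>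
  for all \<open>n \<ge> N\<close>. A segment from a nearby \<open>y\<close> with \<open>\<bar>f ^^ n y\<bar> \<ge> rad (n + 1)\<close> to its nearest point of \<open>E\<close>
  then contains such high points at all later times, and the crossing property between these and
  \<open>y\<close> prevents \<open>y\<close> from staying low.\<close>

theorem unbounded_meets_V_plus:
  assumes U: "open U" "connected U" "\<not> bounded U"
  shows "U \<inter> V_plus f \<noteq> {}"
proof
  assume disj: "U \<inter> V_plus f = {}"
  have low: "\<exists>N. \<forall>n\<ge>N. cmod ((f ^^ n) z) < rad n" if "z \<in> U" for z
    using eventually_low[of z 0] disj that by auto
  define \<A> where "\<A> = {B. open B \<and>
    (\<forall>\<^sub>F n in sequentially. \<forall>w\<in>B. cmod ((f ^^ n) w) < rad (Suc n))}"
  \<comment> \<open>Compactness turns the local bounds in \<open>\<A>\<close> into one bound valid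
    on all of \<open>\<Gamma>\<close> from some time \<open>N\<close> on; crossing from time
    \<open>m\<close> to \<open>max m N\<close> violates it.\<close>
  have stuck: False
    if \<Gamma>: "compact \<Gamma>" "connected \<Gamma>" "\<Gamma> \<subseteq> \<Union>\<A>" "x \<in> \<Gamma>" "y \<in> \<Gamma>"
      and y: "rad (Suc m) \<le> cmod ((f ^^ m) y)"
      and x: "\<And>i. i \<ge> m \<Longrightarrow> cmod ((f ^^ i) x) < rad i" for \<Gamma> x y m
  proof -
    obtain \<T> where \<T>: "finite \<T>" "\<T> \<subseteq> \<A>" "\<Gamma> \<subseteq> \<Union>\<T>"
    proof (rule compactE[OF \<Gamma>(1,3)])
      show "open B" if "B \<in> \<A>" for B using that by (simp add: \<A>_def)
    qed
    have "\<forall>\<^sub>F n in sequentially. \<forall>B\<in>\<T>. \<forall>w\<in>B. cmod ((f ^^ n) w) < rad (Suc n)"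
      by (rule eventually_ball_finite) (use \<T> in \<open>auto simp: \<A>_def\<close>)
    then obtain N where N: "\<And>n w. n \<ge> N \<Longrightarrow> w \<in> \<Gamma> \<Longrightarrow> cmod ((f ^^ n) w) < rad (Suc n)"
      using \<T>(3) unfolding eventually_sequentially by (meson UnionE subsetD)
    have "\<exists>w\<in>\<Gamma>. rad (Suc (0 + max m N)) \<le> cmod ((f ^^ max m N) w)"
      by (rule crossing[OF \<Gamma>(1,2,4,5)]) (use y x in \<open>auto intro: less_imp_le\<close>)
    then show False using N[of "max m N"] by fastforce
  qed
  have "\<exists>x\<in>U. x \<notin> \<Union>\<A>"
  proof (rule ccontr)
    assume "\<not> ?thesis"
    then have UA: "U \<subseteq> \<Union>\<A>" by blast
    obtain x where x: "x \<in> U" using U(3) by fastforce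
    obtain N where N: "\<And>n. n \<ge> N \<Longrightarrow> cmod ((f ^^ n) x) < rad n" using low[OF x] by blast
    have "\<not> bounded ((f ^^ N) ` U)" by (rule unbounded_funpow_image[OF U(2,3)])
    then obtain y where y: "y \<in> U" "rad (Suc N) \<le> cmod ((f ^^ N) y)"
      unfolding bounded_iff by (metis imageE linear)
    obtain g where g: "path g" "path_image g \<subseteq> U" "pathstart g = x" "pathfinish g = y"
      using connected_open_path_connected[OF U(1,2)] x y(1) unfolding path_connected_def by blast
    show False
      by (rule stuck[of "path_image g" x y N])
        (use g y N UA in \<open>auto simp: compact_path_image connected_path_image\<close>)
  qed
  then obtain x \<epsilon> where x: "x \<in> U" "x \<notin> \<Union>\<A>" and \<epsilon>: "\<epsilon> > 0" "cball x \<epsilon> \<subseteq> U"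
    using U(1) open_contains_cball by metis
  define E where "E = - \<Union>\<A>"
  have "open (\<Union>\<A>)" by (rule open_Union) (auto simp: \<A>_def)
  then have "closed E" unfolding E_def by (rule closed_Compl)
  define S where "S = closure (E \<inter> ball x \<epsilon>)"
  have "S \<subseteq> E \<inter> cball x \<epsilon>"
    unfolding S_def using \<open>closed E\<close> ball_subset_cball by (intro closure_minimal closed_Int) auto
  then have SE: "S \<subseteq> E" "S \<subseteq> cball x \<epsilon>" by auto
  have "x \<in> S"
    unfolding S_def by (rule subsetD[OF closure_subset]) (use x \<epsilon> in \<open>auto simp: E_def\<close>)
  \<comment> \<open>\<open>T N\<close> holds the points of \<open>S\<close> that exceed their level
    at some time \<open>n \<ge> N\<close>. If all these relatively open sets were dense in
    \<open>S\<close>, Baire would give a point of \<open>U\<close> exceeding its level infinitely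
    often, against \<open>low\<close>.\<close>
  define T where "T N = S \<inter> (\<Union>n\<in>{N..}. {w. rad n < cmod ((f ^^ n) w)})" for N
  have "\<exists>N. \<not> S \<subseteq> closure (T N)"
  proof (rule ccontr)
    assume dense: "\<not> ?thesis"
    have "S \<subseteq> closure (\<Inter>(range T))"
    proof (rule Baire)
      fix X assume "X \<in> range T"
      then obtain N where X: "X = T N" by blast
      have "openin (top_of_set S) (T N)"
        unfolding T_def
        by (intro openin_open_Int open_UN ballI open_Collect_less continuous_intros continuous_on_funpow[OF cont])
      then show "openin (top_of_set S) X \<and> S \<subseteq> closure X" using dense X by blast
    qed (auto simp: S_def)
    then have "\<Inter>(range T) \<noteq> {}" using \<open>x \<in> S\<close> by (metis closure_empty empty_iff subsetD)
    then obtain w where w: "\<And>N. w \<in> T N" by blast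
    then have "w \<in> U" using SE \<epsilon> by (auto simp: T_def)
    then show False       using low[of w] w unfolding T_def by (metis (no_types, lifting) IntD2 UN_E atLeast_iff mem_Collect_eq not_less_iff_gr_or_eq)
  qed
  then obtain N x' where x': "x' \<in> S" "x' \<notin> closure (T N)" by blast
  \<comment> \<open>The point \<open>x'\<close> may lie on the boundary of the ball; density of
    \<open>E \<inter> ball x \<epsilon>\<close> in \<open>S\<close> replaces it by an interior point
    \<open>p\<close>.\<close>
  have "- closure (T N) \<inter> (E \<inter> ball x \<epsilon>) \<noteq> {}"
    using x' open_Int_closure_eq_empty[of "- closure (T N)" "E \<inter> ball x \<epsilon>"]
    unfolding S_def by blast
  then obtain p where p: "p \<in> E" "p \<in> ball x \<epsilon> \<inter> - closure (T N)" by blast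
  have "open (ball x \<epsilon> \<inter> - closure (T N))" by auto
  then obtain \<eta> where \<eta>: "\<eta> > 0" "cball p \<eta> \<subseteq> ball x \<epsilon> \<inter> - closure (T N)"
    using p(2) open_contains_cball by metis
  have portion: "cmod ((f ^^ n) w) \<le> rad n" if "w \<in> E" "w \<in> cball p \<eta>" "n \<ge> N" for w n
  proof -
    have "w \<in> S" unfolding S_def by (rule subsetD[OF closure_subset]) (use that \<eta> in auto)
    moreover have "w \<notin> T N" using closure_subset \<eta> that by blast
    ultimately show ?thesis using that by (force simp: T_def)
  qed
  have "ball p \<eta> \<notin> \<A>" using p(1) \<eta>(1) unfolding E_def by force
  then have "\<not> (\<forall>\<^sub>F n in sequentially. \<forall>w\<in>ball p \<eta>. cmod ((f ^^ n) w) < rad (Suc n))"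
    by (auto simp: \<A>_def)
  then obtain n y where n: "n \<ge> N" and y: "y \<in> ball p \<eta>" "rad (Suc n) \<le> cmod ((f ^^ n) y)"
    unfolding eventually_sequentially by (metis linorder_not_le)
  have "y \<notin> E"
    using portion[of y n] y n rad_less_Suc[of n] by force
  obtain \<alpha> where \<alpha>: "\<alpha> \<in> E \<inter> cball p \<eta>" "\<And>w. w \<in> E \<inter> cball p \<eta> \<Longrightarrow> dist y \<alpha> \<le> dist y w"
  proof (rule distance_attains_inf)
    show "closed (E \<inter> cball p \<eta>)" using \<open>closed E\<close> by (simp add: closed_Int)
    show "E \<inter> cball p \<eta> \<noteq> {}" using p(1) \<eta>(1) by force
  qed blast
  have "dist y \<alpha> > 0" using \<open>y \<notin> E\<close> \<alpha>(1) by auto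
  have seg: "closed_segment y \<alpha> \<subseteq> cball p \<eta>"
    using \<alpha>(1) y(1) by (intro closed_segment_subset) auto
  have closer: "dist y w < dist y \<alpha>" if w: "w \<in> closed_segment y \<alpha>" "w \<noteq> \<alpha>" for w
  proof -
    obtain u where u: "0 \<le> u" "u \<le> 1" "w = (1 - u) *\<^sub>R y + u *\<^sub>R \<alpha>"
      using w(1) unfolding in_segment by blast
    have "u \<noteq> 1"
    proof
      assume "u = 1"
      then have "w = \<alpha>" unfolding u(3) by simp
      with w(2) show False by simp
    qed
    moreover have "y - w = u *\<^sub>R (y - \<alpha>)" unfolding u(3) by (simp add: algebra_simps)
    then have "dist y w = u * dist y \<alpha>" using u(1) by (simp add: dist_norm)
    ultimately show ?thesis using u(2) \<open>dist y \<alpha> > 0\<close> by simp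
  qed
  have clear: "closed_segment v y \<subseteq> \<Union>\<A>" if v: "v \<in> closed_segment y \<alpha>" "v \<noteq> \<alpha>" for v
  proof
    fix w assume w: "w \<in> closed_segment v y"
    then have w': "w \<in> closed_segment y \<alpha>"
      using subset_closed_segment[of v y y \<alpha>] v(1) by auto
    have "dist y w \<le> dist y v"
      using dist_in_closed_segment[OF w] by (simp add: dist_commute)
    with closer[OF v] have "\<not> dist y \<alpha> \<le> dist y w" by simp
    then have "w \<notin> E" using \<alpha>(2)[of w] w' seg by blast
    then show "w \<in> \<Union>\<A>" by (simp add: E_def)
  qed
  have "y \<in> U" using y(1) \<eta>(2) \<epsilon>(2) ball_subset_cball[of p \<eta>] ball_subset_cball[of x \<epsilon>] by blast
  then obtain M where M: "\<And>i. i \<ge> M \<Longrightarrow> cmod ((f ^^ i) y) < rad i" using low by blast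
  \<comment> \<open>First \<open>\<alpha>\<close> is the low point and \<open>y\<close> the high
    one. The resulting \<open>v\<close> is high at a time when \<open>y\<close> has become low for
    good, so on the segment from \<open>v\<close> to \<open>y\<close> the roles are exchanged. That
    segment avoids \<open>E\<close>, and \<open>stuck\<close> applies.\<close>
  have "\<exists>v\<in>closed_segment y \<alpha>. rad (Suc (0 + max n M)) \<le> cmod ((f ^^ max n M) v)"
    by (rule crossing[where x = \<alpha> and y = y and m = n]) (use portion \<alpha>(1) n y in auto)
  then obtain v where v: "v \<in> closed_segment y \<alpha>"
    "rad (Suc (max n M)) \<le> cmod ((f ^^ max n M) v)" by auto
  have "v \<noteq> \<alpha>"
    using v(2) portion[of \<alpha> "max n M"] \<alpha>(1) n rad_less_Suc[of "max n M"] by force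
  show False
    by (rule stuck[of "closed_segment v y" y v "max n M"])
      (use v clear[OF v(1) \<open>v \<noteq> \<alpha>\<close>] M in auto)
qed

end

section \<open>Normal families and the Fatou set\<close>

text \<open>Separates the convergence dichotomy of \<open>normal_on\<close> from the choice of a
  subsequence, so that it can be localised and diagonalised.\<close>

definition settles_on :: "complex set \<Rightarrow> (nat \<Rightarrow> complex \<Rightarrow> complex) \<Rightarrow> bool" where
  "settles_on S F \<longleftrightarrow>
     (\<exists>g. \<forall>K. compact K \<and> K \<subseteq> S \<longrightarrow> uniform_limit K F g sequentially) \<or>
     (\<forall>K. compact K \<and> K \<subseteq> S \<longrightarrow> (\<forall>B. \<forall>\<^sub>F k in sequentially. \<forall>z\<in>K. B \<le> cmod (F k z)))"

lemma normal_on_iff_settles: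
  "normal_on S \<F> \<longleftrightarrow> (\<forall>F. range F \<subseteq> \<F> \<longrightarrow>
     (\<exists>\<rho> :: nat \<Rightarrow> nat. strict_mono \<rho> \<and> settles_on S (\<lambda>k. F (\<rho> k))))"
  unfolding normal_on_def settles_on_def by blast

lemma settles_on_subseq:
  assumes "settles_on S F" "strict_mono r"
  shows "settles_on S (\<lambda>k. F (r k))"
proof -
  have r: "filterlim r sequentially sequentially" by (rule filterlim_subseq[OF assms(2)])
  show ?thesis
    using assms(1) unfolding settles_on_def
  proof (elim disjE exE)
    fix g assume "\<forall>K. compact K \<and> K \<subseteq> S \<longrightarrow> uniform_limit K F g sequentially"
    then have "\<forall>K. compact K \<and> K \<subseteq> S \<longrightarrow> uniform_limit K (\<lambda>k. F (r k)) g sequentially"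
      using filterlim_compose[OF _ r] by blast
    then show "(\<exists>g. \<forall>K. compact K \<and> K \<subseteq> S \<longrightarrow> uniform_limit K (\<lambda>k. F (r k)) g sequentially) \<or>
      (\<forall>K. compact K \<and> K \<subseteq> S \<longrightarrow> (\<forall>B. \<forall>\<^sub>F k in sequentially. \<forall>z\<in>K. B \<le> cmod (F (r k) z)))"
      by blast
  qed (use eventually_compose_filterlim[OF _ r] in blast)
qed

lemma settles_on_shift: "settles_on S (\<lambda>k. F (k + c)) \<Longrightarrow> settles_on S F"
proof -
  have *: "uniform_limit K (\<lambda>k. F (k + c)) g sequentially \<longleftrightarrow> uniform_limit K F g sequentially" for K g
    unfolding uniform_limit_iff
    using eventually_sequentially_seg[of "\<lambda>k. \<forall>x\<in>K. dist (F k x) (g x) < e" c for e] by simp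
  have "(\<forall>\<^sub>F k in sequentially. \<forall>z\<in>K. B \<le> cmod (F (k + c) z)) \<longleftrightarrow>
        (\<forall>\<^sub>F k in sequentially. \<forall>z\<in>K. B \<le> cmod (F k z))" for K B
    by (rule eventually_sequentially_seg)
  with * show "settles_on S (\<lambda>k. F (k + c)) \<Longrightarrow> settles_on S F"
    unfolding settles_on_def by simp
qed

text \<open>Packages the passage to a finite subcover; it serves uniform convergence, the lifting of
  compact sets through an open map, and local comparison constants.\<close>

lemma compact_local_imp:
  fixes K :: "'a::metric_space set"
  assumes K: "compact K"
    and loc: "\<And>z. z \<in> K \<Longrightarrow> \<exists>\<epsilon>>0. P (ball z \<epsilon>)"
    and "P {}" and un: "\<And>A B. P A \<Longrightarrow> P B \<Longrightarrow> P (A \<union> B)"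
    and mono: "\<And>A B. P B \<Longrightarrow> A \<subseteq> B \<Longrightarrow> P A"
  shows "P K"
proof -
  define \<C> where "\<C> = {B. open B \<and> P B}"
  have "K \<subseteq> \<Union>\<C>"
    unfolding \<C>_def using loc by fastforce
  then obtain \<T> where \<T>: "finite \<T>" "\<T> \<subseteq> \<C>" "K \<subseteq> \<Union>\<T>"
  proof (rule compactE[OF K])
    show "open B" if "B \<in> \<C>" for B using that by (simp add: \<C>_def)
  qed
  from \<T>(1,2) have "P (\<Union>\<T>)"
    by (induction \<T> rule: finite_induct) (auto simp: \<C>_def intro: \<open>P {}\<close> un)
  then show ?thesis using mono \<T>(3) by blast
qed

text \<open>The points with a finite limit nearby and those with divergence nearby form two open
  sets covering \<open>S\<close>. They are disjoint, since no value sequence both converges and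
  tends to infinity, so by connectedness one of them is all of \<open>S\<close>.\<close>

lemma settles_on_locally:
  assumes "open S" "connected S"
    and loc: "\<And>z. z \<in> S \<Longrightarrow> \<exists>B. open B \<and> z \<in> B \<and> settles_on B F"
  shows "settles_on S F"
proof -
  define fin where "fin A \<longleftrightarrow> (\<exists>g. uniform_limit A F g sequentially)" for A
  define inf where "inf A \<longleftrightarrow> (\<forall>B. \<forall>\<^sub>F k in sequentially. \<forall>z\<in>A. B \<le> cmod (F k z))" for A
  \<comment> \<open>Every local limit agrees with the pointwise \<open>lim\<close>, so the local
    limit functions glue.\<close>
  have fin_lim: "uniform_limit A F (\<lambda>z. lim (\<lambda>k. F k z)) sequentially" if "fin A" for A
  proof -
    from \<open>fin A\<close> obtain g where g: "uniform_limit A F g sequentially" unfolding fin_def by blast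
    have "lim (\<lambda>k. F k z) = g z" if "z \<in> A" for z
      by (rule limI, rule tendsto_uniform_limitI[OF g that])
    with g show ?thesis by (simp add: uniform_limit_iff)
  qed
  have mono: "fin A \<Longrightarrow> B \<subseteq> A \<Longrightarrow> fin B" "inf A \<Longrightarrow> B \<subseteq> A \<Longrightarrow> inf B" for A B
  proof -
    show "fin A \<Longrightarrow> B \<subseteq> A \<Longrightarrow> fin B" unfolding fin_def using uniform_limit_on_subset by blast
    assume "inf A" "B \<subseteq> A"
    show "inf B"
      unfolding inf_def
    proof
      fix b
      have "\<forall>\<^sub>F k in sequentially. \<forall>z\<in>A. b \<le> cmod (F k z)" using \<open>inf A\<close> unfolding inf_def ..
      then show "\<forall>\<^sub>F k in sequentially. \<forall>z\<in>B. b \<le> cmod (F k z)"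
        by (rule eventually_mono) (use \<open>B \<subseteq> A\<close> in blast)
    qed
  qed
  have disj: "\<not> (fin {z} \<and> inf {z})" for z
  proof
    assume a: "fin {z} \<and> inf {z}"
    then obtain g where g: "uniform_limit {z} F g sequentially" unfolding fin_def by blast
    have "(\<lambda>k. F k z) \<longlonglongrightarrow> g z" using tendsto_uniform_limitI[OF g, of z] by simp
    then have "(\<lambda>k. cmod (F k z)) \<longlonglongrightarrow> cmod (g z)" by (rule tendsto_norm)
    then have "\<forall>\<^sub>F k in sequentially. cmod (F k z) < cmod (g z) + 1"
      by (rule order_tendstoD(2)) simp
    moreover have "\<forall>\<^sub>F k in sequentially. cmod (g z) + 1 \<le> cmod (F k z)"
      using a unfolding inf_def by auto
    ultimately have "\<forall>\<^sub>F k in sequentially. False" by eventually_elim simp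
    then show False by simp
  qed
  define Fin where "Fin = S \<inter> \<Union>{B. open B \<and> fin B}"
  define Inf where "Inf = S \<inter> \<Union>{B. open B \<and> inf B}"
  have *: "z \<in> Fin \<or> z \<in> Inf" if z: "z \<in> S" for z
  proof -
    obtain B where B: "open B" "z \<in> B" "settles_on B F" using loc[OF z] by blast
    obtain e where e: "e > 0" "cball z e \<subseteq> B" using B(1,2) open_contains_cball[of B] by blast
    have "fin (cball z e) \<or> inf (cball z e)"
    proof -
      have K: "compact (cball z e) \<and> cball z e \<subseteq> B" using e(2) by simp
      show ?thesis
        using B(3) unfolding settles_on_def
      proof (elim disjE exE)
        fix g assume "\<forall>K. compact K \<and> K \<subseteq> B \<longrightarrow> uniform_limit K F g sequentially"
        then show ?thesis using K unfolding fin_def by blast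
      next
        assume "\<forall>K. compact K \<and> K \<subseteq> B \<longrightarrow> (\<forall>b. \<forall>\<^sub>F k in sequentially. \<forall>z\<in>K. b \<le> cmod (F k z))"
        then have "inf (cball z e)" using K unfolding inf_def by blast
        then show ?thesis ..
      qed
    qed
    then have "fin (ball z e) \<or> inf (ball z e)" using mono[OF _ ball_subset_cball] by blast
    moreover have "open (ball z e)" "z \<in> ball z e" using e by auto
    ultimately show ?thesis using z unfolding Fin_def Inf_def by blast
  qed
  have "open Fin" "open Inf" unfolding Fin_def Inf_def using assms(1) by auto
  moreover have "Fin \<inter> Inf \<inter> S = {}"
  proof (rule ccontr)
    assume "\<not> ?thesis"
    then obtain z A B where "z \<in> A" "z \<in> B" "fin A" "inf B" unfolding Fin_def Inf_def by blast
    then have "fin {z}" "inf {z}" using mono[of _ "{z}"] by auto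
    with disj show False by blast
  qed
  moreover have "S \<subseteq> Fin \<union> Inf" using * by blast
  ultimately have "Fin \<inter> S = {} \<or> Inf \<inter> S = {}"
    using connectedD[OF assms(2)] by blast
  then have "S \<subseteq> Fin \<or> S \<subseteq> Inf" using * by blast
  then show ?thesis
  proof
    assume S: "S \<subseteq> Fin"
    have "uniform_limit K F (\<lambda>z. lim (\<lambda>k. F k z)) sequentially" if K: "compact K" "K \<subseteq> S" for K
    proof (rule compact_local_imp[OF K(1)])
      fix z assume "z \<in> K"
      then obtain B where B: "open B" "z \<in> B" "fin B" using K(2) S unfolding Fin_def by blast
      then obtain e where "e > 0" "ball z e \<subseteq> B" using open_contains_ball[of B] by blast
      then show "\<exists>\<epsilon>>0. uniform_limit (ball z \<epsilon>) F (\<lambda>z. lim (\<lambda>k. F k z)) sequentially"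
        using uniform_limit_on_subset[OF fin_lim[OF B(3)]] by blast
    qed (auto intro: uniform_limit_on_Un uniform_limit_on_subset)
    then show ?thesis unfolding settles_on_def by blast
  next
    assume S: "S \<subseteq> Inf"
    have "inf K" if K: "compact K" "K \<subseteq> S" for K
    proof (rule compact_local_imp[OF K(1)])
      fix z assume "z \<in> K"
      then obtain B where B: "open B" "z \<in> B" "inf B" using K(2) S unfolding Inf_def by blast
      then obtain e where "e > 0" "ball z e \<subseteq> B" using open_contains_ball[of B] by blast
      then show "\<exists>\<epsilon>>0. inf (ball z \<epsilon>)" using mono(2)[OF B(3)] by blast
    next
      fix A B assume "inf A" "inf B"
      then show "inf (A \<union> B)" unfolding inf_def by (simp add: ball_Un eventually_conj_iff)
    qed (use mono(2) in \<open>auto simp: inf_def\<close>)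
    then show ?thesis unfolding settles_on_def inf_def by blast
  qed
qed

text \<open>A countable subcover and a diagonal subsequence give one sequence that settles on every
  member of the cover; \<open>settles_on_locally\<close> then assembles the pieces.\<close>

lemma normal_on_locally:
  assumes "open S" "connected S"
    and loc: "\<And>z. z \<in> S \<Longrightarrow> \<exists>B. open B \<and> z \<in> B \<and> normal_on B \<F>"
  shows "normal_on S \<F>"
proof (cases "S = {}")
  case True
  then show ?thesis
    unfolding normal_on_iff_settles settles_on_def by (auto intro!: exI[of _ id] strict_mono_id)
next
  case False
  define \<B> where "\<B> = {B. open B \<and> normal_on B \<F>}"
  have "\<And>B. B \<in> \<B> \<Longrightarrow> open B" by (simp add: \<B>_def)
  then obtain \<B>' where \<B>': "\<B>' \<subseteq> \<B>" "countable \<B>'" "\<Union>\<B>' = \<Union>\<B>"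
    using Lindelof by metis
  have S: "S \<subseteq> \<Union>\<B>'" unfolding \<B>'(3) \<B>_def using loc by blast
  then have "\<B>' \<noteq> {}" using False by blast
  define B where "B = from_nat_into \<B>'"
  have range_B: "range B = \<B>'"
    unfolding B_def by (rule range_from_nat_into[OF \<open>\<B>' \<noteq> {}\<close> \<B>'(2)])
  then have B: "open (B n)" "normal_on (B n) \<F>" for n
    using \<B>'(1) unfolding \<B>_def by blast+
  show ?thesis
    unfolding normal_on_iff_settles
  proof (intro allI impI)
    fix F :: "nat \<Rightarrow> complex \<Rightarrow> complex" assume F: "range F \<subseteq> \<F>"
    define P where "P n s \<longleftrightarrow> settles_on (B n) (\<lambda>k. F (s k))" for n s
    interpret subseqs P
    proof
      fix n s assume "strict_mono (s :: nat \<Rightarrow> nat)"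
      have "range (\<lambda>k. F (s k)) \<subseteq> \<F>" using F by auto
      then obtain r where "strict_mono r" "settles_on (B n) (\<lambda>k. F (s (r k)))"
        using B(2)[of n] unfolding normal_on_iff_settles by meson
      then show "\<exists>r'. strict_mono r' \<and> P n (s \<circ> r')" by (auto simp: P_def)
    qed
    \<comment> \<open>Only a tail of the diagonal sequence is a subsequence of the
      \<open>n\<close>-th one, so the first \<open>Suc n\<close> terms are dropped here and restored
      by \<open>settles_on_shift\<close>.\<close>
    have "P n (diagseq \<circ> ((+) (Suc n)))" for n
      by (rule diagseq_holds) (use settles_on_subseq in \<open>force simp: P_def\<close>)
    then have diag: "settles_on (B n) (\<lambda>k. F (diagseq k))" for n
      using settles_on_shift[of "B n" "\<lambda>k. F (diagseq k)" "Suc n"]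
      by (simp add: P_def add.commute[of _ n])
    have "\<exists>A. open A \<and> z \<in> A \<and> settles_on A (\<lambda>k. F (diagseq k))" if z: "z \<in> S" for z
    proof -
      obtain n where "z \<in> B n" using z S range_B by blast
      then show ?thesis using diag[of n] B(1)[of n] by blast
    qed
    then have "settles_on S (\<lambda>k. F (diagseq k))"
      by (rule settles_on_locally[OF assms(1,2)])
    then show "\<exists>\<rho>. strict_mono \<rho> \<and> settles_on S (\<lambda>k. F (\<rho> k))"
      using subseq_diagseq by blast
  qed
qed

lemma open_fatou_set: "open (fatou_set f)"
proof (subst open_subopen, rule ballI)
  fix z assume "z \<in> fatou_set f"
  then obtain S where S: "open S" "connected S" "z \<in> S" "normal_on S {f ^^ n | n. n \<ge> 1}"
    unfolding fatou_set_def by blast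
  then have "S \<subseteq> fatou_set f" unfolding fatou_set_def by blast
  with S show "\<exists>T. open T \<and> z \<in> T \<and> T \<subseteq> fatou_set f" by blast
qed

lemma normal_on_fatou:
  assumes "open V" "connected V" "V \<subseteq> fatou_set f"
  shows "normal_on V {f ^^ n | n. n \<ge> 1}"
proof (rule normal_on_locally[OF assms(1,2)])
  fix z assume "z \<in> V"
  then have "z \<in> fatou_set f" using assms(3) by blast
  then show "\<exists>B. open B \<and> z \<in> B \<and> normal_on B {f ^^ n | n. n \<ge> 1}"
    unfolding fatou_set_def by blast
qed

lemma normal_iterates_settle:
  assumes "normal_on V {f ^^ n | n. n \<ge> 1}" "\<And>k. n k \<ge> 1"
  obtains \<rho> :: "nat \<Rightarrow> nat" where "strict_mono \<rho>" "settles_on V (\<lambda>k. f ^^ n (\<rho> k))"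
proof -
  have "range (\<lambda>k. f ^^ n k) \<subseteq> {f ^^ n | n. n \<ge> 1}" using assms(2) by blast
  then have "\<exists>\<rho>. strict_mono \<rho> \<and> settles_on V (\<lambda>k. f ^^ n (\<rho> k))"
    using assms(1)[unfolded normal_on_iff_settles, THEN spec, of "\<lambda>k. f ^^ n k"] by blast
  then show ?thesis using that by blast
qed

text \<open>A finite limit would be continuous and hence bounded on \<open>K\<close>, which the
  values at the points \<open>y k\<close> exclude. The other alternative of normality then holds on
  all of \<open>V\<close>.\<close>

lemma normal_iterates_diverge:
  assumes V: "normal_on V {f ^^ n | n. n \<ge> 1}" "\<And>k. n k \<ge> 1"
    and f: "continuous_on UNIV f"
    and K: "compact K" "K \<subseteq> V" "\<And>k. y k \<in> K"
    and lim: "filterlim (\<lambda>k. cmod ((f ^^ n k) (y k))) at_top sequentially"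
  obtains \<rho> :: "nat \<Rightarrow> nat" where "strict_mono \<rho>"
    "\<And>L B. compact L \<Longrightarrow> L \<subseteq> V \<Longrightarrow> \<forall>\<^sub>F k in sequentially. \<forall>z\<in>L. B \<le> cmod ((f ^^ n (\<rho> k)) z)"
proof -
  obtain \<rho> :: "nat \<Rightarrow> nat" where \<rho>: "strict_mono \<rho>" "settles_on V (\<lambda>k. f ^^ n (\<rho> k))"
    using normal_iterates_settle[OF V] .
  have False if "uniform_limit K (\<lambda>k. f ^^ n (\<rho> k)) g sequentially" for g
  proof -
    have "continuous_on K g"
      by (rule uniform_limit_theorem[OF _ that]) (simp_all add: continuous_on_funpow[OF f])
    then have "bounded (g ` K)"
      by (intro compact_imp_bounded compact_continuous_image K)
    then obtain B where B: "\<And>z. z \<in> K \<Longrightarrow> cmod (g z) \<le> B" unfolding bounded_iff by auto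
    have "\<forall>\<^sub>F k in sequentially. \<forall>z\<in>K. dist ((f ^^ n (\<rho> k)) z) (g z) < 1"
      using uniform_limitD[OF that, of 1] by simp
    moreover have "\<forall>\<^sub>F k in sequentially. B + 1 < cmod ((f ^^ n (\<rho> k)) (y (\<rho> k)))"
      using filterlim_compose[OF lim filterlim_subseq[OF \<rho>(1)]]
      unfolding filterlim_at_top_dense by blast
    ultimately have "\<forall>\<^sub>F k in sequentially. False"
    proof eventually_elim
      case (elim k)
      then have "cmod ((f ^^ n (\<rho> k)) (y (\<rho> k)) - g (y (\<rho> k))) < 1"
        using K(3) by (simp add: dist_norm)
      then show ?case
        using elim(2) B[OF K(3)[of "\<rho> k"]]
          norm_triangle_sub[of "(f ^^ n (\<rho> k)) (y (\<rho> k))" "g (y (\<rho> k))"] by linarith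
    qed
    then show False by simp
  qed
  then have "\<And>L B. compact L \<Longrightarrow> L \<subseteq> V \<Longrightarrow>
      \<forall>\<^sub>F k in sequentially. \<forall>z\<in>L. B \<le> cmod ((f ^^ n (\<rho> k)) z)"
    using \<rho>(2) K(1,2) unfolding settles_on_def by blast
  with \<rho>(1) show ?thesis by (rule that)
qed

section \<open>Action of a nonconstant entire function on its Fatou set\<close>

locale nonconstant_entire =
  fixes f :: "complex \<Rightarrow> complex"
  assumes hol: "f holomorphic_on UNIV"
    and nonconst: "\<not> f constant_on UNIV"
begin

lemma holomorphic_on_funpow: "(f ^^ n) holomorphic_on S"
proof (induction n)
  case (Suc n)
  have "f \<circ> (f ^^ n) holomorphic_on S"
    by (rule holomorphic_on_compose[OF Suc holomorphic_on_subset[OF hol]]) simp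
  then show ?case by (simp add: o_def)
qed (simp add: id_def)

lemma open_image: "open S \<Longrightarrow> open (f ` S)"
  by (rule open_mapping_thm[OF hol]) (use nonconst in auto)

lemma open_funpow_image: "open S \<Longrightarrow> open ((f ^^ n) ` S)"
proof (induction n)
  case (Suc n)
  then have "open (f ` (f ^^ n) ` S)" by (intro open_image) simp
  then show ?case by (simp add: image_comp)
qed simp

lemma continuous_on_iterate: "continuous_on S (f ^^ n)"
  by (rule holomorphic_on_imp_continuous_on[OF holomorphic_on_funpow])

lemma continuous_entire: "continuous_on S f"
  by (rule holomorphic_on_imp_continuous_on[OF holomorphic_on_subset[OF hol]]) simp

lemma connected_funpow_image: "connected S \<Longrightarrow> connected ((f ^^ n) ` S)"
  by (rule connected_continuous_image[OF continuous_on_iterate])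

lemma settles_on_image:
  assumes "open S" and F: "settles_on S (\<lambda>k. F k \<circ> f)"
  shows "settles_on (f ` S) F"
proof -
  have lift: "\<exists>L. compact L \<and> L \<subseteq> S \<and> K \<subseteq> f ` L" if K: "compact K" "K \<subseteq> f ` S" for K
  proof (rule compact_local_imp[OF K(1)])
    fix z assume "z \<in> K"
    then obtain x where x: "x \<in> S" "z = f x" using K(2) by blast
    obtain e where e: "e > 0" "cball x e \<subseteq> S" using x(1) \<open>open S\<close> open_contains_cball[of S] by blast
    have "open (f ` ball x e)" "z \<in> f ` ball x e" using open_image x e by auto
    then obtain d where "d > 0" "ball z d \<subseteq> f ` ball x e" using open_contains_ball[of "f ` ball x e"] by blast
    moreover have "f ` ball x e \<subseteq> f ` cball x e" by (intro image_mono ball_subset_cball)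
    ultimately show "\<exists>\<epsilon>>0. \<exists>L. compact L \<and> L \<subseteq> S \<and> ball z \<epsilon> \<subseteq> f ` L"
      using e(2) by (intro exI[of _ d] conjI exI[of _ "cball x e"]) auto
  next
    fix A B
    assume "\<exists>L. compact L \<and> L \<subseteq> S \<and> A \<subseteq> f ` L" "\<exists>L. compact L \<and> L \<subseteq> S \<and> B \<subseteq> f ` L"
    then obtain L M where "compact L" "L \<subseteq> S" "A \<subseteq> f ` L" "compact M" "M \<subseteq> S" "B \<subseteq> f ` M"
      by blast
    then show "\<exists>L. compact L \<and> L \<subseteq> S \<and> A \<union> B \<subseteq> f ` L"
      by (intro exI[of _ "L \<union> M"]) (auto simp: image_Un)
  qed (auto intro: exI[of _ "{}"] dest: subset_trans)
  from F show ?thesis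
    unfolding settles_on_def
  proof (elim disjE exE)
    fix g assume g: "\<forall>K. compact K \<and> K \<subseteq> S \<longrightarrow> uniform_limit K (\<lambda>k. F k \<circ> f) g sequentially"
    \<comment> \<open>The limit at \<open>x\<close> depends only on \<open>f x\<close>, so it
      induces a limit function on the image.\<close>
    have *: "g x = lim (\<lambda>k. F k (f x))" if "x \<in> S" for x
    proof -
      have "compact {x} \<and> {x} \<subseteq> S" using that by simp
      then have ul: "uniform_limit {x} (\<lambda>k. F k \<circ> f) g sequentially" using g by blast
      have "(\<lambda>k. (F k \<circ> f) x) \<longlonglongrightarrow> g x" using tendsto_uniform_limitI[OF ul, of x] by simp
      then show ?thesis by (simp add: limI)
    qed
    have "uniform_limit K F (\<lambda>w. lim (\<lambda>k. F k w)) sequentially"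
      if K: "compact K" "K \<subseteq> f ` S" for K
    proof -
      obtain L where L: "compact L" "L \<subseteq> S" "K \<subseteq> f ` L" using lift[OF K] by blast
      then have "uniform_limit L (\<lambda>k. F k \<circ> f) g sequentially" using g by blast
      then show ?thesis
        unfolding uniform_limit_iff
      proof (rule all_forward, intro impI)
        fix e assume e: "0 < e \<longrightarrow> (\<forall>\<^sub>F n in sequentially. \<forall>x\<in>L. dist ((F n \<circ> f) x) (g x) < e)"
          and "0 < (e :: real)"
        then have "\<forall>\<^sub>F n in sequentially. \<forall>x\<in>L. dist ((F n \<circ> f) x) (g x) < e" by blast
        then show "\<forall>\<^sub>F n in sequentially. \<forall>w\<in>K. dist (F n w) (lim (\<lambda>k. F k w)) < e"
          by (rule eventually_mono) (use L * in \<open>fastforce\<close>)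
      qed
    qed
    then show "(\<exists>g. \<forall>K. compact K \<and> K \<subseteq> f ` S \<longrightarrow> uniform_limit K F g sequentially) \<or>
      (\<forall>K. compact K \<and> K \<subseteq> f ` S \<longrightarrow> (\<forall>B. \<forall>\<^sub>F k in sequentially. \<forall>z\<in>K. B \<le> cmod (F k z)))"
      by blast
  next
    assume inf: "\<forall>K. compact K \<and> K \<subseteq> S \<longrightarrow>
      (\<forall>B. \<forall>\<^sub>F k in sequentially. \<forall>z\<in>K. B \<le> cmod ((F k \<circ> f) z))"
    have "\<forall>\<^sub>F k in sequentially. \<forall>z\<in>K. B \<le> cmod (F k z)"
      if K: "compact K" "K \<subseteq> f ` S" for K B
    proof -
      obtain L where L: "compact L" "L \<subseteq> S" "K \<subseteq> f ` L" using lift[OF K] by blast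
      then have "\<forall>\<^sub>F k in sequentially. \<forall>z\<in>L. B \<le> cmod ((F k \<circ> f) z)" using inf by blast
      then show ?thesis by (rule eventually_mono) (use L in fastforce)
    qed
    then show "(\<exists>g. \<forall>K. compact K \<and> K \<subseteq> f ` S \<longrightarrow> uniform_limit K F g sequentially) \<or>
      (\<forall>K. compact K \<and> K \<subseteq> f ` S \<longrightarrow> (\<forall>B. \<forall>\<^sub>F k in sequentially. \<forall>z\<in>K. B \<le> cmod (F k z)))"
      by blast
  qed
qed

text \<open>Precomposing an iterate with \<open>f\<close> gives an iterate again, so normality near
  \<open>z\<close> is normality of these compositions and descends to a neighbourhood of
  \<open>f z\<close>.\<close>

lemma fatou_set_image: "f ` fatou_set f \<subseteq> fatou_set f"
proof clarify
  fix z assume "z \<in> fatou_set f"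
  then obtain S where S: "open S" "connected S" "z \<in> S" "normal_on S {f ^^ n | n. n \<ge> 1}"
    unfolding fatou_set_def by blast
  have "normal_on (f ` S) {f ^^ n | n. n \<ge> 1}"
    unfolding normal_on_iff_settles
  proof (intro allI impI)
    fix F :: "nat \<Rightarrow> complex \<Rightarrow> complex" assume "range F \<subseteq> {f ^^ n | n. n \<ge> 1}"
    then have "\<forall>k. \<exists>n\<ge>1. F k = f ^^ n" by blast
    then obtain n where n: "\<And>k. F k = f ^^ n k" by metis
    obtain \<rho> :: "nat \<Rightarrow> nat" where \<rho>: "strict_mono \<rho>" "settles_on S (\<lambda>k. f ^^ Suc (n (\<rho> k)))"
      using normal_iterates_settle[OF S(4), of "\<lambda>k. Suc (n k)"] by auto
    have "settles_on (f ` S) (\<lambda>k. F (\<rho> k))"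
      by (rule settles_on_image[OF S(1)]) (use \<rho>(2) in \<open>simp only: n funpow_Suc_right\<close>)
    with \<rho>(1) show "\<exists>\<rho>. strict_mono \<rho> \<and> settles_on (f ` S) (\<lambda>k. F (\<rho> k))" by blast
  qed
  moreover have "open (f ` S)" "connected (f ` S)" "f z \<in> f ` S"
    using S open_image connected_continuous_image[OF continuous_entire] by auto
  ultimately show "f z \<in> fatou_set f" unfolding fatou_set_def by blast
qed

lemma fatou_set_funpow_image: "(f ^^ n) ` fatou_set f \<subseteq> fatou_set f"
proof (induction n)
  case (Suc n)
  have "f ` (f ^^ n) ` fatou_set f \<subseteq> f ` fatou_set f" by (rule image_mono[OF Suc])
  also have "\<dots> \<subseteq> fatou_set f" by (rule fatou_set_image)
  finally show ?case by (simp add: image_comp)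
qed simp

lemma component_facts:
  assumes "V \<in> components (fatou_set f)"
  shows "open V" "connected V" "V \<noteq> {}" "V \<subseteq> fatou_set f"
    "normal_on V {f ^^ n | n. n \<ge> 1}"
proof -
  show "open V" by (rule open_components[OF open_fatou_set assms])
  moreover show "connected V" and V: "V \<noteq> {}" "V \<subseteq> fatou_set f"
    using in_components_connected[OF assms] in_components_nonempty[OF assms]
      in_components_subset[OF assms] by auto
  ultimately show "normal_on V {f ^^ n | n. n \<ge> 1}" using normal_on_fatou V(2) by blast
qed

text \<open>Makes the definite description in \<open>fatou_iterate\<close> well defined: the image
  is a nonempty connected subset of the Fatou set.\<close>

lemma fatou_iterate_unique:
  assumes "U \<in> components (fatou_set f)"
  shows "\<exists>!V. V \<in> components (fatou_set f) \<and> (f ^^ n) ` U \<subseteq> V"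
proof -
  note U = component_facts[OF assms]
  have sub: "(f ^^ n) ` U \<subseteq> fatou_set f" using fatou_set_funpow_image U(4) by blast
  have "(f ^^ n) ` U \<noteq> {}" using U(3) by simp
  then obtain V where "V \<in> components (fatou_set f)" "(f ^^ n) ` U \<subseteq> V"
    using exists_component_superset[OF sub _ connected_funpow_image[OF U(2)]] sub by blast
  moreover have "W = V'" if "W \<in> components (fatou_set f)" "V' \<in> components (fatou_set f)"
    "(f ^^ n) ` U \<subseteq> W" "(f ^^ n) ` U \<subseteq> V'" for W V'
    using components_eq[OF that(1,2)] that(3,4) U(3) by blast
  ultimately show ?thesis by blast
qed

lemma fatou_iterate:
  assumes "U \<in> components (fatou_set f)"
  shows "fatou_iterate f U n \<in> components (fatou_set f)" "(f ^^ n) ` U \<subseteq> fatou_iterate f U n"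
  using theI'[OF fatou_iterate_unique[OF assms, of n]] by (auto simp: fatou_iterate_def)

lemma fatou_iterate_eqI:
  assumes "U \<in> components (fatou_set f)" "V \<in> components (fatou_set f)"
    and "x \<in> U" "(f ^^ n) x \<in> V"
  shows "fatou_iterate f U n = V"
proof -
  have "(f ^^ n) x \<in> fatou_iterate f U n" using fatou_iterate(2)[OF assms(1), of n] assms(3) by blast
  then show ?thesis using components_eq[OF fatou_iterate(1)[OF assms(1), of n] assms(2)] assms(4) by blast
qed

end

section \<open>Harnack and Bloch estimates\<close>

text \<open>The Harnack chain argument: constants multiply along chains, connectedness links every
  point to a base point \<open>p\<close>, and compactness makes the constant uniform. The relation
  \<open>Q\<close> may quantify over all iterates, which gives constants independent of the
  iterate.\<close>

lemma compact_chain: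
  fixes Q :: "real \<Rightarrow> 'a::metric_space \<Rightarrow> 'a \<Rightarrow> bool"
  assumes V: "open V" "connected V" and K: "compact K" "K \<subseteq> V"
    and mono: "\<And>C D x y. Q C x y \<Longrightarrow> C \<le> D \<Longrightarrow> Q D x y"
    and trans: "\<And>C D x y z. 1 \<le> C \<Longrightarrow> 1 \<le> D \<Longrightarrow> Q C x y \<Longrightarrow> Q D y z \<Longrightarrow> Q (C * D) x z"
    and loc: "\<And>a. a \<in> V \<Longrightarrow> \<exists>\<delta>>0. \<exists>C\<ge>1. \<forall>x\<in>ball a \<delta>. \<forall>y\<in>ball a \<delta>. Q C x y"
  shows "\<exists>C\<ge>1. \<forall>x\<in>K. \<forall>y\<in>K. Q C x y"
proof (cases "K = {}")
  case True
  then show ?thesis by (intro exI[of _ 1]) auto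
next
  case False
  then obtain p where p: "p \<in> K" by blast
  define E where "E x y \<longleftrightarrow> (\<exists>C\<ge>1. Q C x y \<and> Q C y x)" for x y
  have E: "E x y" if xy: "x \<in> V" "y \<in> V" for x y
    using V(2) xy
  proof (rule connected_equivalence_relation)
    fix x y assume "E x y" then show "E y x" unfolding E_def by blast
  next
    fix x y z assume "E x y" "E y z"
    then obtain C D where CD: "1 \<le> C" "Q C x y" "Q C y x" "1 \<le> D" "Q D y z" "Q D z y"
      unfolding E_def by blast
    have "Q (C * D) x z" "Q (C * D) z x"
      using trans[of C D x y z] trans[of D C z y x] CD by (simp_all add: mult.commute)
    moreover have "1 * 1 \<le> C * D" using CD by (intro mult_mono) auto
    ultimately show "E x z" unfolding E_def by auto
  next
    fix a assume a: "a \<in> V"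
    obtain \<delta> C where d: "\<delta> > 0" "C \<ge> 1" "\<forall>x\<in>ball a \<delta>. \<forall>y\<in>ball a \<delta>. Q C x y"
      using loc[OF a] by blast
    have "\<forall>x\<in>V \<inter> ball a \<delta>. E a x" unfolding E_def using d by auto
    then show "\<exists>T. openin (top_of_set V) T \<and> a \<in> T \<and> (\<forall>x\<in>T. E a x)"
      using a d(1) by (intro exI[of _ "V \<inter> ball a \<delta>"]) (auto intro: openin_open_Int)
  qed
  have "\<exists>C\<ge>1. \<forall>x\<in>K. Q C x p \<and> Q C p x"
  proof (rule compact_local_imp[OF K(1)])
    fix z assume "z \<in> K"
    then have z: "z \<in> V" using K by blast
    obtain \<delta> C where d: "\<delta> > 0" "C \<ge> 1" "\<forall>x\<in>ball z \<delta>. \<forall>y\<in>ball z \<delta>. Q C x y"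
      using loc[OF z] by blast
    have "E z p" using E z p K by blast
    then obtain D where D: "D \<ge> 1" "Q D z p" "Q D p z" unfolding E_def by blast
    have "Q (C * D) x p \<and> Q (C * D) p x" if "x \<in> ball z \<delta>" for x
    proof -
      have "Q C x z" "Q C z x" using d that by auto
      then show ?thesis
        using trans[of C D x z p] trans[of D C p z x] d D by (simp add: mult.commute)
    qed
    moreover have "1 * 1 \<le> C * D" using d D by (intro mult_mono) auto
    ultimately have "1 \<le> C * D \<and> (\<forall>x\<in>ball z \<delta>. Q (C * D) x p \<and> Q (C * D) p x)" by simp
    with d(1) show "\<exists>\<epsilon>>0. \<exists>C\<ge>1. \<forall>x\<in>ball z \<epsilon>. Q C x p \<and> Q C p x" by blast
  next
    fix A B
    assume "\<exists>C\<ge>1. \<forall>x\<in>A. Q C x p \<and> Q C p x" "\<exists>C\<ge>1. \<forall>x\<in>B. Q C x p \<and> Q C p x"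
    then obtain C D where "C \<ge> 1" "\<forall>x\<in>A. Q C x p \<and> Q C p x" "D \<ge> 1" "\<forall>x\<in>B. Q D x p \<and> Q D p x"
      by blast
    then show "\<exists>C\<ge>1. \<forall>x\<in>A \<union> B. Q C x p \<and> Q C p x"
      using mono[of C _ _ "max C D"] mono[of D _ _ "max C D"] by (intro exI[of _ "max C D"]) auto
  qed (auto intro: exI[of _ 1])
  then obtain C where C: "C \<ge> 1" "\<And>x. x \<in> K \<Longrightarrow> Q C x p \<and> Q C p x" by blast
  have "Q (C * C) x y" if "x \<in> K" "y \<in> K" for x y
    using trans[of C C x p y] C that by blast
  moreover have "1 * 1 \<le> C * C" using C by (intro mult_mono) auto
  ultimately show ?thesis by (intro exI[of _ "C * C"]) auto
qed

text \<open>Harnack's inequality for the positive harmonic function \<open>ln (cmod (h z))\<close>,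
  obtained from the Schwarz lemma for a branch of the logarithm. The factor 3 is (1 + 1/2) / (1 -
  1/2).\<close>

lemma harnack_log:
  assumes h: "h holomorphic_on ball x \<rho>" and "0 < \<rho>"
    and gt: "\<And>z. z \<in> ball x \<rho> \<Longrightarrow> 1 < cmod (h z)"
    and z: "dist x z \<le> \<rho> / 2"
  shows "ln (cmod (h z)) \<le> 3 * ln (cmod (h x))"
proof -
  obtain g where g: "g holomorphic_on ball x \<rho>" "\<And>w. w \<in> ball x \<rho> \<Longrightarrow> exp (g w) = h w"
  proof (rule holomorphic_logarithm_exists[OF convex_ball open_ball h])
    show "h w \<noteq> 0" if "w \<in> ball x \<rho>" for w using gt[OF that] by auto
    show "x \<in> ball x \<rho>" using \<open>0 < \<rho>\<close> by simp
  qed blast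
  have Re_g: "Re (g w) = ln (cmod (h w))" if "w \<in> ball x \<rho>" for w
    using g(2)[OF that, symmetric] by simp
  define A where "A = Re (g x)"
  have A: "A > 0" unfolding A_def using Re_g[of x] gt[of x] \<open>0 < \<rho>\<close> by (simp add: ln_gt_zero)
  define G where "G w = g w - \<i> * of_real (Im (g x))" for w
  have G: "G holomorphic_on ball x \<rho>" unfolding G_def by (intro holomorphic_intros g)
  have ReG: "Re (G w) > 0" if "w \<in> ball x \<rho>" for w
    using Re_g[OF that] gt[OF that] by (simp add: G_def ln_gt_zero)
  have Gx: "G x = of_real A" by (simp add: G_def A_def complex_eq_iff)
  \<comment> \<open>The Cayley transform of the right half-plane onto the unit disc that sends
    \<open>A\<close>, the value of \<open>G\<close> at \<open>x\<close>, to 0.\<close>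
  define \<phi> where "\<phi> w = (G (x + of_real \<rho> * w) - of_real A) / (G (x + of_real \<rho> * w) + of_real A)" for w
  have in_ball: "x + of_real \<rho> * w \<in> ball x \<rho>" if "cmod w < 1" for w
    using that \<open>0 < \<rho>\<close> by (simp add: dist_norm norm_mult)
  have ne: "G w + of_real A \<noteq> 0" if "w \<in> ball x \<rho>" for w
  proof
    assume "G w + of_real A = 0"
    then have "Re (G w + of_real A) = 0" by simp
    then show False using ReG[OF that] A by simp
  qed
  have "(\<lambda>w. G (x + of_real \<rho> * w)) holomorphic_on ball 0 1"
  proof -
    have "G \<circ> (\<lambda>w. x + of_real \<rho> * w) holomorphic_on ball 0 1"
      by (rule holomorphic_on_compose_gen[OF _ G]) (auto intro!: holomorphic_intros in_ball[simplified])
    then show ?thesis by (simp add: o_def)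
  qed
  then have hol\<phi>: "\<phi> holomorphic_on ball 0 1"
    unfolding \<phi>_def using ne[OF in_ball] by (intro holomorphic_intros) auto
  have lt: "cmod (\<phi> w) < 1" if "cmod w < 1" for w
  proof -
    let ?W = "G (x + of_real \<rho> * w)"
    have "(Re ?W - A)\<^sup>2 < (Re ?W + A)\<^sup>2"
      using ReG[OF in_ball[OF that]] A by (simp add: power2_eq_square algebra_simps)
    then have "cmod (?W - of_real A) < cmod (?W + of_real A)"
      unfolding cmod_def by (simp add: real_sqrt_less_iff)
    then show ?thesis
      using ne[OF in_ball[OF that]] by (simp add: \<phi>_def norm_divide divide_less_eq)
  qed
  define w where "w = (z - x) / of_real \<rho>"
  have w: "cmod w \<le> 1 / 2" "x + of_real \<rho> * w = z"
    using z \<open>0 < \<rho>\<close> by (simp_all add: w_def norm_divide dist_norm norm_minus_commute field_simps)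
  have "\<phi> 0 = 0" by (simp add: \<phi>_def Gx)
  then have "cmod (\<phi> w) \<le> cmod w"
    using Schwarz_Lemma(1)[OF hol\<phi>] lt w(1) by simp
  then have "cmod (\<phi> w) \<le> 1 / 2" using w by linarith
  have zb: "z \<in> ball x \<rho>" using z \<open>0 < \<rho>\<close> by simp
  have "cmod (G z - of_real A) \<le> cmod (G z + of_real A) / 2"
    using \<open>cmod (\<phi> w) \<le> 1 / 2\<close> ne[OF zb]
    unfolding \<phi>_def w(2) norm_divide by (simp add: divide_le_eq)
  moreover have "cmod (G z) - A \<le> cmod (G z - of_real A)"
    using norm_triangle_ineq2[of "G z" "of_real A"] A by simp
  moreover have "cmod (G z + of_real A) \<le> cmod (G z) + A"
    using norm_triangle_ineq[of "G z" "of_real A"] A by simp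
  ultimately have "cmod (G z) \<le> 3 * A" by argo
  then have "Re (G z) \<le> 3 * A" using complex_Re_le_cmod[of "G z"] by linarith
  then show ?thesis
    using Re_g[OF zb] Re_g[of x] \<open>0 < \<rho>\<close> by (simp add: G_def A_def)
qed

text \<open>By Bloch's theorem a branch of \<open>log h\<close> with large derivative covers a disc of radius
  greater than \<open>\<pi>\<close>, whose image under the exponential function contains a circle about the origin.\<close>

lemma ratio_bound_if_no_circle:
  assumes h: "h holomorphic_on ball a r" and "0 < r"
    and nz: "\<And>z. z \<in> ball a r \<Longrightarrow> h z \<noteq> 0"
    and no: "\<And>\<rho>. 0 < \<rho> \<Longrightarrow> \<not> sphere 0 \<rho> \<subseteq> h ` ball a r"
    and xy: "x \<in> ball a (r / 2)" "y \<in> ball a (r / 2)"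
  shows "cmod (h x) \<le> exp 96 * cmod (h y)"
proof -
  have sub: "ball a (r / 2) \<subseteq> ball a r" using \<open>0 < r\<close> by (intro subset_ball) simp
  obtain g where g: "g holomorphic_on ball a r" "\<And>w. w \<in> ball a r \<Longrightarrow> exp (g w) = h w"
    using holomorphic_logarithm_exists[OF convex_ball open_ball h nz, of a] \<open>0 < r\<close>
    by (metis centre_in_ball)
  \<comment> \<open>Bloch's theorem on a disc of radius \<open>r / 2\<close> yields an image disc of
    radius \<open>(r / 2) * cmod (deriv g z) / 12\<close>. The constant 96 makes this at least 4,
    which exceeds \<open>pi\<close>.\<close>
  have D: "cmod (deriv g z) \<le> 96 / r" if z: "z \<in> ball a (r / 2)" for z
  proof (rule ccontr)
    assume "\<not> ?thesis"
    then have big: "4 \<le> (r / 2) * cmod (deriv g z) / 12" using \<open>0 < r\<close> by (simp add: field_simps)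
    have sub: "ball z (r / 2) \<subseteq> ball a r"
    proof
      fix w assume "w \<in> ball z (r / 2)"
      then show "w \<in> ball a r" using z dist_triangle[of a w z] by simp
    qed
    have "g holomorphic_on ball z (r / 2)" using g(1) sub by (rule holomorphic_on_subset)
    then obtain b where b: "ball b 4 \<subseteq> g ` ball z (r / 2)"
      using Bloch[OF _ _ big] \<open>0 < r\<close> by auto
    have "sphere 0 (exp (Re b)) \<subseteq> h ` ball a r"
    proof
      fix v :: complex assume "v \<in> sphere 0 (exp (Re b))"
      then have v: "cmod v = exp (Re b)" by simp
      then have "v \<noteq> 0" by auto
      \<comment> \<open>A logarithm of \<open>v\<close> on the vertical line through
        \<open>b\<close>, within distance \<open>pi\<close> of \<open>b\<close>.\<close>
      define c where "c = of_real (Re b) + \<i> * of_real (Im b + Arg (v / exp b))"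
      have "v / exp b \<noteq> 0" "cmod (v / exp b) = 1" using \<open>v \<noteq> 0\<close> v by (simp_all add: norm_divide)
      then have "exp (\<i> * of_real (Arg (v / exp b))) = v / exp b"
        using Arg_eq[of "v / exp b"] by simp
      moreover have "c = b + \<i> * of_real (Arg (v / exp b))"
        by (simp add: c_def complex_eq_iff)
      ultimately have "exp c = v" by (simp add: exp_add)
      have "\<bar>Arg (v / exp b)\<bar> \<le> pi" using Arg_bounded[of "v / exp b"] by auto
      then have "\<bar>Arg (v / exp b)\<bar> < 4" using pi_less_4 by linarith
      then have "c \<in> ball b 4"
        using \<open>c = b + _\<close> by (simp add: dist_norm norm_mult)
      then obtain u where u: "u \<in> ball z (r / 2)" "c = g u" using b by blast
      then have "v = h u" using g(2) sub \<open>exp c = v\<close> by blast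
      then show "v \<in> h ` ball a r" using u sub by blast
    qed
    then show False using no[of "exp (Re b)"] by simp
  qed
  have "cmod (g x - g y) \<le> 96 / r * cmod (x - y)"
  proof (rule field_differentiable_bound[OF convex_ball])
    fix z assume z: "z \<in> ball a (r / 2)"
    show "(g has_field_derivative deriv g z) (at z within ball a (r / 2))"
      using holomorphic_derivI[OF g(1) open_ball] z sub by blast
    show "cmod (deriv g z) \<le> 96 / r" by (rule D[OF z])
  qed (use xy in auto)
  also have "\<dots> \<le> 96 / r * r"
  proof (rule mult_left_mono)
    have "dist x y \<le> dist a x + dist a y" by (metis dist_commute dist_triangle)
    then show "cmod (x - y) \<le> r" using xy by (simp add: dist_norm)
  qed (use \<open>0 < r\<close> in simp)
  also have "\<dots> = 96" using \<open>0 < r\<close> by simp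
  finally have "Re (g x) \<le> 96 + Re (g y)"
    using complex_Re_le_cmod[of "g x - g y"] by simp
  then have "exp (Re (g x)) \<le> exp 96 * exp (Re (g y))"
    by (simp flip: exp_add)
  moreover have "cmod (h x) = exp (Re (g x))" "cmod (h y) = exp (Re (g y))"
    using g(2)[of x] g(2)[of y] xy sub by (auto simp flip: norm_exp_eq_Re)
  ultimately show ?thesis by simp
qed

section \<open>Comparison of iterates on compact sets, uniformly in the iterate\<close>

context nonconstant_entire
begin

text \<open>A local comparison is required only for iterates that are large on the whole disc. If no
  constant worked near \<open>a\<close>, the left-hand values would be unbounded because
  \<open>\<Phi>\<close> is bounded below by \<open>c\<close>; normality then makes a subsequence
  diverge on the disc, where \<open>D\<close> does work.\<close>

lemma iterates_comparable:
  fixes \<Phi> :: "real \<Rightarrow> real"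
  assumes V: "open V" "connected V" "normal_on V {f ^^ n | n. n \<ge> 1}"
    and K: "compact K" "K \<subseteq> V"
    and \<Phi>: "mono \<Phi>" "0 < c" "\<And>t. c \<le> \<Phi> t"
    and loc: "\<And>a. a \<in> V \<Longrightarrow> \<exists>r>0. \<exists>\<delta>>0. \<delta> \<le> r \<and> cball a r \<subseteq> V \<and> (\<exists>D B. \<forall>n\<ge>1.
      (\<forall>z\<in>cball a r. B \<le> cmod ((f ^^ n) z)) \<longrightarrow>
      (\<forall>x\<in>ball a \<delta>. \<forall>y\<in>ball a \<delta>. \<Phi> (cmod ((f ^^ n) x)) \<le> D * \<Phi> (cmod ((f ^^ n) y))))"
  shows "\<exists>C\<ge>1. \<forall>n\<ge>1. \<forall>x\<in>K. \<forall>y\<in>K. \<Phi> (cmod ((f ^^ n) x)) \<le> C * \<Phi> (cmod ((f ^^ n) y))"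
proof -
  define L where "L n x = \<Phi> (cmod ((f ^^ n) x))" for n x
  have L: "c \<le> L n x" "0 < L n x" for n x using \<Phi>(2) \<Phi>(3)[of "cmod ((f ^^ n) x)"] by (auto simp: L_def)
  have "\<exists>C\<ge>1. \<forall>x\<in>K. \<forall>y\<in>K. \<forall>n\<ge>1. L n x \<le> C * L n y"
  proof (rule compact_chain[OF V(1,2) K])
    fix C D x y assume "\<forall>n\<ge>1. L n x \<le> C * L n y" "C \<le> D"
    then show "\<forall>n\<ge>1. L n x \<le> D * L n y"
      using L(2) by (meson less_imp_le mult_right_mono order_trans)
  next
    fix C D :: real and x y z
    assume "1 \<le> C" "1 \<le> D" "\<forall>n\<ge>1. L n x \<le> C * L n y" "\<forall>n\<ge>1. L n y \<le> D * L n z"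
    then show "\<forall>n\<ge>1. L n x \<le> C * D * L n z"
      by (smt (verit) mult.assoc mult_left_mono)
  next
    fix a assume a: "a \<in> V"
    obtain r \<delta> D B where r: "r > 0" "\<delta> > 0" "\<delta> \<le> r" "cball a r \<subseteq> V"
      and D: "\<And>n x y. n \<ge> 1 \<Longrightarrow> (\<forall>z\<in>cball a r. B \<le> cmod ((f ^^ n) z)) \<Longrightarrow>
        x \<in> ball a \<delta> \<Longrightarrow> y \<in> ball a \<delta> \<Longrightarrow> L n x \<le> D * L n y"
      using loc[OF a] unfolding L_def by blast
    have "\<exists>C\<ge>1. \<forall>x\<in>ball a \<delta>. \<forall>y\<in>ball a \<delta>. \<forall>n\<ge>1. L n x \<le> C * L n y"
    proof (rule ccontr)
      assume not: "\<not> ?thesis"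
      \<comment> \<open>The factor is at least 1, is at least \<open>D\<close>, and tends to
        infinity with \<open>k\<close>.\<close>
      have "\<exists>x y n. x \<in> ball a \<delta> \<and> y \<in> ball a \<delta> \<and> n \<ge> 1 \<and>
          (\<bar>D\<bar> + 1 + real k) * L n y < L n x" for k
      proof (rule ccontr)
        assume "\<not> ?thesis"
        then have "\<forall>x\<in>ball a \<delta>. \<forall>y\<in>ball a \<delta>. \<forall>n\<ge>1. L n x \<le> (\<bar>D\<bar> + 1 + real k) * L n y"
          by (meson not_less)
        then show False using not by (metis abs_ge_zero add_increasing add_increasing2 le_add_same_cancel2 of_nat_0_le_iff)
      qed
      then obtain x y n where xy: "\<And>k. x k \<in> ball a \<delta>" "\<And>k. y k \<in> ball a \<delta>" "\<And>k. n k \<ge> 1"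
        and big: "\<And>k. (\<bar>D\<bar> + 1 + real k) * L (n k) (y k) < L (n k) (x k)" by metis
      have lim: "filterlim (\<lambda>k. cmod ((f ^^ n k) (x k))) at_top sequentially"
        unfolding filterlim_at_top
      proof
        fix b
        obtain N where N: "\<Phi> b / c < real N" using reals_Archimedean2 by blast
        have "b \<le> cmod ((f ^^ n k) (x k))" if "k \<ge> N" for k
        proof (rule ccontr)
          assume "\<not> ?thesis"
          then have "L (n k) (x k) \<le> \<Phi> b" unfolding L_def by (intro monoD[OF \<Phi>(1)]) simp
          also have "\<Phi> b < real N * c" using N \<Phi>(2) by (simp add: field_simps)
          also have "\<dots> \<le> (\<bar>D\<bar> + 1 + real k) * L (n k) (y k)"
            using that L(1) \<Phi>(2) by (intro mult_mono) auto
          finally show False using big[of k] by simp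
        qed
        then show "\<forall>\<^sub>F k in sequentially. b \<le> cmod ((f ^^ n k) (x k))"
          unfolding eventually_sequentially by blast
      qed
      have xK: "x k \<in> cball a r" for k using xy(1)[of k] r by simp
      obtain \<rho> :: "nat \<Rightarrow> nat" where \<rho>: "strict_mono \<rho>"
        "\<And>L B. compact L \<Longrightarrow> L \<subseteq> V \<Longrightarrow>
           \<forall>\<^sub>F k in sequentially. \<forall>z\<in>L. B \<le> cmod ((f ^^ n (\<rho> k)) z)"
        using normal_iterates_diverge[OF V(3) xy(3) continuous_entire compact_cball r(4) xK lim] by blast
      have "\<forall>\<^sub>F k in sequentially. \<forall>z\<in>cball a r. B \<le> cmod ((f ^^ n (\<rho> k)) z)"
        using \<rho>(2)[OF compact_cball r(4)] .
      then obtain k where k: "\<forall>z\<in>cball a r. B \<le> cmod ((f ^^ n (\<rho> k)) z)"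
        by (auto simp: eventually_sequentially)
      have "L (n (\<rho> k)) (x (\<rho> k)) \<le> D * L (n (\<rho> k)) (y (\<rho> k))"
        by (rule D[OF xy(3) k xy(1,2)])
      also have "\<dots> \<le> (\<bar>D\<bar> + 1 + real (\<rho> k)) * L (n (\<rho> k)) (y (\<rho> k))"
        using L(2)[of "n (\<rho> k)" "y (\<rho> k)"] by (intro mult_right_mono) auto
      finally show False using big[of "\<rho> k"] by simp
    qed
    with r(2) show "\<exists>\<delta>>0. \<exists>C\<ge>1. \<forall>x\<in>ball a \<delta>. \<forall>y\<in>ball a \<delta>. \<forall>n\<ge>1. L n x \<le> C * L n y"
      by blast
  qed
  then show ?thesis unfolding L_def by blast
qed

text \<open>The truncation at 2 keeps the logarithms bounded below by \<open>ln 2\<close>; where the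
  iterate has modulus at least 2 it has no effect, and \<open>harnack_log\<close> applies.\<close>

lemma harnack_iterates:
  assumes V: "open V" "connected V" "normal_on V {f ^^ n | n. n \<ge> 1}"
    and K: "compact K" "K \<subseteq> V"
  shows "\<exists>C\<ge>1. \<forall>n\<ge>1. \<forall>x\<in>K. \<forall>y\<in>K.
    ln (max 2 (cmod ((f ^^ n) x))) \<le> C * ln (max 2 (cmod ((f ^^ n) y)))"
proof (rule iterates_comparable[OF V K, of "\<lambda>t. ln (max 2 t)" "ln 2"])
  show "mono (\<lambda>t::real. ln (max 2 t))" by (intro monoI) simp
  show "0 < ln (2::real)" by simp
  show "ln 2 \<le> ln (max 2 t)" for t :: real by simp
  fix a assume "a \<in> V"
  then obtain r where r: "r > 0" "cball a r \<subseteq> V" using V(1) open_contains_cball[of V] by blast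
  \<comment> \<open>With both points within \<open>r / 8\<close> of \<open>a\<close>, the disc of
    radius \<open>r / 2\<close> about \<open>y\<close> lies in \<open>cball a r\<close> and contains
    \<open>x\<close> in its concentric half.\<close>
  have "ln (max 2 (cmod ((f ^^ n) x))) \<le> 3 * ln (max 2 (cmod ((f ^^ n) y)))"
    if big: "\<forall>z\<in>cball a r. 2 \<le> cmod ((f ^^ n) z)" and xy: "x \<in> ball a (r/8)" "y \<in> ball a (r/8)"
    for n x y
  proof -
    have sub: "ball y (r/2) \<subseteq> cball a r"
    proof
      fix z assume "z \<in> ball y (r/2)"
      then show "z \<in> cball a r"
        using xy(2) r(1) dist_triangle[of a z y] by simp
    qed
    have "dist y x \<le> (r/2)/2"
      using xy r(1) dist_triangle[of y x a] by (simp add: dist_commute)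
    then have "ln (cmod ((f ^^ n) x)) \<le> 3 * ln (cmod ((f ^^ n) y))"
      using harnack_log[OF holomorphic_on_funpow, of "r/2" y n x] r(1) big sub by fastforce
    moreover have "x \<in> cball a r" "y \<in> cball a r" using xy r(1) by auto
    ultimately show ?thesis using big by (simp add: max_absorb2)
  qed
  then show "\<exists>r>0. \<exists>\<delta>>0. \<delta> \<le> r \<and> cball a r \<subseteq> V \<and> (\<exists>D B. \<forall>n\<ge>1.
      (\<forall>z\<in>cball a r. B \<le> cmod ((f ^^ n) z)) \<longrightarrow>
      (\<forall>x\<in>ball a \<delta>. \<forall>y\<in>ball a \<delta>. ln (max 2 (cmod ((f ^^ n) x))) \<le> D * ln (max 2 (cmod ((f ^^ n) y)))))"
    using r by (intro exI[of _ r] conjI exI[of _ "r/8"] exI[of _ 3] exI[of _ 2]) auto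
qed

end

section \<open>Unbounded Fatou components\<close>

text \<open>Cauchy's estimates on discs of radius \<open>M / 2\<close> show that all Taylor
  coefficients of order above \<open>C\<close> vanish, although the bound is known only for a
  sequence of radii.\<close>

lemma polynomial_if_bounded_on_discs:
  assumes f: "f holomorphic_on UNIV"
    and bound: "\<And>B. \<exists>M\<ge>B. \<forall>w\<in>ball 0 M. cmod (f w) \<le> M powr C"
  shows "\<exists>p. \<forall>z. f z = poly p z"
proof -
  obtain N :: nat where N: "C \<le> real N" using real_arch_simple by blast
  have zero: "(deriv ^^ j) f 0 = 0" if j: "N < j" for j
  proof (rule ccontr)
    assume ne: "(deriv ^^ j) f 0 \<noteq> 0"
    define c where "c = cmod ((deriv ^^ j) f 0)"
    have c: "c > 0" using ne by (simp add: c_def)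
    obtain M where M: "M \<ge> max 1 (fact j * 2 ^ j / c + 1)"
      and le: "\<And>w. w \<in> ball 0 M \<Longrightarrow> cmod (f w) \<le> M powr C" using bound by blast
    have M1: "M \<ge> 1" "fact j * 2 ^ j / c < M" using M by auto
    have "c \<le> fact j * M powr C / (M / 2) ^ j"
      unfolding c_def
    proof (rule Cauchy_inequality)
      show "f holomorphic_on ball 0 (M / 2)" by (rule holomorphic_on_subset[OF f]) simp
      show "continuous_on (cball 0 (M / 2)) f"
        by (rule holomorphic_on_imp_continuous_on[OF holomorphic_on_subset[OF f]]) simp
    qed (use M1 le in auto)
    also have "\<dots> = fact j * 2 ^ j * M powr C / M ^ j" by (simp add: power_divide)
    also have "\<dots> \<le> fact j * 2 ^ j * M ^ N / M ^ j"
      using M1 N powr_mono[of C "real N" M]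
      by (intro divide_right_mono mult_left_mono) (auto simp: powr_realpow)
    also have "\<dots> \<le> fact j * 2 ^ j * M ^ (j - 1) / M ^ j"
      using M1 j by (intro divide_right_mono mult_left_mono power_increasing) auto
    also have "\<dots> = fact j * 2 ^ j / M"
      using j M1 by (cases j) auto
    also have "\<dots> < c" using M1 c by (simp add: field_simps)
    finally show False by simp
  qed
  define p where "p = (\<Sum>j\<le>N. monom ((deriv ^^ j) f 0 / fact j) j)"
  have "f z = poly p z" for z
  proof -
    have "(\<lambda>j. (deriv ^^ j) f 0 / fact j * (z - 0) ^ j) sums f z"
      by (rule holomorphic_power_series[where r = "cmod z + 1"])
        (auto intro: holomorphic_on_subset[OF f])
    moreover have "(\<lambda>j. (deriv ^^ j) f 0 / fact j * (z - 0) ^ j) sums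
        (\<Sum>j\<le>N. (deriv ^^ j) f 0 / fact j * (z - 0) ^ j)"
      by (rule sums_finite) (use zero in auto)
    ultimately have "f z = (\<Sum>j\<le>N. (deriv ^^ j) f 0 / fact j * z ^ j)"
      using sums_unique2 by fastforce
    then show ?thesis by (simp add: p_def poly_sum poly_monom)
  qed
  then show ?thesis by blast
qed

lemma transcendental_entire_nonconstant:
  assumes "transcendental_entire f"
  shows "\<not> f constant_on UNIV"
proof
  assume "f constant_on UNIV"
  then obtain c where "\<forall>z. f z = c" unfolding constant_on_def by blast
  then have "\<forall>z. f z = poly [:c:] z" by simp
  then show False using assms unfolding transcendental_entire_def by blast
qed

text \<open>Supplies a bounded orbit, which serves as the permanently low point of the crossing
  property in \<open>circle_radius\<close>.\<close>

lemma transcendental_entire_period_2_point: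
  assumes "transcendental_entire f"
  obtains p where "f (f p) = p"
proof (rule holomorphic_involution_point)
  show "f holomorphic_on UNIV" using assms by (simp add: transcendental_entire_def)
  show "f \<noteq> (\<lambda>x. a + x)" for a
  proof
    assume "f = (\<lambda>x. a + x)"
    then have "\<forall>z. f z = poly [:a, 1:] z" by simp
    then show False using assms unfolding transcendental_entire_def by blast
  qed
qed

locale transcendental_growth =
  fixes f :: "complex \<Rightarrow> complex" and R :: real
  assumes entire: "transcendental_entire f"
    and adm_R: "admissible_radius f R"

sublocale transcendental_growth \<subseteq> nonconstant_entire f
  using entire transcendental_entire_nonconstant[OF entire]
  by unfold_locales (auto simp: transcendental_entire_def)

sublocale transcendental_growth \<subseteq> min_modulus_growth f R
  by unfold_locales (rule continuous_entire, rule adm_R)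

context nonconstant_entire
begin

lemma frontier_funpow_ball_image:
  "frontier ((f ^^ n) ` ball 0 \<rho>) \<subseteq> (f ^^ n) ` sphere 0 \<rho>"
proof -
  have "closed ((f ^^ n) ` cball 0 \<rho>)"
    by (intro compact_imp_closed compact_continuous_image continuous_on_iterate compact_cball)
  then have "closure ((f ^^ n) ` ball 0 \<rho>) \<subseteq> (f ^^ n) ` cball 0 \<rho>"
    by (intro closure_minimal image_mono ball_subset_cball)
  moreover have "interior ((f ^^ n) ` ball 0 \<rho>) = (f ^^ n) ` ball 0 \<rho>"
    by (intro interior_open open_funpow_image open_ball)
  ultimately have "frontier ((f ^^ n) ` ball 0 \<rho>) \<subseteq> (f ^^ n) ` cball 0 \<rho> - (f ^^ n) ` ball 0 \<rho>"
    unfolding frontier_def by blast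
  also have "\<dots> \<subseteq> (f ^^ n) ` (cball 0 \<rho> - ball 0 \<rho>)" by blast
  finally show ?thesis by (simp add: cball_diff_eq_sphere)
qed

text \<open>A disc that meets the image but is not covered by it would contain a frontier point of
  the image, and these come from the circle, where the modulus is at least \<open>M\<close>.\<close>

lemma ball_subset_funpow_ball_image:
  assumes "p \<in> ball 0 \<rho>" "cmod ((f ^^ n) p) < M"
    and ge: "\<And>z. z \<in> sphere 0 \<rho> \<Longrightarrow> M \<le> cmod ((f ^^ n) z)"
  shows "ball 0 M \<subseteq> (f ^^ n) ` ball 0 \<rho>"
proof (rule ccontr)
  assume "\<not> ?thesis"
  then have "ball 0 M - (f ^^ n) ` ball 0 \<rho> \<noteq> {}" by blast
  moreover have "ball 0 M \<inter> (f ^^ n) ` ball 0 \<rho> \<noteq> {}" using assms(1,2) by auto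
  ultimately have "ball 0 M \<inter> frontier ((f ^^ n) ` ball 0 \<rho>) \<noteq> {}"
    by (intro connected_Int_frontier) auto
  then obtain z where "z \<in> sphere 0 \<rho>" "(f ^^ n) z \<in> ball 0 M"
    using frontier_funpow_ball_image by blast
  then show False using ge[of z] by simp
qed

end

context transcendental_growth
begin

text \<open>If an unbounded component \<open>V\<close> contained a large circle, the iterates would
  diverge on \<open>V\<close> and \<open>V\<close> would be forward invariant. Harnack's inequality
  between the circle and its image then bounds \<open>f\<close> by a power of the radius on
  arbitrarily large discs, so \<open>f\<close> would be a polynomial.\<close>

lemma circle_radius:
  obtains \<rho>0 where "0 < \<rho>0"
    "\<And>V \<rho>. V \<in> components (fatou_set f) \<Longrightarrow> \<not> bounded V \<Longrightarrow> \<rho>0 \<le> \<rho> \<Longrightarrow> \<not> sphere 0 \<rho> \<subseteq> V"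
proof -
  obtain p where p: "f (f p) = p" using transcendental_entire_period_2_point[OF entire] .
  define P where "P = max (cmod p) (cmod (f p))"
  have orbit: "cmod ((f ^^ n) p) \<le> P" for n
  proof -
    have "(f ^^ n) p = p \<or> (f ^^ n) p = f p" by (induction n) (use p in auto)
    then show ?thesis by (auto simp: P_def)
  qed
  obtain k where k: "P \<le> rad k"
    using filterlim_rad unfolding filterlim_at_top eventually_sequentially by blast
  have "\<not> sphere 0 \<rho> \<subseteq> V"
    if V: "V \<in> components (fatou_set f)" "\<not> bounded V" and \<rho>: "rad (Suc k) \<le> \<rho>" for V \<rho>
  proof
    assume sub: "sphere 0 \<rho> \<subseteq> V"
    note VF = component_facts[OF V(1)]
    have \<rho>0: "\<rho> > 0" using rad_pos[of "Suc k"] \<rho> by linarith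
    have p_in: "p \<in> ball 0 \<rho>"
      using orbit[of 0] k \<rho> rad_less_Suc[of k] by simp
    \<comment> \<open>Crossing against the bounded orbit of \<open>p\<close> gives a high point in
      the closed disc; the maximum principle moves it to the circle.\<close>
    have large: "\<exists>w\<in>sphere 0 \<rho>. rad (Suc (k + n)) \<le> cmod ((f ^^ n) w)" for n
    proof -
      have "\<exists>w\<in>cball 0 \<rho>. rad (Suc (k + n)) \<le> cmod ((f ^^ n) w)"
      proof (rule crossing[where m = 0 and x = p and y = "complex_of_real \<rho>"])
        show "complex_of_real \<rho> \<in> cball 0 \<rho>" using \<rho>0 by simp
        show "cmod ((f ^^ i) p) \<le> rad (k + i)" for i
          using orbit[of i] k rad_mono[of k "k + i"] by simp
      qed (use p_in \<rho> \<rho>0 in auto)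
      then obtain w where w: "w \<in> cball 0 \<rho>" "rad (Suc (k + n)) \<le> cmod ((f ^^ n) w)" by blast
      have "compact ((\<lambda>z. cmod ((f ^^ n) z)) ` sphere 0 \<rho>)"
        by (intro compact_continuous_image continuous_intros continuous_on_iterate) simp
      moreover have "sphere (0::complex) \<rho> \<noteq> {}" using \<rho>0 by simp
      ultimately obtain v where v: "v \<in> sphere 0 \<rho>"
        "\<And>z. z \<in> sphere 0 \<rho> \<Longrightarrow> cmod ((f ^^ n) z) \<le> cmod ((f ^^ n) v)"
        using compact_attains_sup[of "(\<lambda>z. cmod ((f ^^ n) z)) ` sphere 0 \<rho>"] by blast
      have "cmod ((f ^^ n) w) \<le> cmod ((f ^^ n) v)"
      proof (rule maximum_modulus_frontier[of "f ^^ n" "cball 0 \<rho>"])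
        show "cmod ((f ^^ n) z) \<le> cmod ((f ^^ n) v)" if "z \<in> frontier (cball 0 \<rho>)" for z
          using v(2)[of z] that by simp
      qed (use w in \<open>auto intro: holomorphic_on_funpow continuous_on_iterate\<close>)
      with w(2) have "rad (Suc (k + n)) \<le> cmod ((f ^^ n) v)" by linarith
      with v(1) show ?thesis by blast
    qed
    \<comment> \<open>Any failure along a sequence of iterates is refuted by a subsequence that
      diverges on \<open>V\<close>, since every iterate is large somewhere on the circle.\<close>
    have escape: "\<forall>\<^sub>F n in sequentially. \<forall>z\<in>K. B \<le> cmod ((f ^^ n) z)"
      if K: "compact K" "K \<subseteq> V" for K B
    proof (rule ccontr)
      assume "\<not> ?thesis"
      then have "\<forall>N. \<exists>n\<ge>N. \<exists>z\<in>K. \<not> B \<le> cmod ((f ^^ n) z)"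
        unfolding eventually_sequentially by blast
      then have "\<forall>j. \<exists>n\<ge>Suc j. \<exists>z\<in>K. \<not> B \<le> cmod ((f ^^ n) z)" by blast
      then obtain n where n: "\<And>j. n j \<ge> Suc j" "\<And>j. \<exists>z\<in>K. \<not> B \<le> cmod ((f ^^ n j) z)"
        by metis
      have "\<forall>j. \<exists>w\<in>sphere 0 \<rho>. rad (Suc (k + n j)) \<le> cmod ((f ^^ n j) w)" using large by blast
      then obtain y where y: "\<And>j. y j \<in> sphere 0 \<rho>" "\<And>j. rad (Suc (k + n j)) \<le> cmod ((f ^^ n j) (y j))"
        by metis
      have n1: "n j \<ge> 1" for j using n(1)[of j] by simp
      have lim: "filterlim (\<lambda>j. cmod ((f ^^ n j) (y j))) at_top sequentially"
      proof (rule filterlim_at_top_mono[OF filterlim_rad])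
        show "\<forall>\<^sub>F j in sequentially. rad j \<le> cmod ((f ^^ n j) (y j))"
        proof (rule always_eventually, rule allI)
          fix j
          have "rad j \<le> rad (Suc (k + n j))" using n(1)[of j] by (intro rad_mono) simp
          then show "rad j \<le> cmod ((f ^^ n j) (y j))" using y(2)[of j] by linarith
        qed
      qed
      obtain \<sigma> :: "nat \<Rightarrow> nat" where \<sigma>: "strict_mono \<sigma>"
        "\<And>L B. compact L \<Longrightarrow> L \<subseteq> V \<Longrightarrow>
          \<forall>\<^sub>F j in sequentially. \<forall>z\<in>L. B \<le> cmod ((f ^^ n (\<sigma> j)) z)"
        using normal_iterates_diverge[OF VF(5) n1 cont compact_sphere sub y(1) lim] by blast
      obtain j where "\<forall>z\<in>K. B \<le> cmod ((f ^^ n (\<sigma> j)) z)"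
        using \<sigma>(2)[OF K, of B] unfolding eventually_sequentially by blast
      then show False using n(2) by blast
    qed
    obtain v0 where v0: "v0 \<in> V" using VF(3) by blast
    have "f ` V \<subseteq> V"
    proof -
      have "\<forall>\<^sub>F n in sequentially. \<forall>z\<in>sphere 0 \<rho>. max (P + 1) (cmod v0 + 1) \<le> cmod ((f ^^ n) z)"
        by (rule escape) (use sub in auto)
      then obtain N where N: "\<And>n z. n \<ge> N \<Longrightarrow> z \<in> sphere 0 \<rho> \<Longrightarrow>
          max (P + 1) (cmod v0 + 1) \<le> cmod ((f ^^ n) z)"
        unfolding eventually_sequentially by blast
      \<comment> \<open>The image of the disc covers \<open>v0\<close> but, being bounded, not all
        of \<open>V\<close>. So \<open>V\<close> meets its frontier, which comes from the circle and
        hence from \<open>V\<close>.\<close>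
      have ret: "(f ^^ n) ` V \<subseteq> V" if n: "n \<ge> N" for n
      proof -
        have "ball 0 (max (P + 1) (cmod v0 + 1)) \<subseteq> (f ^^ n) ` ball 0 \<rho>"
          by (rule ball_subset_funpow_ball_image[OF p_in]) (use orbit[of n] N[OF n] in auto)
        then have "v0 \<in> (f ^^ n) ` ball 0 \<rho>" by (rule subsetD) simp
        moreover have "bounded ((f ^^ n) ` ball 0 \<rho>)"
        proof (rule bounded_subset)
          show "bounded ((f ^^ n) ` cball 0 \<rho>)"
            by (intro compact_imp_bounded compact_continuous_image continuous_on_iterate) simp
        qed auto
        then have "\<not> V \<subseteq> (f ^^ n) ` ball 0 \<rho>" using V(2) bounded_subset by blast
        ultimately have "V \<inter> frontier ((f ^^ n) ` ball 0 \<rho>) \<noteq> {}"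
          using v0 by (intro connected_Int_frontier VF(2)) auto
        then obtain x where "x \<in> sphere 0 \<rho>" "(f ^^ n) x \<in> V"
          using frontier_funpow_ball_image by blast
        then have "fatou_iterate f V n = V"
          using sub by (intro fatou_iterate_eqI V(1)) auto
        then show ?thesis using fatou_iterate(2)[OF V(1), of n] by simp
      qed
      \<comment> \<open>Returns at two consecutive times make \<open>V\<close> invariant under
        \<open>f\<close> itself.\<close>
      have "(f ^^ N) v0 \<in> V" "(f ^^ Suc N) v0 \<in> V"
        using ret[of N] ret[of "Suc N"] v0 by auto
      then have "fatou_iterate f V 1 = V"
        by (intro fatou_iterate_eqI[of _ _ "(f ^^ N) v0"] V(1)) auto
      then show ?thesis using fatou_iterate(2)[OF V(1), of 1] by simp
    qed
    \<comment> \<open>Both \<open>x\<close> and \<open>f x\<close> must be compared for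
      \<open>x\<close> on the circle, because
      \<open>f ((f ^^ n) x) = (f ^^ n) (f x)\<close>.\<close>
    define K where "K = sphere 0 \<rho> \<union> f ` sphere 0 \<rho>"
    have K: "compact K" "K \<subseteq> V"
      unfolding K_def using sub \<open>f ` V \<subseteq> V\<close>
      by (auto intro!: compact_Un compact_continuous_image continuous_entire)
    obtain C where C: "C \<ge> 1" "\<And>n x y. n \<ge> 1 \<Longrightarrow> x \<in> K \<Longrightarrow> y \<in> K \<Longrightarrow>
        ln (max 2 (cmod ((f ^^ n) x))) \<le> C * ln (max 2 (cmod ((f ^^ n) y)))"
      using harnack_iterates[OF VF(1,2,5) K] by blast
    have "\<exists>M\<ge>B. \<forall>w\<in>ball 0 M. cmod (f w) \<le> M powr C" for B
    proof -
      have "\<forall>\<^sub>F n in sequentially. \<forall>z\<in>sphere 0 \<rho>. max (max B 2) (P + 1) \<le> cmod ((f ^^ n) z)"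
        by (rule escape) (use sub in auto)
      then have "\<forall>\<^sub>F n in sequentially. n \<ge> 1 \<and>
          (\<forall>z\<in>sphere 0 \<rho>. max (max B 2) (P + 1) \<le> cmod ((f ^^ n) z))"
        by (intro eventually_conj eventually_ge_at_top)
      then obtain n where n: "n \<ge> 1"
        "\<And>z. z \<in> sphere 0 \<rho> \<Longrightarrow> max (max B 2) (P + 1) \<le> cmod ((f ^^ n) z)"
        unfolding eventually_sequentially by blast
      have "compact ((\<lambda>z. cmod ((f ^^ n) z)) ` sphere 0 \<rho>)"
        by (intro compact_continuous_image continuous_intros continuous_on_iterate) simp
      moreover have "sphere (0::complex) \<rho> \<noteq> {}" using \<rho>0 by simp
      ultimately obtain y where y: "y \<in> sphere 0 \<rho>"
        "\<And>z. z \<in> sphere 0 \<rho> \<Longrightarrow> cmod ((f ^^ n) y) \<le> cmod ((f ^^ n) z)"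
        using compact_attains_inf[of "(\<lambda>z. cmod ((f ^^ n) z)) ` sphere 0 \<rho>"] by blast
      define M where "M = cmod ((f ^^ n) y)"
      have M: "M \<ge> B" "M \<ge> 2" "M \<ge> P + 1" using n(2)[OF y(1)] by (auto simp: M_def)
      have "ball 0 M \<subseteq> (f ^^ n) ` ball 0 \<rho>"
        by (rule ball_subset_funpow_ball_image[OF p_in])
          (use orbit[of n] M(3) y(2) in \<open>auto simp: M_def\<close>)
      moreover have "cmod (f w) \<le> M powr C" if w: "w \<in> (f ^^ n) ` ball 0 \<rho>" for w
      proof (rule maximum_modulus_frontier[of f, OF _ _ _ _ w])
        show "bounded ((f ^^ n) ` ball 0 \<rho>)"
        proof (rule bounded_subset)
          show "bounded ((f ^^ n) ` cball 0 \<rho>)"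
            by (intro compact_imp_bounded compact_continuous_image continuous_on_iterate) simp
        qed auto
        fix z assume "z \<in> frontier ((f ^^ n) ` ball 0 \<rho>)"
        then obtain x where x: "x \<in> sphere 0 \<rho>" "z = (f ^^ n) x"
          using frontier_funpow_ball_image by blast
        have "f z = (f ^^ n) (f x)" by (simp add: x(2) funpow_swap1)
        then have "ln (max 2 (cmod (f z))) \<le> C * ln (max 2 M)"
          using C(2)[OF n(1), of "f x" y] x(1) y(1) by (simp add: K_def M_def)
        then have "ln (max 2 (cmod (f z))) \<le> ln (M powr C)"
          using M(2) by (simp add: ln_powr max_absorb2)
        moreover have "0 < M powr C" using M(2) by simp
        moreover have "0 < max 2 (cmod (f z))" by simp
        ultimately have "max 2 (cmod (f z)) \<le> M powr C"
          using ln_le_cancel_iff[of "max 2 (cmod (f z))" "M powr C"] by blast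
        then show "cmod (f z) \<le> M powr C" by simp
      qed (auto intro: holomorphic_on_subset[OF hol] continuous_entire)
      ultimately show ?thesis using M(1) by blast
    qed
    then have "\<exists>p. \<forall>z. f z = poly p z" by (rule polynomial_if_bounded_on_discs[OF hol])
    then show False using entire unfolding transcendental_entire_def by blast
  qed
  then show ?thesis using that[OF rad_pos] by blast
qed

lemma unbounded_fatou_iterate:
  assumes "U \<in> components (fatou_set f)" "\<not> bounded U"
  shows "\<not> bounded (fatou_iterate f U n)"
  using unbounded_funpow_image[OF component_facts(2)[OF assms(1)] assms(2), of n]
    bounded_subset[OF _ fatou_iterate(2)[OF assms(1), of n]] by blast

text \<open>Where an iterate is at least \<open>max 1 \<rho>0\<close> on a disc, its image lies in
  an unbounded component and outside the disc of radius \<open>\<rho>0\<close>, so by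
  \<open>circle_radius\<close> it contains no circle about 0. This is the situation of
  \<open>ratio_bound_if_no_circle\<close>.\<close>

lemma ratio_bounded:
  assumes U: "U \<in> components (fatou_set f)" "\<not> bounded U" and xy: "x \<in> U" "y \<in> U"
  obtains C where "C \<ge> 1" "\<And>n. n \<ge> 1 \<Longrightarrow> cmod ((f ^^ n) x) \<le> C * max 1 (cmod ((f ^^ n) y))"
proof -
  note UF = component_facts[OF U(1)]
  obtain \<rho>0 where \<rho>0: "0 < \<rho>0"
    "\<And>V \<rho>. V \<in> components (fatou_set f) \<Longrightarrow> \<not> bounded V \<Longrightarrow> \<rho>0 \<le> \<rho> \<Longrightarrow> \<not> sphere 0 \<rho> \<subseteq> V"
    using circle_radius by blast
  have "\<exists>C\<ge>1. \<forall>n\<ge>1. \<forall>u\<in>{x, y}. \<forall>v\<in>{x, y}. max 1 (cmod ((f ^^ n) u)) \<le> C * max 1 (cmod ((f ^^ n) v))"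
  proof (rule iterates_comparable[where K = "{x, y}" and \<Phi> = "\<lambda>t. max 1 t" and c = 1, OF UF(1,2,5)])
    show "mono (\<lambda>t::real. max 1 t)" by (intro monoI) auto
    fix a assume "a \<in> U"
    then obtain r where r: "r > 0" "cball a r \<subseteq> U" using UF(1) open_contains_cball[of U] by blast
    have "max 1 (cmod ((f ^^ n) x)) \<le> exp 96 * max 1 (cmod ((f ^^ n) y))"
      if big: "\<forall>z\<in>cball a r. max 1 \<rho>0 \<le> cmod ((f ^^ n) z)"
        and xy: "x \<in> ball a (r/2)" "y \<in> ball a (r/2)" for n x y
    proof -
      have big': "max 1 \<rho>0 \<le> cmod ((f ^^ n) z)" if "z \<in> ball a r" for z
        using big that ball_subset_cball[of a r] by blast
      have "cmod ((f ^^ n) x) \<le> exp 96 * cmod ((f ^^ n) y)"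
      proof (rule ratio_bound_if_no_circle[OF holomorphic_on_funpow r(1) _ _ xy])
        show "(f ^^ n) z \<noteq> 0" if "z \<in> ball a r" for z using big'[OF that] by auto
        show "\<not> sphere 0 \<sigma> \<subseteq> (f ^^ n) ` ball a r" if \<sigma>: "0 < \<sigma>" for \<sigma>
        proof
          assume sub: "sphere 0 \<sigma> \<subseteq> (f ^^ n) ` ball a r"
          have "of_real \<sigma> \<in> sphere (0::complex) \<sigma>" using \<sigma> by simp
          then obtain z where z: "z \<in> ball a r" "of_real \<sigma> = (f ^^ n) z" using sub by blast
          then have "\<rho>0 \<le> \<sigma>" using big'[OF z(1)] \<sigma> by (simp flip: z(2))
          moreover have "sphere 0 \<sigma> \<subseteq> fatou_iterate f U n"
            using sub fatou_iterate(2)[OF U(1), of n] r(2) ball_subset_cball[of a r] by blast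
          ultimately show False
            using \<rho>0(2)[OF fatou_iterate(1)[OF U(1)] unbounded_fatou_iterate[OF U]] by blast
        qed
      qed
      moreover have "x \<in> cball a r" "y \<in> cball a r" using xy r(1) by auto
      then have "1 \<le> cmod ((f ^^ n) x)" "1 \<le> cmod ((f ^^ n) y)" using big by auto
      ultimately show ?thesis by (simp add: max_absorb2)
    qed
    then show "\<exists>r>0. \<exists>\<delta>>0. \<delta> \<le> r \<and> cball a r \<subseteq> U \<and> (\<exists>D B. \<forall>n\<ge>1.
        (\<forall>z\<in>cball a r. B \<le> cmod ((f ^^ n) z)) \<longrightarrow>
        (\<forall>x\<in>ball a \<delta>. \<forall>y\<in>ball a \<delta>. max 1 (cmod ((f ^^ n) x)) \<le> D * max 1 (cmod ((f ^^ n) y))))"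
      using r by (intro exI[of _ r] conjI exI[of _ "r/2"] exI[of _ "exp 96"] exI[of _ "max 1 \<rho>0"]) auto
  qed (use xy in auto)
  then obtain C where C: "C \<ge> 1" "\<And>n. n \<ge> 1 \<Longrightarrow> max 1 (cmod ((f ^^ n) x)) \<le> C * max 1 (cmod ((f ^^ n) y))"
    by blast
  show ?thesis
  proof (rule that[OF C(1)])
    fix n :: nat assume "n \<ge> 1"
    from C(2)[OF this] show "cmod ((f ^^ n) x) \<le> C * max 1 (cmod ((f ^^ n) y))" by linarith
  qed
qed

end

section \<open>Growth of the minimum modulus\<close>

lemma less_Liminf_imp_eventually_scaled:
  assumes "1 < Liminf at_top (\<lambda>r. ereal (g r / r))"
  obtains c :: real where "1 < c" "\<forall>\<^sub>F r in at_top. c * r \<le> g r"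
proof -
  obtain c where c: "1 < ereal c" "ereal c < Liminf at_top (\<lambda>r. ereal (g r / r))"
    using ereal_dense2[OF assms] by blast
  from less_LiminfD[OF c(2)] eventually_gt_at_top[of 0]
  have "\<forall>\<^sub>F r in at_top. c * r \<le> g r"
    by eventually_elim (simp add: field_simps)
  with c(1) that show ?thesis by simp
qed

lemma filterlim_quotient_imp_eventually_scaled:
  fixes g :: "real \<Rightarrow> real"
  assumes "filterlim (\<lambda>r. g r / r) at_top at_top"
  shows "\<forall>\<^sub>F r in at_top. c * r \<le> g r"
proof -
  have "\<forall>\<^sub>F r in at_top. c \<le> g r / r" using assms by (simp add: filterlim_at_top)
  then show ?thesis
    using eventually_gt_at_top[of 0] by eventually_elim (simp add: field_simps)
qed

lemma max_min_modulus_nonneg: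
  assumes "continuous_on UNIV f" "0 \<le> r"
  shows "0 \<le> max_min_modulus f r"
  using min_modulus_le_max_min_modulus[OF assms(1) order_refl assms(2)]
    min_modulus_nonneg[OF order_refl, of f] by linarith

lemma log_growth_imp_power_growth:
  assumes f: "continuous_on UNIV f"
    and lim: "filterlim (\<lambda>r. ln (max_min_modulus f r) / ln r) at_top at_top" and "0 < K"
  shows "\<forall>\<^sub>F r in at_top. r powr K \<le> max_min_modulus f r"
proof -
  have "\<forall>\<^sub>F r in at_top. K \<le> ln (max_min_modulus f r) / ln r"
    using lim by (simp add: filterlim_at_top)
  then show ?thesis
    using eventually_gt_at_top[of 1]
  proof eventually_elim
    case (elim r)
    then have "0 < ln r" by simp
    then have le: "K * ln r \<le> ln (max_min_modulus f r)" using elim(1) by (simp add: field_simps)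
    moreover have "0 < K * ln r" using \<open>0 < K\<close> \<open>0 < ln r\<close> by simp
    \<comment> \<open>Since \<open>ln 0\<close> is 0 by convention, positivity of the logarithm
      excludes the value 0.\<close>
    ultimately have "max_min_modulus f r \<noteq> 0" by auto
    then have "0 < max_min_modulus f r"
      using max_min_modulus_nonneg[OF f, of r] elim(2) by simp
    then have "exp (K * ln r) \<le> max_min_modulus f r" using le by (metis exp_le_cancel_iff exp_ln)
    then show ?case using elim(2) by (simp add: powr_def)
  qed
qed

lemma log_growth_imp_linear_growth:
  assumes f: "continuous_on UNIV f"
    and lim: "filterlim (\<lambda>r. ln (max_min_modulus f r) / ln r) at_top at_top"
  shows "filterlim (\<lambda>r. max_min_modulus f r / r) at_top at_top"
proof (rule filterlim_at_top_mono[OF filterlim_ident])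
  show "\<forall>\<^sub>F r in at_top. r \<le> max_min_modulus f r / r"
  proof -
    have "\<forall>\<^sub>F r in at_top. r powr 2 \<le> max_min_modulus f r"
      by (rule log_growth_imp_power_growth[OF f lim]) simp
    then show ?thesis
      using eventually_gt_at_top[of 0]
      by eventually_elim (simp add: le_divide_eq power2_eq_square)
  qed
qed

context min_modulus_growth
begin

lemma rad_power_growth:
  assumes c: "0 \<le> c" "\<And>n. n \<ge> n0 \<Longrightarrow> c * rad n \<le> rad (Suc n)" and "n0 \<le> n"
  shows "c ^ k * rad n \<le> rad (n + k)"
proof (induction k)
  case (Suc k)
  have "c ^ Suc k * rad n = c * (c ^ k * rad n)" by simp
  also have "\<dots> \<le> c * rad (n + k)" using Suc c(1) by (intro mult_left_mono)
  also have "\<dots> \<le> rad (Suc (n + k))" using c(2) \<open>n0 \<le> n\<close> by simp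
  finally show ?case by simp
qed simp

lemma eventually_scaled_imp_rad:
  assumes "\<forall>\<^sub>F r in at_top. c * r \<le> max_min_modulus f r"
  obtains n0 where "\<And>n. n \<ge> n0 \<Longrightarrow> c * rad n \<le> rad (Suc n)"
proof -
  have "\<forall>\<^sub>F n in sequentially. c * rad n \<le> max_min_modulus f (rad n)"
    by (rule eventually_compose_filterlim[OF assms filterlim_rad])
  then show ?thesis
    using that unfolding eventually_sequentially rad_Suc by blast
qed

text \<open>Raising to the power \<open>K\<close> adds \<open>ln K\<close> to the iterated
  logarithm, so \<open>ln (ln (rad n))\<close> grows faster than every linear function. The shift
  \<open>l\<close> accommodates the preimages in \<open>V_plus\<close>.\<close>

lemma ln_ln_rad_growth:
  assumes "filterlim (\<lambda>r. ln (max_min_modulus f r) / ln r) at_top at_top"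
  shows "filterlim (\<lambda>n. ln (ln (rad n)) / real (n + l)) at_top sequentially"
  unfolding filterlim_at_top
proof
  fix B :: real
  \<comment> \<open>Each step gains \<open>2 * b\<close>. One half is the required rate; the other
    absorbs the fixed losses from \<open>n0\<close>, \<open>l\<close> and the initial value.\<close>
  define b where "b = \<bar>B\<bar> + 1"
  define K where "K = exp (2 * b)"
  have "\<forall>\<^sub>F r in at_top. r powr K \<le> max_min_modulus f r"
    by (rule log_growth_imp_power_growth[OF cont assms]) (simp add: K_def)
  then have "\<forall>\<^sub>F n in sequentially. rad n powr K \<le> max_min_modulus f (rad n)"
    by (rule eventually_compose_filterlim[OF _ filterlim_rad])
  moreover have "\<forall>\<^sub>F n in sequentially. 1 < rad n"
    using filterlim_rad by (simp add: filterlim_at_top_dense)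
  ultimately have "\<forall>\<^sub>F n in sequentially. rad n powr K \<le> max_min_modulus f (rad n) \<and> 1 < rad n"
    by (rule eventually_conj)
  then obtain n0 where n0: "\<And>n. n \<ge> n0 \<Longrightarrow> rad n powr K \<le> rad (Suc n)" "\<And>n. n \<ge> n0 \<Longrightarrow> 1 < rad n"
    unfolding eventually_sequentially rad_Suc by blast
  have step: "2 * b + ln (ln (rad n)) \<le> ln (ln (rad (Suc n)))" if n: "n \<ge> n0" for n
  proof -
    have pos: "0 < ln (rad n)" using n0(2)[OF n] by simp
    have "ln (rad n powr K) \<le> ln (rad (Suc n))"
      using n0(1)[OF n] n0(2)[OF n] n0(2)[of "Suc n"] n by (subst ln_le_cancel_iff) auto
    then have "K * ln (rad n) \<le> ln (rad (Suc n))" using n0(2)[OF n] by (simp add: ln_powr)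
    moreover have "0 < K * ln (rad n)" using pos by (simp add: K_def)
    ultimately have "ln (K * ln (rad n)) \<le> ln (ln (rad (Suc n)))"
      by (subst ln_le_cancel_iff) auto
    then show ?thesis using pos by (simp add: ln_mult K_def)
  qed
  have lower: "2 * b * real k + ln (ln (rad n0)) \<le> ln (ln (rad (n0 + k)))" for k
  proof (induction k)
    case (Suc k)
    then show ?case using step[of "n0 + k"] by (simp add: algebra_simps)
  qed simp
  obtain M :: nat where M: "(2 * b * real n0 + b * real l - ln (ln (rad n0))) / b \<le> real M"
    using real_arch_simple by blast
  have b: "b > 0" "B \<le> b" by (auto simp: b_def)
  have "B \<le> ln (ln (rad n)) / real (n + l)" if n: "n \<ge> max (max n0 M) 1" for n
  proof -
    have "real M \<le> real n" using n by simp
    then have "(2 * b * real n0 + b * real l - ln (ln (rad n0))) / b \<le> real n" using M by linarith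
    then have "2 * b * real n0 + b * real l - ln (ln (rad n0)) \<le> b * real n"
      using b(1) by (simp only: pos_divide_le_eq mult.commute[of b])
    moreover have "2 * b * (real n - real n0) + ln (ln (rad n0)) \<le> ln (ln (rad n))"
      using lower[of "n - n0"] n by (simp add: of_nat_diff)
    ultimately have "b * (real n + real l) \<le> ln (ln (rad n))" by (simp add: algebra_simps)
    moreover have "B * (real n + real l) \<le> b * (real n + real l)"
      using b by (intro mult_right_mono) auto
    moreover have "0 < real n + real l" using n by simp
    ultimately have "B * real (n + l) \<le> ln (ln (rad n))" "0 < real (n + l)"
      unfolding of_nat_add by linarith+
    then show ?thesis by (simp only: pos_le_divide_eq)
  qed
  then show "\<forall>\<^sub>F n in sequentially. B \<le> ln (ln (rad n)) / real (n + l)"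
    unfolding eventually_sequentially by blast
qed

lemma V_plus_subset_Z_plus:
  assumes "filterlim (\<lambda>r. ln (max_min_modulus f r) / ln r) at_top at_top"
  shows "V_plus f \<subseteq> Z_plus f"
proof
  fix z assume "z \<in> V_plus f"
  then obtain l where l: "\<And>N. \<exists>n\<ge>N. rad n \<le> cmod ((f ^^ (n + l)) z)"
    using V_plus_high by blast
  define S where "S = {n. 1 \<le> n \<and> rad n \<le> cmod ((f ^^ (n + l)) z)}"
  have "infinite S"
    unfolding infinite_nat_iff_unbounded_le
  proof
    fix N
    obtain n where "n \<ge> max N 1" "rad n \<le> cmod ((f ^^ (n + l)) z)" using l by blast
    then show "\<exists>n\<ge>N. n \<in> S" unfolding S_def by (intro exI[of _ n]) auto
  qed
  define \<mu> where "\<mu> = enumerate S"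
  have \<mu>: "strict_mono \<mu>" "\<And>j. \<mu> j \<in> S"
    unfolding \<mu>_def using \<open>infinite S\<close> strict_mono_enumerate enumerate_in_set by auto
  have \<mu>_lim: "filterlim \<mu> at_top sequentially" by (rule filterlim_subseq[OF \<mu>(1)])
  have "filterlim (\<lambda>j. log_plus (log_plus (cmod ((f ^^ (\<mu> j + l)) z))) / real (\<mu> j + l)) at_top sequentially"
  proof (rule filterlim_at_top_mono[OF filterlim_compose[OF ln_ln_rad_growth[OF assms] \<mu>_lim]])
    have "\<forall>\<^sub>F n in sequentially. exp 1 < rad n"
      using filterlim_rad by (simp add: filterlim_at_top_dense)
    then have "\<forall>\<^sub>F j in sequentially. exp 1 < rad (\<mu> j)"
      by (rule eventually_compose_filterlim[OF _ \<mu>_lim])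
    then show "\<forall>\<^sub>F j in sequentially. ln (ln (rad (\<mu> j))) / real (\<mu> j + l)
        \<le> log_plus (log_plus (cmod ((f ^^ (\<mu> j + l)) z))) / real (\<mu> j + l)"
    proof eventually_elim
      case (elim j)
      let ?a = "cmod ((f ^^ (\<mu> j + l)) z)"
      have a: "rad (\<mu> j) \<le> ?a" using \<mu>(2)[of j] by (simp add: S_def)
      have "0 < rad (\<mu> j)" by (rule rad_pos)
      have "1 < ln (rad (\<mu> j))" using elim \<open>0 < rad (\<mu> j)\<close> by (metis exp_less_cancel_iff exp_ln)
      moreover have "ln (rad (\<mu> j)) \<le> ln ?a" using a \<open>0 < rad (\<mu> j)\<close> by (subst ln_le_cancel_iff) auto
      ultimately have pos: "0 < ln (rad (\<mu> j))" "0 < ln ?a" "ln (rad (\<mu> j)) \<le> ln ?a" by linarith+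
      then have "ln (ln (rad (\<mu> j))) \<le> ln (ln ?a)" by (subst ln_le_cancel_iff) auto
      also have "\<dots> \<le> log_plus (ln ?a)" using pos(2) unfolding log_plus_def by simp
      also have "ln ?a = log_plus ?a"
        using a \<open>0 < rad (\<mu> j)\<close> pos(2) by (simp add: log_plus_def max_absorb1)
      finally have "ln (ln (rad (\<mu> j))) \<le> log_plus (log_plus ?a)" .
      then show ?case by (intro divide_right_mono) auto
    qed
  qed
  moreover have "strict_mono (\<lambda>j. \<mu> j + l)" using \<mu>(1) by (simp add: strict_mono_def)
  moreover have "\<mu> j + l \<ge> 1" for j using \<mu>(2)[of j] by (simp add: S_def)
  ultimately show "z \<in> Z_plus f" unfolding Z_plus_def by blast
qed

end

section \<open>Consequences of linear and superlinear growth for unbounded components\<close>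

context transcendental_growth
begin

text \<open>A point \<open>w\<close> of \<open>U\<close> in \<open>V_plus f\<close> is compared with
  \<open>z\<close> by \<open>ratio_bounded\<close>. The constant \<open>C\<close> is less than
  \<open>c ^ k\<close>, so it costs at most \<open>k\<close> steps of \<open>rad\<close>, which are
  added to the shift.\<close>

lemma subset_V_plus:
  assumes U: "U \<in> components (fatou_set f)" "\<not> bounded U"
    and c: "1 < c" "\<forall>\<^sub>F r in at_top. c * r \<le> max_min_modulus f r"
  shows "U \<subseteq> V_plus f"
proof
  fix z assume z: "z \<in> U"
  note UF = component_facts[OF U(1)]
  obtain w where w: "w \<in> U" "w \<in> V_plus f" using unbounded_meets_V_plus[OF UF(1,2) U(2)] by blast
  obtain l where l: "\<And>N. \<exists>n\<ge>N. rad n \<le> cmod ((f ^^ (n + l)) w)" using V_plus_high[OF w(2)] by blast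
  obtain C where C: "C \<ge> 1" "\<And>n. n \<ge> 1 \<Longrightarrow> cmod ((f ^^ n) w) \<le> C * max 1 (cmod ((f ^^ n) z))"
    using ratio_bounded[OF U w(1) z] by blast
  obtain n0 where n0: "\<And>n. n \<ge> n0 \<Longrightarrow> c * rad n \<le> rad (Suc n)"
    using eventually_scaled_imp_rad[OF c(2)] by blast
  obtain k where k: "C < c ^ k" using real_arch_pow[OF c(1)] by blast
  obtain n1 where n1: "C < rad n1"
    using filterlim_rad unfolding filterlim_at_top_dense eventually_sequentially by blast
  have "\<exists>n\<ge>N. rad n \<le> cmod ((f ^^ (n + (l + k))) z)" for N
  proof -
    obtain n where n: "n \<ge> Suc (N + k + n0 + n1)" "rad n \<le> cmod ((f ^^ (n + l)) w)" using l by blast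
    define m where "m = n - k"
    have m: "n = m + k" "m \<ge> N" "m \<ge> n0" using n(1) by (auto simp: m_def)
    have le: "rad n \<le> C * max 1 (cmod ((f ^^ (n + l)) z))"
      using n(2) C(2)[of "n + l"] n(1) by simp
    \<comment> \<open>Ensures that the truncation at 1 in \<open>ratio_bounded\<close> is not
      active.\<close>
    have "C < rad n" using n1 rad_mono[of n1 n] n(1) by simp
    have "1 \<le> cmod ((f ^^ (n + l)) z)"
    proof (rule ccontr)
      assume "\<not> ?thesis"
      then have "rad n \<le> C" using le by simp
      with \<open>C < rad n\<close> show False by simp
    qed
    then have "rad n \<le> C * cmod ((f ^^ (n + l)) z)" using le by (simp add: max_absorb2)
    moreover have "C * rad m \<le> c ^ k * rad m" using k rad_pos[of m] by simp
    moreover have "c ^ k * rad m \<le> rad n"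
      unfolding m(1) by (rule rad_power_growth[OF _ n0 m(3)]) (use c in auto)
    ultimately have "C * rad m \<le> C * cmod ((f ^^ (n + l)) z)" by linarith
    then have "rad m \<le> cmod ((f ^^ (m + (l + k))) z)"
      using C(1) m(1) by (simp add: ac_simps)
    then show ?thesis using m(2) by blast
  qed
  then show "z \<in> V_plus f" unfolding V_plus_iff by blast
qed

lemma iterate_eq_imp_periodic:
  assumes U: "U \<in> components (fatou_set f)" and eq: "fatou_iterate f U m = fatou_iterate f U n"
    and u: "u \<in> U" and "m \<le> n"
  shows "(f ^^ m) u \<in> fatou_iterate f U m" "(f ^^ (n - m)) ((f ^^ m) u) \<in> fatou_iterate f U m"
    "fatou_iterate f (fatou_iterate f U m) (n - m) = fatou_iterate f U m"
proof -
  show a: "(f ^^ m) u \<in> fatou_iterate f U m" using fatou_iterate(2)[OF U, of m] u by blast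
  have "(f ^^ (n - m)) ((f ^^ m) u) = (f ^^ n) u"
    using \<open>m \<le> n\<close> by (simp flip: funpow_add[unfolded o_def, THEN fun_cong])
  then show b: "(f ^^ (n - m)) ((f ^^ m) u) \<in> fatou_iterate f U m"
    unfolding eq using fatou_iterate(2)[OF U, of n] u by auto
  show "fatou_iterate f (fatou_iterate f U m) (n - m) = fatou_iterate f U m"
    by (rule fatou_iterate_eqI[OF fatou_iterate(1)[OF U] fatou_iterate(1)[OF U] a b])
qed

text \<open>On a periodic component \<open>z\<close> and \<open>(f ^^ p) z\<close> are comparable,
  so the orbit of \<open>z\<close> grows at most like \<open>C ^ j\<close>. Superlinear growth makes
  \<open>rad\<close> grow at least like \<open>(2 * C) ^ j\<close>, and \<open>z\<close> lies in
  \<open>V_plus f\<close>.\<close>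

lemma wandering_if_superlinear:
  assumes U: "U \<in> components (fatou_set f)" "\<not> bounded U"
    and lim: "filterlim (\<lambda>r. max_min_modulus f r / r) at_top at_top"
  shows "wandering_domain f U"
proof -
  have False if mn: "m < n" and eq: "fatou_iterate f U m = fatou_iterate f U n" for m n
  proof -
    define V where "V = fatou_iterate f U m"
    define p where "p = n - m"
    have p: "p \<ge> 1" using mn by (simp add: p_def)
    obtain u where u: "u \<in> U" using component_facts(3)[OF U(1)] by blast
    define z where "z = (f ^^ m) u"
    have z: "z \<in> V" "(f ^^ p) z \<in> V"
      using iterate_eq_imp_periodic[OF U(1) eq u] mn by (auto simp: V_def z_def p_def)
    have V: "V \<in> components (fatou_set f)" "\<not> bounded V"
      unfolding V_def using fatou_iterate(1)[OF U(1)] unbounded_fatou_iterate[OF U] by auto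
    have "\<forall>\<^sub>F r in at_top. 2 * r \<le> max_min_modulus f r"
      by (rule filterlim_quotient_imp_eventually_scaled[OF lim])
    then have "z \<in> V_plus f" using subset_V_plus[OF V, of 2] z(1) by auto
    then obtain l where l: "\<And>N. \<exists>n\<ge>N. rad n \<le> cmod ((f ^^ (n + l)) z)" using V_plus_high by blast
    obtain C where C: "C \<ge> 1" "\<And>n. n \<ge> 1 \<Longrightarrow> cmod ((f ^^ n) ((f ^^ p) z)) \<le> C * max 1 (cmod ((f ^^ n) z))"
      using ratio_bounded[OF V z(2,1)] by blast
    define a where "a j = max 1 (cmod ((f ^^ j) z))" for j
    \<comment> \<open>Covers the first period; afterwards each block of \<open>p\<close> steps costs
      one factor \<open>C\<close>.\<close>
    define A where "A = Max (a ` {..p})"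
    have a_le: "a j \<le> A" if "j \<le> p" for j
      unfolding A_def using that by (intro Max_ge) auto
    have "A \<ge> 1" using a_le[of 0] by (simp add: a_def)
    have bound: "a j \<le> A * C ^ j" for j
    proof (induction j rule: less_induct)
      case (less j)
      show ?case
      proof (cases "j \<le> p")
        case True
        have "A * 1 \<le> A * C ^ j" using \<open>A \<ge> 1\<close> C(1) by (intro mult_left_mono) auto
        then show ?thesis using a_le[OF True] by simp
      next
        case False
        define i where "i = j - p"
        have i: "j = i + p" "i \<ge> 1" "i < j" using False p by (auto simp: i_def)
        have "cmod ((f ^^ j) z) \<le> C * a i" using C(2)[OF i(2)] by (simp add: i(1) funpow_add a_def)
        moreover have "1 * 1 \<le> C * a i" using C(1) by (intro mult_mono) (auto simp: a_def)
        ultimately have "a j \<le> C * a i" by (simp add: a_def[of j])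
        also have "\<dots> \<le> C * (A * C ^ i)" using less[OF i(3)] C(1) by (intro mult_left_mono) auto
        also have "\<dots> = A * C ^ Suc i" by simp
        also have "\<dots> \<le> A * C ^ j"
          using \<open>A \<ge> 1\<close> C(1) i(1) p by (intro mult_left_mono power_increasing) auto
        finally show ?thesis .
      qed
    qed
    obtain n0 where n0: "\<And>n. n \<ge> n0 \<Longrightarrow> (2 * C) * rad n \<le> rad (Suc n)"
      using eventually_scaled_imp_rad[OF filterlim_quotient_imp_eventually_scaled[OF lim]] by blast
    \<comment> \<open>After cancelling \<open>C ^ i\<close> this would bound \<open>2 ^ i\<close>
      for arbitrarily large \<open>i\<close>.\<close>
    define D where "D = A * C ^ (n0 + l) / rad n0"
    obtain k where k: "D < 2 ^ k" using real_arch_pow[of 2 D] by auto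
    obtain n where n: "n \<ge> n0 + k" "rad n \<le> cmod ((f ^^ (n + l)) z)" using l by blast
    define i where "i = n - n0"
    have i: "n = n0 + i" "k \<le> i" using n(1) by (auto simp: i_def)
    have "(2 * C) ^ i * rad n0 \<le> rad n"
      unfolding i(1) by (rule rad_power_growth[OF _ n0]) (use C in auto)
    also have "\<dots> \<le> A * C ^ (n + l)" using n(2) bound[of "n + l"] by (simp add: a_def)
    also have "\<dots> = C ^ i * (A * C ^ (n0 + l))" by (simp add: i(1) power_add)
    finally have "C ^ i * (2 ^ i * rad n0) \<le> C ^ i * (A * C ^ (n0 + l))"
      by (simp add: power_mult_distrib ac_simps)
    then have "2 ^ i * rad n0 \<le> A * C ^ (n0 + l)" using C(1) by simp
    then have "2 ^ i \<le> D" using rad_pos[of n0] by (simp add: D_def field_simps)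
    moreover have "(2::real) ^ k \<le> 2 ^ i" using i(2) by (intro power_increasing) auto
    ultimately show False using k by linarith
  qed
  then have "fatou_iterate f U m \<noteq> fatou_iterate f U n" if "m \<noteq> n" for m n
    using that by (metis linorder_neqE_nat)
  then show ?thesis unfolding wandering_domain_def using U(1) by blast
qed

end

section \<open>Periodic components\<close>

text \<open>A fixed point of \<open>x - F x + w\<close> is a solution of \<open>F x = w\<close>, and
  closeness to the identity makes this map preserve the ball.\<close>

lemma surjective_near_identity:
  fixes F :: "'a::euclidean_space \<Rightarrow> 'a"
  assumes "0 < e" "continuous_on (cball w e) F" "\<And>x. x \<in> cball w e \<Longrightarrow> dist (F x) x \<le> e"
  obtains x where "x \<in> cball w e" "F x = w"
proof (rule brouwer_ball[OF assms(1), of w "\<lambda>x. x - F x + w"])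
  show "continuous_on (cball w e) (\<lambda>x. x - F x + w)" by (intro continuous_intros assms)
  show "(\<lambda>x. x - F x + w) \<in> cball w e \<rightarrow> cball w e"
  proof
    fix x assume "x \<in> cball w e"
    then have "dist (F x) x \<le> e" by (rule assms(3))
    moreover have "dist w (x - F x + w) = dist (F x) x"
      by (simp add: dist_norm algebra_simps norm_minus_commute)
    ultimately show "x - F x + w \<in> cball w e" by simp
  qed
  show "\<And>x. x \<in> cball w e \<Longrightarrow> x - F x + w = x \<Longrightarrow> thesis" using that by (simp add: algebra_simps)
qed

text \<open>The induction on the fixed exponent \<open>i\<close> needs uniform convergence on a
  compact neighbourhood of \<open>K\<close>, since the inner iterate moves points slightly off
  \<open>K\<close>.\<close>

lemma uniform_limit_funpow_ident:
  fixes F :: "nat \<Rightarrow> complex \<Rightarrow> complex"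
  assumes V: "open V"
    and F: "\<And>K. compact K \<Longrightarrow> K \<subseteq> V \<Longrightarrow> uniform_limit K F (\<lambda>z. z) sequentially"
    and K: "compact K" "K \<subseteq> V"
  shows "uniform_limit K (\<lambda>k. F k ^^ i) (\<lambda>z. z) sequentially"
proof (induction i)
  case 0
  show ?case by (auto simp: uniform_limit_iff)
next
  case (Suc i)
  obtain \<delta> where \<delta>: "\<delta> > 0" "(\<Union>x\<in>K. cball x \<delta>) \<subseteq> V"
    using compact_subset_open_imp_cball_epsilon_subset[OF K(1) V K(2)] by blast
  define L where "L = (\<Union>x\<in>K. cball x \<delta>)"
  have L: "compact L" "L \<subseteq> V" unfolding L_def using compact_minkowski_sum_cball[OF K(1)] \<delta> by auto
  show ?case
    unfolding uniform_limit_iff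
  proof (intro allI impI)
    fix e :: real assume e: "e > 0"
    have "\<forall>\<^sub>F k in sequentially. \<forall>z\<in>K. dist ((F k ^^ i) z) z < min \<delta> (e/2)"
      by (rule uniform_limitD[OF Suc]) (use \<delta> e in auto)
    moreover have "\<forall>\<^sub>F k in sequentially. \<forall>z\<in>L. dist (F k z) z < e/2"
      by (rule uniform_limitD[OF F[OF L]]) (use e in auto)
    ultimately show "\<forall>\<^sub>F k in sequentially. \<forall>z\<in>K. dist ((F k ^^ Suc i) z) z < e"
    proof eventually_elim
      case (elim k)
      show ?case
      proof
        fix z assume z: "z \<in> K"
        let ?w = "(F k ^^ i) z"
        have w: "dist ?w z < \<delta>" "dist ?w z < e/2" using elim(1) z by auto
        then have "?w \<in> L" unfolding L_def using z by (auto simp: dist_commute intro!: bexI[of _ z])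
        then have "dist (F k ?w) ?w < e/2" using elim(2) by blast
        then have "dist (F k ?w) z < e" using w(2) dist_triangle[of "F k ?w" z ?w] by linarith
        then show "dist ((F k ^^ Suc i) z) z < e" by simp
      qed
    qed
  qed
qed

lemma path_to_sphere:
  assumes V: "open V" "connected V" "z \<in> V" "\<not> bounded V" and "cmod z < t"
  obtains \<Gamma> b where "compact \<Gamma>" "connected \<Gamma>" "\<Gamma> \<subseteq> V" "\<Gamma> \<subseteq> cball 0 t" "z \<in> \<Gamma>" "b \<in> \<Gamma>" "cmod b = t"
proof -
  obtain y where y: "y \<in> V" "\<not> cmod y \<le> t" using V(4) unfolding bounded_iff by blast
  obtain g where g: "path g" "path_image g \<subseteq> V" "pathstart g = z" "pathfinish g = y"
    using connected_open_path_connected[OF V(1,2)] V(3) y(1) unfolding path_connected_def by blast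
  have "0 < t" using assms(5) norm_ge_zero[of z] by linarith
  have "pathstart g \<in> closure (ball 0 t)"
    using g(3) assms(5) by (intro subsetD[OF closure_subset]) simp
  moreover have "pathfinish g \<notin> ball 0 t" using g(4) y(2) by simp
  ultimately obtain h where h: "path h" "pathstart h = pathstart g" "path_image h \<subseteq> path_image g"
    "path_image h - {pathfinish h} \<subseteq> interior (ball 0 t)" "pathfinish h \<in> frontier (ball 0 t)"
    using exists_path_subpath_to_frontier[OF g(1)] by blast
  have fin: "cmod (pathfinish h) = t" using h(5) \<open>0 < t\<close> by simp
  have "path_image h \<subseteq> cball 0 t"
  proof
    fix x assume "x \<in> path_image h"
    then show "x \<in> cball 0 t"
      using h(4) fin by (cases "x = pathfinish h") auto
  qed
  then show ?thesis
    using that[of "path_image h" "pathfinish h"] h g fin compact_path_image[OF h(1)]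
      connected_path_image[OF h(1)] pathstart_in_path_image[of h] pathfinish_in_path_image[of h]
    by (metis order_trans)
qed

section \<open>Recurrence and limit functions on forward invariant domains\<close>

context transcendental_growth
begin

text \<open>Convergence to the identity makes a suitable iterate \<open>H\<close> an automorphism of
  \<open>V\<close>. By the crossing property its inverse \<open>G\<close> sends every point joined
  to \<open>z0\<close> inside a large disc into a smaller disc, whereas recurrence returns a point
  outside the smaller disc close to itself.\<close>

lemma no_recurrence_to_identity:
  assumes V: "open V" "connected V" "V \<noteq> {}" "\<not> bounded V"
    and p: "1 \<le> p" "(f ^^ p) ` V \<subseteq> V" and m: "\<And>k. 1 \<le> m k"
    and lim: "\<And>K. compact K \<Longrightarrow> K \<subseteq> V \<Longrightarrow> uniform_limit K (\<lambda>k. (f ^^ p) ^^ m k) (\<lambda>z. z) sequentially"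
  shows False
proof -
  obtain z0 where z0: "z0 \<in> V" using V(3) by blast
  obtain \<epsilon> where \<epsilon>: "\<epsilon> > 0" "cball z0 \<epsilon> \<subseteq> V" using V(1) z0 open_contains_cball[of V] by blast
  \<comment> \<open>One exponent is fixed such that \<open>H\<close> moves \<open>z0\<close> by less
    than \<open>\<epsilon>\<close>, so that the segment from \<open>H z0\<close> to
    \<open>z0\<close> stays in \<open>V\<close>.\<close>
  have "\<forall>\<^sub>F k in sequentially. \<forall>z\<in>{z0}. dist (((f ^^ p) ^^ m k) z) z < \<epsilon>"
    by (rule uniform_limitD[OF lim]) (use z0 \<epsilon> in auto)
  then obtain k0 where k0: "dist (((f ^^ p) ^^ m k0) z0) z0 < \<epsilon>"
    unfolding eventually_sequentially by auto
  define N where "N = p * m k0"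
  define H where "H = f ^^ N"
  have N: "N \<ge> 1" using p(1) m[of k0] by (simp add: N_def)
  have H_eq: "H = (f ^^ p) ^^ m k0" by (simp add: H_def N_def funpow_mult)
  have inV: "((f ^^ p) ^^ i) ` V \<subseteq> V" for i
  proof (induction i)
    case (Suc i)
    have "(f ^^ p) ` ((f ^^ p) ^^ i) ` V \<subseteq> (f ^^ p) ` V" by (rule image_mono[OF Suc])
    with p(2) show ?case by (auto simp: image_subset_iff)
  qed simp
  have HV: "(H ^^ i) ` V \<subseteq> V" for i
    using inV[of "m k0 * i"] by (simp add: H_eq funpow_mult mult.assoc)
  have HV1: "H z \<in> V" if "z \<in> V" for z using HV[of 1] that by auto
  have Hlim: "uniform_limit K (\<lambda>k. H ^^ m k) (\<lambda>z. z) sequentially" if K: "compact K" "K \<subseteq> V" for K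
  proof -
    \<comment> \<open>The exponents commute: the iterate of \<open>H\<close> of order
      \<open>m k\<close> is the fixed power \<open>m k0\<close> of a map that tends to the
      identity.\<close>
    have "uniform_limit K (\<lambda>k. ((f ^^ p) ^^ m k) ^^ m k0) (\<lambda>z. z) sequentially"
      by (rule uniform_limit_funpow_ident[OF V(1) lim K])
    then show ?thesis by (simp add: H_eq funpow_mult ac_simps)
  qed
  have contH: "continuous_on S (H ^^ i)" for S i
    unfolding H_def funpow_mult by (rule continuous_on_iterate)
  have close: "\<exists>k. \<exists>x\<in>cball w e. (H ^^ m k) x = w" if we: "0 < e" "cball w e \<subseteq> V" for w e
  proof -
    have "\<forall>\<^sub>F k in sequentially. \<forall>x\<in>cball w e. dist ((H ^^ m k) x) x < e"
      by (rule uniform_limitD[OF Hlim]) (use we in auto)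
    then obtain k where k: "\<And>x. x \<in> cball w e \<Longrightarrow> dist ((H ^^ m k) x) x < e"
      unfolding eventually_sequentially by blast
    obtain x where "x \<in> cball w e" "(H ^^ m k) x = w"
      by (rule surjective_near_identity[OF we(1) contH]) (use k in \<open>auto intro: less_imp_le\<close>)
    then show ?thesis by blast
  qed
  have pos: "\<exists>i. m k = Suc i" for k using m[of k] by (cases "m k") auto
  have inj: "inj_on H V"
  proof (rule inj_onI)
    fix x y assume xy: "x \<in> V" "y \<in> V" "H x = H y"
    have eq: "(H ^^ m k) x = (H ^^ m k) y" for k
      using pos[of k] xy(3) by (auto simp: funpow_Suc_right simp del: funpow.simps)
    have "uniform_limit {x, y} (\<lambda>k. H ^^ m k) (\<lambda>z. z) sequentially"
      by (rule Hlim) (use xy in auto)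
    from tendsto_uniform_limitI[OF this, of x] tendsto_uniform_limitI[OF this, of y]
    have "(\<lambda>k. (H ^^ m k) x) \<longlonglongrightarrow> x" "(\<lambda>k. (H ^^ m k) x) \<longlonglongrightarrow> y" by (simp_all add: eq)
    then show "x = y" by (rule LIMSEQ_unique)
  qed
  have surj: "H ` V = V"
  proof
    show "H ` V \<subseteq> V" using HV1 by blast
    show "V \<subseteq> H ` V"
    proof
      fix w assume w: "w \<in> V"
      then obtain e where e: "e > 0" "cball w e \<subseteq> V" using V(1) open_contains_cball[of V] by blast
      then obtain k x where x: "x \<in> cball w e" "(H ^^ m k) x = w" using close by blast
      obtain i where "m k = Suc i" using pos by blast
      then have "w = H ((H ^^ i) x)" using x(2) by simp
      moreover have "(H ^^ i) x \<in> V" using HV[of i] x(1) e(2) by blast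
      ultimately show "w \<in> H ` V" by blast
    qed
  qed
  have holH: "H holomorphic_on V" unfolding H_def by (rule holomorphic_on_funpow)
  obtain G where G: "G holomorphic_on H ` V" "\<And>z. z \<in> V \<Longrightarrow> G (H z) = z"
    using holomorphic_has_inverse[OF holH V(1) inj] by metis
  have contG: "continuous_on V G" using holomorphic_on_imp_continuous_on[OF G(1)] surj by simp
  have GV: "G w \<in> V" "H (G w) = w" if w: "w \<in> V" for w
  proof -
    obtain z where "z \<in> V" "w = H z" using w surj by blast
    then show "G w \<in> V" "H (G w) = w" using G(2) by auto
  qed
  define A where "A = Max ((\<lambda>n. cmod ((f ^^ n) z0)) ` {..N})"
  have A: "cmod ((f ^^ n) z0) \<le> A" if "n \<le> N" for n unfolding A_def using that by (intro Max_ge) auto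
  \<comment> \<open>This level dominates the first \<open>N\<close> iterates of \<open>z0\<close>
    and the disc about \<open>z0\<close>, as required for a crossing that lasts \<open>N\<close>
    steps.\<close>
  obtain \<Lambda> where \<Lambda>: "max A (cmod z0 + \<epsilon>) \<le> rad \<Lambda>"
    using filterlim_rad unfolding filterlim_at_top eventually_sequentially by blast
  define r where "r = rad (Suc \<Lambda>)"
  define r' where "r' = rad (Suc (\<Lambda> + N))"
  have r: "rad \<Lambda> < r" "r < r'"
    unfolding r_def r'_def using strict_mono_rad N by (simp_all add: strict_mono_less)
  \<comment> \<open>The pull-back under \<open>H\<close> of a continuum in the large disc that joins \<open>z0\<close> to \<open>w\<close> cannot
    leave the small disc, since the image of one that does leaves the large disc.\<close>
  define J where "J = {w. \<exists>\<Gamma>. compact \<Gamma> \<and> connected \<Gamma> \<and> \<Gamma> \<subseteq> V \<and> \<Gamma> \<subseteq> ball 0 r' \<and> z0 \<in> \<Gamma> \<and> w \<in> \<Gamma>}"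
  have JV: "J \<subseteq> V" unfolding J_def by blast
  have pull: "G w \<in> J \<and> cmod (G w) < r" if w: "w \<in> J" for w
  proof -
    obtain \<Gamma> where \<Gamma>: "compact \<Gamma>" "connected \<Gamma>" "\<Gamma> \<subseteq> V" "\<Gamma> \<subseteq> ball 0 r'" "z0 \<in> \<Gamma>" "w \<in> \<Gamma>"
      using w unfolding J_def by blast
    have Hz0: "H z0 \<in> cball z0 \<epsilon>" using k0 by (simp add: H_eq dist_commute)
    then have seg: "closed_segment (H z0) z0 \<subseteq> cball z0 \<epsilon>"
      using \<epsilon>(1) by (intro closed_segment_subset) auto
    have "cball z0 \<epsilon> \<subseteq> ball 0 r'"
    proof
      fix x assume "x \<in> cball z0 \<epsilon>"
      then have "cmod x \<le> cmod z0 + \<epsilon>"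
        using norm_triangle_sub[of x z0] by (simp add: dist_norm norm_minus_commute)
      then show "x \<in> ball 0 r'" using \<Lambda> r by simp
    qed
    \<comment> \<open>The added segment contains \<open>H z0\<close>, so that the pull-back under
      \<open>G\<close> contains \<open>z0\<close> again.\<close>
    define \<Gamma>' where "\<Gamma>' = closed_segment (H z0) z0 \<union> \<Gamma>"
    have \<Gamma>': "compact \<Gamma>'" "connected \<Gamma>'" "\<Gamma>' \<subseteq> V" "\<Gamma>' \<subseteq> ball 0 r'" "H z0 \<in> \<Gamma>'" "w \<in> \<Gamma>'"
    proof -
      show "connected \<Gamma>'" unfolding \<Gamma>'_def using \<Gamma>(2,5) by (intro connected_Un) auto
    qed (use \<Gamma> seg \<epsilon>(2) \<open>cball z0 \<epsilon> \<subseteq> ball 0 r'\<close> in \<open>auto simp: \<Gamma>'_def\<close>)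
    define \<Delta> where "\<Delta> = G ` \<Gamma>'"
    have \<Delta>: "compact \<Delta>" "connected \<Delta>" "\<Delta> \<subseteq> V"
      unfolding \<Delta>_def using \<Gamma>'(1,2) continuous_on_subset[OF contG \<Gamma>'(3)] GV(1) \<Gamma>'(3)
      by (auto intro!: compact_continuous_image connected_continuous_image)
    have z0\<Delta>: "z0 \<in> \<Delta>" "G w \<in> \<Delta>"
      unfolding \<Delta>_def using imageI[OF \<Gamma>'(5), of G] imageI[OF \<Gamma>'(6), of G] G(2)[OF z0] by simp_all
    have small: "cmod v < r" if v: "v \<in> \<Delta>" for v
    proof (rule ccontr)
      assume "\<not> ?thesis"
      then have "\<exists>u\<in>\<Delta>. rad (Suc (\<Lambda> + N)) \<le> cmod ((f ^^ N) u)"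
      proof (intro crossing[where x = z0 and y = v and m = 0] \<Delta> z0\<Delta> v)
        fix i assume "i < N"
        then show "cmod ((f ^^ i) z0) \<le> rad (\<Lambda> + i)"
          using A[of i] \<Lambda> rad_mono[of \<Lambda> "\<Lambda> + i"] by simp
      qed (auto simp: r_def)
      then obtain u where u: "u \<in> \<Delta>" "r' \<le> cmod (H u)" unfolding H_def r'_def by blast
      then obtain v' where v': "v' \<in> \<Gamma>'" "u = G v'" unfolding \<Delta>_def by blast
      then have "H u \<in> \<Gamma>'" using GV(2)[of v'] \<Gamma>'(3) by auto
      then show False using u(2) \<Gamma>'(4) by auto
    qed
    then have "\<Delta> \<subseteq> ball 0 r'" using r(2) by fastforce
    then show ?thesis using \<Delta> z0\<Delta> small unfolding J_def by blast
  qed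
  have iter: "(G ^^ Suc i) w \<in> J \<and> cmod ((G ^^ Suc i) w) < r" if "w \<in> J" for i w
    by (induction i) (use pull that in auto)
  \<comment> \<open>The contradiction comes from a point \<open>b\<close> of \<open>J\<close>
    strictly between the two circles: a nearby \<open>x\<close> with \<open>(H ^^ m k) x = b\<close>
    is a pull-back of \<open>b\<close>, hence in the small disc.\<close>
  have "cmod z0 < (r + r') / 2" using \<Lambda> r \<epsilon>(1) by (simp add: field_simps)
  then obtain \<Gamma> b where b: "compact \<Gamma>" "connected \<Gamma>" "\<Gamma> \<subseteq> V" "\<Gamma> \<subseteq> cball 0 ((r + r') / 2)"
    "z0 \<in> \<Gamma>" "b \<in> \<Gamma>" "cmod b = (r + r') / 2"
    using path_to_sphere[OF V(1,2) z0 V(4)] by blast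
  have "\<Gamma> \<subseteq> ball 0 r'" using b(4) r(2) by fastforce
  then have "b \<in> J" unfolding J_def using b by blast
  have "r < cmod b" using b(7) r(2) by simp
  have "b \<in> V" using b(3,6) by blast
  then obtain e0 where e0: "e0 > 0" "cball b e0 \<subseteq> V" using V(1) open_contains_cball[of V] by blast
  define e where "e = min e0 ((cmod b - r) / 2)"
  have "cball b e \<subseteq> cball b e0" by (rule subset_cball) (simp add: e_def)
  then have e: "e > 0" "cball b e \<subseteq> V" "e < cmod b - r"
    using e0 \<open>r < cmod b\<close> by (auto simp: e_def min_def)
  obtain k x where x: "x \<in> cball b e" "(H ^^ m k) x = b" using close[OF e(1,2)] by blast
  have left_inv: "(G ^^ i) ((H ^^ i) v) = v" if v: "v \<in> V" for i v
  proof (induction i)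
    case (Suc i)
    have "(G ^^ Suc i) ((H ^^ Suc i) v) = (G ^^ i) (G (H ((H ^^ i) v)))"
      by (subst funpow_Suc_right) simp
    also have "\<dots> = (G ^^ i) ((H ^^ i) v)" using G(2) HV[of i] v by (metis image_subset_iff)
    finally show ?case using Suc by simp
  qed simp
  obtain i where i: "m k = Suc i" using pos by blast
  have "x = (G ^^ Suc i) b" using left_inv[of x "m k"] x e(2) i by auto
  then have "cmod x < r" using iter[OF \<open>b \<in> J\<close>] by simp
  moreover have "cmod b \<le> cmod x + e"
    using x(1) norm_triangle_sub[of b x] by (simp add: dist_norm)
  ultimately show False using e(3) by simp
qed

text \<open>A nonconstant limit \<open>\<phi>\<close> has an open image in \<open>V\<close>. Limits
  of the iterates with orders equal to the gaps of \<open>m\<close> fix that image, so they are the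
  identity, against \<open>no_recurrence_to_identity\<close>.\<close>

lemma limit_function_constant:
  assumes V: "open V" "connected V" "V \<noteq> {}" "\<not> bounded V" "normal_on V {f ^^ n | n. n \<ge> 1}"
    and p: "1 \<le> p" "(f ^^ p) ` V \<subseteq> V" and m: "strict_mono m"
    and lim: "\<And>K. compact K \<Longrightarrow> K \<subseteq> V \<Longrightarrow> uniform_limit K (\<lambda>k. (f ^^ p) ^^ m k) \<phi> sequentially"
  shows "\<phi> constant_on V"
proof (rule ccontr)
  assume nonconst: "\<not> \<phi> constant_on V"
  define h where "h n = (f ^^ p) ^^ n" for n
  have h_eq: "h n = f ^^ (p * n)" for n by (simp add: h_def funpow_mult)
  have h_add: "h (i + j) z = h i (h j z)" for i j z by (simp add: h_def funpow_add)
  have hV: "h n z \<in> V" if "z \<in> V" for n z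
    by (induction n) (use p(2) that in \<open>auto simp: h_def\<close>)
  have holh: "h n holomorphic_on S" for n S unfolding h_eq by (rule holomorphic_on_funpow)
  have limh: "uniform_limit K (\<lambda>k. h (m k)) \<phi> sequentially" if "compact K" "K \<subseteq> V" for K
    using lim[OF that] by (simp add: h_def)
  have locally: "\<exists>d>0. cball x d \<subseteq> V \<and> uniform_limit (cball x d) F g sequentially"
    if F: "\<And>K. compact K \<Longrightarrow> K \<subseteq> V \<Longrightarrow> uniform_limit K F g sequentially" and x: "x \<in> V" for F g x
  proof -
    obtain d where "d > 0" "cball x d \<subseteq> V" using V(1) x open_contains_cball[of V] by blast
    then show ?thesis using F[OF compact_cball] by blast
  qed
  have hol\<phi>: "\<phi> holomorphic_on V"
    by (rule holomorphic_uniform_sequence[OF V(1) holh locally[OF limh]])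
  \<comment> \<open>By Hurwitz the nonconstant limit omits every value that all the approximating
    maps omit.\<close>
  have \<phi>V: "\<phi> z \<in> V" if z: "z \<in> V" for z
  proof (rule ccontr)
    assume w: "\<phi> z \<notin> V"
    have "(\<lambda>v. \<phi> v - \<phi> z) z \<noteq> 0"
    proof (rule Hurwitz_no_zeros[OF V(1,2) _ _ _ _ _ z, where \<F> = "\<lambda>k v. h (m k) v - \<phi> z"
            and g = "\<lambda>v. \<phi> v - \<phi> z"])
      show "(\<lambda>v. h (m n) v - \<phi> z) holomorphic_on V" for n by (intro holomorphic_intros holh)
      show "(\<lambda>v. \<phi> v - \<phi> z) holomorphic_on V" by (intro holomorphic_intros hol\<phi>)
      show "uniform_limit K (\<lambda>k v. h (m k) v - \<phi> z) (\<lambda>v. \<phi> v - \<phi> z) sequentially"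
        if "compact K" "K \<subseteq> V" for K
        using limh[OF that] by (simp add: uniform_limit_iff dist_norm)
      show "\<not> (\<lambda>v. \<phi> v - \<phi> z) constant_on V"
      proof
        assume "(\<lambda>v. \<phi> v - \<phi> z) constant_on V"
        then obtain c where "\<forall>v\<in>V. \<phi> v - \<phi> z = c" unfolding constant_on_def by blast
        then have "\<forall>v\<in>V. \<phi> v = c + \<phi> z" by (simp add: algebra_simps)
        then show False using nonconst unfolding constant_on_def by blast
      qed
      show "h (m n) v - \<phi> z \<noteq> 0" if "v \<in> V" for n v using hV[OF that, of "m n"] w by auto
    qed
    then show False by simp
  qed
  \<comment> \<open>The iterate of order \<open>l k\<close> carries \<open>h (m k) z\<close> to
    \<open>h (m (Suc k)) z\<close>, and both tend to \<open>\<phi> z\<close>.\<close>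
  define l where "l k = m (Suc k) - m k" for k
  have mono: "m k < m (Suc k)" for k using m by (simp add: strict_mono_Suc_iff)
  have l: "l k \<ge> 1" "m (Suc k) = l k + m k" for k using mono[of k] by (simp_all add: l_def)
  have pl: "p * l k \<ge> 1" for k using p(1) l(1)[of k] by simp
  obtain \<rho> :: "nat \<Rightarrow> nat" where \<rho>: "strict_mono \<rho>" "settles_on V (\<lambda>k. f ^^ (p * l (\<rho> k)))"
    using normal_iterates_settle[OF V(5), of "\<lambda>k. p * l k"] pl by blast
  have \<rho>_lim: "filterlim \<rho> at_top sequentially" by (rule filterlim_subseq[OF \<rho>(1)])
  have pointlim: "(\<lambda>k. h (m (\<rho> k)) z) \<longlonglongrightarrow> \<phi> z" "(\<lambda>k. h (l (\<rho> k)) (h (m (\<rho> k)) z)) \<longlonglongrightarrow> \<phi> z"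
    if z: "z \<in> V" for z
  proof -
    have ul: "uniform_limit {z} (\<lambda>k. h (m k)) \<phi> sequentially" by (rule limh) (use z in auto)
    then have *: "(\<lambda>k. h (m k) z) \<longlonglongrightarrow> \<phi> z" using tendsto_uniform_limitI[OF ul, of z] by simp
    show "(\<lambda>k. h (m (\<rho> k)) z) \<longlonglongrightarrow> \<phi> z" by (rule filterlim_compose[OF * \<rho>_lim])
    have "(\<lambda>k. h (m (Suc k)) z) \<longlonglongrightarrow> \<phi> z" by (rule LIMSEQ_Suc[OF *])
    then have "(\<lambda>k. h (m (Suc (\<rho> k))) z) \<longlonglongrightarrow> \<phi> z" by (rule filterlim_compose[OF _ \<rho>_lim])
    then show "(\<lambda>k. h (l (\<rho> k)) (h (m (\<rho> k)) z)) \<longlonglongrightarrow> \<phi> z" by (simp add: l(2) h_add)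
  qed
  obtain z where z: "z \<in> V" using V(3) by blast
  have near: "\<exists>e>0. cball (\<phi> z) e \<subseteq> V \<and> (\<forall>\<^sub>F k in sequentially. h (m (\<rho> k)) z \<in> cball (\<phi> z) e)"
    if z: "z \<in> V" for z
  proof -
    obtain e where e: "e > 0" "cball (\<phi> z) e \<subseteq> V"
      using V(1) \<phi>V[OF z] open_contains_cball[of V] by blast
    have "\<forall>\<^sub>F k in sequentially. dist (h (m (\<rho> k)) z) (\<phi> z) < e"
      using pointlim(1)[OF z] e(1) by (rule tendstoD)
    then have "\<forall>\<^sub>F k in sequentially. h (m (\<rho> k)) z \<in> cball (\<phi> z) e"
      by eventually_elim (simp add: dist_commute)
    with e show ?thesis by blast
  qed
  from \<rho>(2) show False
    unfolding settles_on_def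
  proof (elim disjE exE)
    fix \<psi> assume "\<forall>K. compact K \<and> K \<subseteq> V \<longrightarrow> uniform_limit K (\<lambda>k. f ^^ (p * l (\<rho> k))) \<psi> sequentially"
    then have \<psi>: "uniform_limit K (\<lambda>k. h (l (\<rho> k))) \<psi> sequentially" if "compact K" "K \<subseteq> V" for K
      using that by (simp add: h_eq)
    have hol\<psi>: "\<psi> holomorphic_on V"
      by (rule holomorphic_uniform_sequence[OF V(1) holh locally[OF \<psi>]])
    have fix\<psi>: "\<psi> (\<phi> v) = \<phi> v" if v: "v \<in> V" for v
    proof -
      obtain e where e: "e > 0" "cball (\<phi> v) e \<subseteq> V"
        "\<forall>\<^sub>F k in sequentially. h (m (\<rho> k)) v \<in> cball (\<phi> v) e" using near[OF v] by blast
      have ul: "uniform_limit (cball (\<phi> v) e) (\<lambda>k. h (l (\<rho> k))) \<psi> sequentially"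
        by (rule \<psi>[OF compact_cball e(2)])
      have "isCont \<psi> (\<phi> v)"
        using holomorphic_on_imp_continuous_on[OF hol\<psi>] V(1) \<phi>V[OF v]
        by (simp add: continuous_on_eq_continuous_at)
      then have *: "(\<lambda>k. \<psi> (h (m (\<rho> k)) v)) \<longlonglongrightarrow> \<psi> (\<phi> v)"
        by (rule isCont_tendsto_compose[OF _ pointlim(1)[OF v]])
      have "(\<lambda>k. h (l (\<rho> k)) (h (m (\<rho> k)) v) - \<psi> (h (m (\<rho> k)) v)) \<longlonglongrightarrow> 0"
      proof (rule tendstoI)
        fix d :: real assume "d > 0"
        from uniform_limitD[OF ul this] e(3)
        show "\<forall>\<^sub>F k in sequentially. dist (h (l (\<rho> k)) (h (m (\<rho> k)) v) - \<psi> (h (m (\<rho> k)) v)) 0 < d"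
          by eventually_elim (auto simp: dist_norm)
      qed
      from tendsto_add[OF this *]
      have "(\<lambda>k. h (l (\<rho> k)) (h (m (\<rho> k)) v)) \<longlonglongrightarrow> \<psi> (\<phi> v)" by simp
      then show ?thesis by (rule LIMSEQ_unique[OF _ pointlim(2)[OF v]])
    qed
    have "open (\<phi> ` V)"
      by (rule open_mapping_thm[OF hol\<phi> V(1,2) V(1) order_refl nonconst])
    then have ident: "\<psi> v = v" if "v \<in> V" for v
      by (rule analytic_continuation_open[of "\<phi> ` V" V \<psi> "\<lambda>v. v"])
        (use V \<phi>V hol\<psi> fix\<psi> that in \<open>auto intro!: holomorphic_intros\<close>)
    show False
    proof (rule no_recurrence_to_identity[OF V(1-4) p])
      show "1 \<le> l (\<rho> k)" for k by (rule l(1))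
      show "uniform_limit K (\<lambda>k. (f ^^ p) ^^ l (\<rho> k)) (\<lambda>z. z) sequentially"
        if K: "compact K" "K \<subseteq> V" for K
        unfolding uniform_limit_iff
      proof (intro allI impI)
        fix d :: real assume "d > 0"
        show "\<forall>\<^sub>F k in sequentially. \<forall>v\<in>K. dist (((f ^^ p) ^^ l (\<rho> k)) v) v < d"
          using uniform_limitD[OF \<psi>[OF K] \<open>d > 0\<close>]
        proof eventually_elim
          case (elim k)
          show ?case
          proof
            fix v assume "v \<in> K"
            then have "v \<in> V" using K(2) by blast
            then show "dist (((f ^^ p) ^^ l (\<rho> k)) v) v < d"
              using elim \<open>v \<in> K\<close> ident[OF \<open>v \<in> V\<close>] unfolding h_def by (metis (no_types))
          qed
        qed
      qed
    qed
  next
    \<comment> \<open>Divergence of the gap iterates is impossible, since they map points of a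
      compact disc about \<open>\<phi> z\<close> to points tending to
      \<open>\<phi> z\<close>.\<close>
    assume inf: "\<forall>K. compact K \<and> K \<subseteq> V \<longrightarrow>
      (\<forall>B. \<forall>\<^sub>F k in sequentially. \<forall>v\<in>K. B \<le> cmod ((f ^^ (p * l (\<rho> k))) v))"
    obtain e where e: "e > 0" "cball (\<phi> z) e \<subseteq> V"
      "\<forall>\<^sub>F k in sequentially. h (m (\<rho> k)) z \<in> cball (\<phi> z) e" using near[OF z] by blast
    have "compact (cball (\<phi> z) e) \<and> cball (\<phi> z) e \<subseteq> V" using e(2) by simp
    then have "\<forall>\<^sub>F k in sequentially. \<forall>v\<in>cball (\<phi> z) e. cmod (\<phi> z) + 1 \<le> cmod (h (l (\<rho> k)) v)"
      using inf unfolding h_eq by blast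
    moreover have "\<forall>\<^sub>F k in sequentially. cmod (h (l (\<rho> k)) (h (m (\<rho> k)) z)) < cmod (\<phi> z) + 1"
      by (rule order_tendstoD(2)[OF tendsto_norm[OF pointlim(2)[OF z]]]) simp
    ultimately have "\<forall>\<^sub>F k in sequentially. False" using e(3)
    proof eventually_elim
      case (elim k)
      then have "cmod (\<phi> z) + 1 \<le> cmod (h (l (\<rho> k)) (h (m (\<rho> k)) z))" by blast
      with elim(2) show ?case by simp
    qed
    then show False by simp
  qed
qed

text \<open>All finite limit functions of \<open>(f ^^ p) ^^ k\<close> on \<open>V\<close> are constant, hence fixed points of
  \<open>f ^^ p\<close>, which are isolated. An orbit that returns near a finite limit point but is unbounded
  would cross a small annulus about it infinitely often and so accumulate at a second fixed point.\<close>

lemma periodic_component_escapes: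
  assumes V: "V \<in> components (fatou_set f)" "\<not> bounded V"
    and p: "1 \<le> p" "fatou_iterate f V p = V" and meets: "V \<inter> V_plus f \<noteq> {}" and z: "z \<in> V"
  shows "filterlim (\<lambda>n. (f ^^ n) z) at_infinity sequentially"
proof -
  note VF = component_facts[OF V(1)]
  define g where "g = f ^^ p"
  have gV: "g ` V \<subseteq> V" unfolding g_def using fatou_iterate(2)[OF V(1), of p] p(2) by simp
  have gn: "g ^^ n = f ^^ (p * n)" for n by (simp add: g_def funpow_mult)
  have gnV: "(g ^^ n) v \<in> V" if "v \<in> V" for n v
    by (induction n) (use gV that in auto)
  have holg: "g holomorphic_on S" for S unfolding g_def by (rule holomorphic_on_funpow)
  have contg: "continuous_on S g" for S by (rule holomorphic_on_imp_continuous_on[OF holg])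
  \<comment> \<open>Bounds up to \<open>p\<close> further iterates on a disc; this transfers
    boundedness between the orbits of \<open>f\<close> and of \<open>g\<close>.\<close>
  have tail: "\<exists>B'. \<forall>v\<in>cball 0 B. \<forall>q\<le>p. cmod ((f ^^ q) v) \<le> B'" for B
  proof -
    have "bounded (\<Union>q\<le>p. (f ^^ q) ` cball 0 B)"
      by (intro bounded_UN ballI compact_imp_bounded compact_continuous_image continuous_on_iterate) auto
    then have "\<exists>B'. \<forall>w\<in>(\<Union>q\<le>p. (f ^^ q) ` cball 0 B). cmod w \<le> B'"
      by (simp only: bounded_iff)
    then obtain B' where B': "\<forall>w\<in>(\<Union>q\<le>p. (f ^^ q) ` cball 0 B). cmod w \<le> B'" by (rule exE)
    have "cmod ((f ^^ q) v) \<le> B'" if "v \<in> cball 0 B" "q \<le> p" for v q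
      by (rule B'[rule_format]) (use that in \<open>auto intro!: bexI[of _ q]\<close>)
    then show ?thesis by blast
  qed
  have unbounded: "\<exists>n. B < cmod ((f ^^ n) z)" for B
  proof -
    obtain w where w: "w \<in> V" "w \<in> V_plus f" using meets by blast
    obtain l where l: "\<And>N. \<exists>n\<ge>N. rad n \<le> cmod ((f ^^ (n + l)) w)" using V_plus_high[OF w(2)] by blast
    obtain C where C: "C \<ge> 1" "\<And>n. n \<ge> 1 \<Longrightarrow> cmod ((f ^^ n) w) \<le> C * max 1 (cmod ((f ^^ n) z))"
      using ratio_bounded[OF V w(1) z] by blast
    obtain N where N: "C * max 1 B < rad N"
      using filterlim_rad unfolding filterlim_at_top_dense eventually_sequentially by blast
    obtain n where n: "n \<ge> Suc N" "rad n \<le> cmod ((f ^^ (n + l)) w)" using l by blast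
    have "C * max 1 B < C * max 1 (cmod ((f ^^ (n + l)) z))"
      using N rad_mono[of N n] n C(2)[of "n + l"] by simp
    then have "max 1 B < max 1 (cmod ((f ^^ (n + l)) z))" using C(1) by simp
    then have "B < cmod ((f ^^ (n + l)) z)" by auto
    then show ?thesis by blast
  qed
  have g_unbounded: "\<exists>k. B < cmod ((g ^^ k) z)" for B
  proof (rule ccontr)
    assume "\<not> ?thesis"
    then have B: "cmod ((g ^^ k) z) \<le> B" for k by (meson not_less)
    obtain B' where B': "\<And>v q. v \<in> cball 0 B \<Longrightarrow> q \<le> p \<Longrightarrow> cmod ((f ^^ q) v) \<le> B'" using tail by blast
    have "cmod ((f ^^ n) z) \<le> B'" for n
    proof -
      have "(f ^^ n) z = (f ^^ (n mod p)) ((g ^^ (n div p)) z)"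
        unfolding gn by (metis comp_apply funpow_add mod_mult_div_eq)
      then show ?thesis using B'[of "(g ^^ (n div p)) z" "n mod p"] B p(1) by simp
    qed
    then show False using unbounded[of B'] by (meson not_less)
  qed
  \<comment> \<open>A bounded sequence of iterates of \<open>z\<close> excludes divergence, so the
    limit is a constant \<open>a\<close>. It is also the limit along the orbit of
    \<open>g z\<close>, which gives \<open>g a = a\<close>.\<close>
  have fixed_limit: "\<exists>a. \<exists>\<sigma> :: nat \<Rightarrow> nat. strict_mono \<sigma> \<and> g a = a \<and> (\<lambda>j. (g ^^ m (\<sigma> j)) z) \<longlonglongrightarrow> a"
    if m: "strict_mono m" "\<And>j. m j \<ge> 1" and B: "\<And>j. cmod ((g ^^ m j) z) \<le> B" for m B
  proof -
    have pm: "p * m j \<ge> 1" for j using p(1) m(2)[of j] by simp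
    obtain \<sigma> :: "nat \<Rightarrow> nat" where \<sigma>: "strict_mono \<sigma>" "settles_on V (\<lambda>j. f ^^ (p * m (\<sigma> j)))"
      using normal_iterates_settle[OF VF(5), of "\<lambda>j. p * m j"] pm by blast
    have not_inf: False
      if inf: "\<forall>K. compact K \<and> K \<subseteq> V \<longrightarrow> (\<forall>B. \<forall>\<^sub>F k in sequentially. \<forall>v\<in>K. B \<le> cmod ((f ^^ (p * m (\<sigma> k))) v))"
    proof -
      have "compact {z} \<and> {z} \<subseteq> V" using z by simp
      then have "\<forall>\<^sub>F k in sequentially. \<forall>v\<in>{z}. B + 1 \<le> cmod ((f ^^ (p * m (\<sigma> k))) v)" using inf by blast
      then obtain k where "B + 1 \<le> cmod ((g ^^ m (\<sigma> k)) z)" unfolding gn eventually_sequentially by auto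
      then show False using B[of "\<sigma> k"] by simp
    qed
    then obtain \<phi> where \<phi>: "\<And>K. compact K \<Longrightarrow> K \<subseteq> V \<Longrightarrow> uniform_limit K (\<lambda>j. g ^^ m (\<sigma> j)) \<phi> sequentially"
      using \<sigma>(2) unfolding settles_on_def gn by blast
    have "\<phi> constant_on V"
    proof (rule limit_function_constant[OF VF(1-3) V(2) VF(5) p(1)])
      show "(f ^^ p) ` V \<subseteq> V" using gV by (simp add: g_def)
      show "strict_mono (m \<circ> \<sigma>)" by (rule strict_mono_o[OF m(1) \<sigma>(1)])
      show "uniform_limit K (\<lambda>k. (f ^^ p) ^^ (m \<circ> \<sigma>) k) \<phi> sequentially" if "compact K" "K \<subseteq> V" for K
        using \<phi>[OF that] by (simp add: g_def o_def)
    qed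
    then obtain a where a: "\<And>v. v \<in> V \<Longrightarrow> \<phi> v = a" unfolding constant_on_def by blast
    have to_a: "(\<lambda>j. (g ^^ m (\<sigma> j)) v) \<longlonglongrightarrow> a" if v: "v \<in> V" for v
    proof -
      have ul: "uniform_limit {v} (\<lambda>j. g ^^ m (\<sigma> j)) \<phi> sequentially" by (rule \<phi>) (use v in auto)
      show ?thesis using tendsto_uniform_limitI[OF ul, of v] a[OF v] by simp
    qed
    have "isCont g a" using contg[of UNIV] by (simp add: continuous_on_eq_continuous_at)
    then have "(\<lambda>j. g ((g ^^ m (\<sigma> j)) z)) \<longlonglongrightarrow> g a"
      by (rule isCont_tendsto_compose[OF _ to_a[OF z]])
    moreover have "(\<lambda>j. g ((g ^^ m (\<sigma> j)) z)) \<longlonglongrightarrow> a"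
      using to_a[of "g z"] gV z by (simp add: funpow_swap1 image_subset_iff)
    ultimately have "g a = a" by (rule LIMSEQ_unique)
    then show ?thesis using \<sigma>(1) to_a[OF z] by blast
  qed
  have g_escapes: "\<exists>N. \<forall>k\<ge>N. B < cmod ((g ^^ k) z)" for B
  proof (rule ccontr)
    assume "\<not> ?thesis"
    then have "\<forall>N. \<exists>k\<ge>N. cmod ((g ^^ k) z) \<le> B" by (meson not_less)
    then have "infinite {k. 1 \<le> k \<and> cmod ((g ^^ k) z) \<le> B}" (is "infinite ?S")
      unfolding infinite_nat_iff_unbounded_le by (metis (no_types, lifting) max.boundedE mem_Collect_eq)
    then have en: "strict_mono (enumerate ?S)" "\<And>j. enumerate ?S j \<in> ?S"
      using strict_mono_enumerate enumerate_in_set by blast+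
    obtain a \<sigma> where a: "g a = a" "strict_mono (\<sigma> :: nat \<Rightarrow> nat)"
      "(\<lambda>j. (g ^^ enumerate ?S (\<sigma> j)) z) \<longlonglongrightarrow> a"
      using fixed_limit[OF en(1), of B] en(2) by blast
    obtain k1 where k1: "cmod z < cmod ((g ^^ k1) z)" using g_unbounded by blast
    \<comment> \<open>Were \<open>g\<close> the identity, the orbit of \<open>z\<close> under
      \<open>g\<close> would be constant. Hence its fixed points are isolated.\<close>
    have "\<exists>v. g v - v \<noteq> 0"
    proof (rule ccontr)
      assume "\<not> ?thesis"
      then have "g v = v" for v by simp
      then have "(g ^^ k1) z = z" by (induction k1) auto
      then show False using k1 by simp
    qed
    then obtain v where "g v - v \<noteq> 0" by blast
    obtain r where r: "r > 0" "\<And>u. u \<in> ball a r - {a} \<Longrightarrow> g u - u \<noteq> 0"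
    proof (rule isolated_zeros[of "\<lambda>u. g u - u" UNIV a v])
      show "(\<lambda>u. g u - u) holomorphic_on UNIV" by (intro holomorphic_intros holg)
    qed (use a(1) \<open>g v - v \<noteq> 0\<close> in auto)
    have "isCont g a" using contg[of UNIV] by (simp add: continuous_on_eq_continuous_at)
    from this[unfolded continuous_at_eps_delta, rule_format, of "r / 2"] r(1)
    obtain d where d: "d > 0" "\<And>u. dist u a < d \<Longrightarrow> dist (g u) a < r / 2" by (auto simp: a(1))
    define \<delta> where "\<delta> = min d (r / 2)"
    have \<delta>: "\<delta> > 0" "\<delta> \<le> d" using d r by (auto simp: \<delta>_def)
    \<comment> \<open>After each return to the small disc the unbounded orbit leaves it again; the
      first exit lands in the annulus because \<open>g\<close> maps the \<open>\<delta>\<close>-disc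
      into the disc of radius \<open>r / 2\<close>.\<close>
    have annulus: "\<exists>k\<ge>N. 1 \<le> k \<and> \<delta> \<le> dist ((g ^^ k) z) a \<and> dist ((g ^^ k) z) a < r / 2" for N
    proof -
      have "\<forall>\<^sub>F j in sequentially. dist ((g ^^ enumerate ?S (\<sigma> j)) z) a < \<delta>"
        by (rule tendstoD[OF a(3) \<delta>(1)])
      then obtain J where J: "\<And>j. j \<ge> J \<Longrightarrow> dist ((g ^^ enumerate ?S (\<sigma> j)) z) a < \<delta>"
        unfolding eventually_sequentially by blast
      define k where "k = enumerate ?S (\<sigma> (max J N))"
      have "max J N \<le> \<sigma> (max J N)" by (rule strict_mono_imp_increasing[OF a(2)])
      also have "\<dots> \<le> k" unfolding k_def by (rule strict_mono_imp_increasing[OF en(1)])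
      finally have k: "N \<le> k" "dist ((g ^^ k) z) a < \<delta>" using J[of "max J N"] by (auto simp: k_def)
      \<comment> \<open>Exceeding all earlier values forces the far point \<open>k'\<close> to come
        after the return time \<open>k\<close>.\<close>
      define B' where "B' = Max ((\<lambda>i. cmod ((g ^^ i) z)) ` {..k})"
      have B': "cmod ((g ^^ i) z) \<le> B'" if "i \<le> k" for i unfolding B'_def using that by (intro Max_ge) auto
      obtain k' where k': "max B' (cmod a + \<delta>) < cmod ((g ^^ k') z)" using g_unbounded by blast
      have "k < k'" using B'[of k'] k' by (cases "k' \<le> k") auto
      have far: "\<not> dist ((g ^^ k') z) a < \<delta>"
        using k' norm_triangle_sub[of "(g ^^ k') z" a] by (simp add: dist_norm)
      define i where "i = (LEAST i. k < i \<and> \<not> dist ((g ^^ i) z) a < \<delta>)"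
      have i: "k < i" "\<not> dist ((g ^^ i) z) a < \<delta>"
        unfolding i_def using LeastI[of "\<lambda>i. k < i \<and> \<not> dist ((g ^^ i) z) a < \<delta>" k'] \<open>k < k'\<close> far by auto
      have least: "dist ((g ^^ j) z) a < \<delta>" if "k < j" "j < i" for j
        using not_less_Least[of j "\<lambda>i. k < i \<and> \<not> dist ((g ^^ i) z) a < \<delta>"] that unfolding i_def by blast
      obtain j where j: "i = Suc j" using i(1) by (cases i) auto
      have "dist ((g ^^ j) z) a < \<delta>"
        using least[of j] k(2) i(1) j by (cases "j = k") auto
      then have "dist ((g ^^ i) z) a < r / 2" using d(2)[of "(g ^^ j) z"] \<delta>(2) by (simp add: j)
      then show ?thesis using i k(1) by (intro exI[of _ i]) auto
    qed
    define T where "T = {k. 1 \<le> k \<and> \<delta> \<le> dist ((g ^^ k) z) a \<and> dist ((g ^^ k) z) a < r / 2}"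
    have "infinite T" unfolding infinite_nat_iff_unbounded_le T_def using annulus by blast
    then have enT: "strict_mono (enumerate T)" "\<And>j. enumerate T j \<in> T"
      using strict_mono_enumerate enumerate_in_set by blast+
    have T1: "enumerate T j \<ge> 1" "\<delta> \<le> dist ((g ^^ enumerate T j) z) a"
      "dist ((g ^^ enumerate T j) z) a < r / 2" for j
      using enT(2)[of j] by (auto simp: T_def)
    have T2: "cmod ((g ^^ enumerate T j) z) \<le> cmod a + r / 2" for j
      using T1(3)[of j] norm_triangle_sub[of "(g ^^ enumerate T j) z" a] by (simp add: dist_norm)
    obtain b \<tau> where b: "g b = b" "strict_mono (\<tau> :: nat \<Rightarrow> nat)"
      "(\<lambda>j. (g ^^ enumerate T (\<tau> j)) z) \<longlonglongrightarrow> b"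
      using fixed_limit[OF enT(1) T1(1) T2] by blast
    have lim: "(\<lambda>j. dist ((g ^^ enumerate T (\<tau> j)) z) a) \<longlonglongrightarrow> dist b a"
      by (intro tendsto_intros b(3))
    have "\<delta> \<le> dist b a" by (rule LIMSEQ_le_const[OF lim]) (use T1(2) in auto)
    moreover have "dist b a \<le> r / 2"
      by (rule LIMSEQ_le_const2[OF lim]) (use T1(3) in \<open>auto intro: less_imp_le\<close>)
    ultimately have "b \<in> ball a r - {a}" using \<delta>(1) r(1) by (auto simp: dist_commute)
    then show False using r(2)[of b] b(1) by simp
  qed
  show ?thesis
    unfolding filterlim_at_infinity_conv_norm_at_top filterlim_at_top
  proof
    fix B
    obtain B' where B': "\<And>v q. v \<in> cball 0 B \<Longrightarrow> q \<le> p \<Longrightarrow> cmod ((f ^^ q) v) \<le> B'" using tail by blast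
    obtain N where N: "\<And>k. k \<ge> N \<Longrightarrow> B' < cmod ((g ^^ k) z)" using g_escapes by blast
    have "B \<le> cmod ((f ^^ n) z)" if n: "n \<ge> p * N" for n
    proof (rule ccontr)
      assume "\<not> ?thesis"
      then have "(f ^^ n) z \<in> cball 0 B" by simp
      \<comment> \<open>The first multiple of \<open>p\<close> strictly after \<open>n\<close> is at
        most \<open>p\<close> steps away, and there the orbit of \<open>g\<close> would be bounded
        by \<open>B'\<close>.\<close>
      moreover have "p - n mod p \<le> p" by simp
      ultimately have "cmod ((f ^^ (p - n mod p)) ((f ^^ n) z)) \<le> B'" by (rule B')
      moreover have "(f ^^ (p - n mod p)) ((f ^^ n) z) = (g ^^ Suc (n div p)) z"
      proof -
        have "n mod p < p" using p(1) by simp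
        have "p - n mod p + n = p - n mod p + (n mod p + p * (n div p))"
          by (simp only: mod_mult_div_eq)
        also have "\<dots> = p * Suc (n div p)"
          using \<open>n mod p < p\<close> unfolding mult_Suc_right by linarith
        finally have eq: "p - n mod p + n = p * Suc (n div p)" .
        show ?thesis unfolding gn eq[symmetric] by (simp add: funpow_add)
      qed
      moreover have "N \<le> Suc (n div p)"
        using div_le_mono[OF n, of p] p(1) by simp
      ultimately show False using N[of "Suc (n div p)"] by simp
    qed
    then show "\<forall>\<^sub>F n in sequentially. B \<le> cmod ((f ^^ n) z)"
      unfolding eventually_sequentially by blast
  qed
qed

text \<open>Starting later by \<open>m\<close> steps only lowers the level to be reached, because
  \<open>rad\<close> is increasing.\<close>

lemma V_plus_funpow:
  assumes "z \<in> V_plus f"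
  shows "(f ^^ m) z \<in> V_plus f"
proof -
  obtain l where l: "\<And>N. \<exists>n\<ge>N. rad n \<le> cmod ((f ^^ (n + l)) z)" using V_plus_high[OF assms] by blast
  have "\<exists>n\<ge>N. rad n \<le> cmod ((f ^^ (n + l)) ((f ^^ m) z))" for N
  proof -
    obtain n where n: "n \<ge> N + m" "rad n \<le> cmod ((f ^^ (n + l)) z)" using l by blast
    have "n + l = n - m + l + m" using n(1) by simp
    then have "(f ^^ (n + l)) z = (f ^^ (n - m + l)) ((f ^^ m) z)" by (metis comp_apply funpow_add)
    moreover have "rad (n - m) \<le> rad n" by (rule rad_mono) simp
    ultimately show ?thesis using n by (intro exI[of _ "n - m"]) auto
  qed
  then show ?thesis unfolding V_plus_iff by blast
qed

text \<open>A coincidence among the iterated components gives a periodic \<open>V\<close> that meets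
  \<open>V_plus f\<close> by forward invariance, so \<open>periodic_component_escapes\<close> makes
  \<open>V\<close> a Baker domain.\<close>

lemma wandering_or_baker:
  assumes U: "U \<in> components (fatou_set f)" "\<not> bounded U"
  shows "(baker_domain f U \<or> preimage_of_baker_domain f U) \<or> wandering_domain f U"
proof (cases "wandering_domain f U")
  case False
  then have "\<exists>m n. m \<noteq> n \<and> fatou_iterate f U m = fatou_iterate f U n"
    unfolding wandering_domain_def using U(1) by blast
  then obtain m n where mn: "m < n" and eq: "fatou_iterate f U m = fatou_iterate f U n"
    by (metis linorder_neqE_nat)
  note UF = component_facts[OF U(1)]
  obtain u where u: "u \<in> U" "u \<in> V_plus f" using unbounded_meets_V_plus[OF UF(1,2) U(2)] by blast
  define V where "V = fatou_iterate f U m"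
  have V: "V \<in> components (fatou_set f)" "\<not> bounded V"
    unfolding V_def using fatou_iterate(1)[OF U(1)] unbounded_fatou_iterate[OF U] by auto
  have per: "(f ^^ m) u \<in> V" "fatou_iterate f V (n - m) = V"
    using iterate_eq_imp_periodic[OF U(1) eq u(1)] mn by (auto simp: V_def)
  have "V \<inter> V_plus f \<noteq> {}" using per(1) V_plus_funpow[OF u(2)] by blast
  moreover have "1 \<le> n - m" using mn by simp
  ultimately have "baker_domain f V"
    unfolding baker_domain_def using V periodic_component_escapes[OF V _ per(2)] per(2) by blast
  \<comment> \<open>Index 0 is treated apart, since \<open>preimage_of_baker_domain\<close> asks for
    \<open>k \<ge> 1\<close>.\<close>
  moreover have "V = U" if "m = 0"
    unfolding V_def by (rule fatou_iterate_eqI[OF U(1) U(1) u(1)]) (use u(1) that in simp)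
  moreover have "preimage_of_baker_domain f U" if "baker_domain f V" "m \<ge> 1"
    unfolding preimage_of_baker_domain_def using U(1) that unfolding V_def by blast
  ultimately show ?thesis by (cases "m = 0") auto
qed simp

end

section \<open>The three growth conditions combined\<close>

theorem theorem1p6:
  fixes f :: "complex \<Rightarrow> complex" and U :: "complex set"
  assumes "transcendental_entire f"
    and "U \<in> components (fatou_set f)"
    and "\<not> bounded U"
  shows
    "((\<exists>r>0. filterlim (\<lambda>n. (min_modulus f ^^ n) r) at_top sequentially) \<longrightarrow>
        U \<inter> V_plus f \<noteq> {} \<and>
        ((baker_domain f U \<or> preimage_of_baker_domain f U) \<or> wandering_domain f U) \<and>
        (Liminf at_top (\<lambda>r. ereal (max_min_modulus f r / r)) > 1 \<longrightarrow> U \<subseteq> V_plus f)) \<and>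
     (filterlim (\<lambda>r. max_min_modulus f r / r) at_top at_top \<longrightarrow>
        wandering_domain f U \<and> U \<subseteq> V_plus f) \<and>
     (filterlim (\<lambda>r. ln (max_min_modulus f r) / ln r) at_top at_top \<longrightarrow>
        wandering_domain f U \<and> U \<subseteq> V_plus f \<and> V_plus f \<subseteq> Z_plus f)"
proof (intro conjI impI)
  have cont: "continuous_on UNIV f"
    using assms(1) by (simp add: transcendental_entire_def holomorphic_on_imp_continuous_on)
  \<comment> \<open>Under superlinear growth the inequality with factor 2 already supplies an
    admissible radius, without any assumption on the iterates of
    \<open>min_modulus f\<close>.\<close>
  have growth: "\<exists>R. transcendental_growth f R"
    if lim: "filterlim (\<lambda>r. max_min_modulus f r / r) at_top at_top"
  proof -
    have "\<forall>\<^sub>F r in at_top. r < max_min_modulus f r"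
      using filterlim_quotient_imp_eventually_scaled[OF lim, of 2] eventually_gt_at_top[of 0]
      by eventually_elim simp
    then obtain R where "admissible_radius f R" using admissible_radius_if_eventually by blast
    then show ?thesis using assms(1) by (auto simp: transcendental_growth_def)
  qed
  have linear: "wandering_domain f U" "U \<subseteq> V_plus f"
    if lim: "filterlim (\<lambda>r. max_min_modulus f r / r) at_top at_top"
  proof -
    obtain R where "transcendental_growth f R" using growth[OF lim] by blast
    then interpret transcendental_growth f R .
    show "wandering_domain f U" by (rule wandering_if_superlinear[OF assms(2,3) lim])
    show "U \<subseteq> V_plus f"
      using subset_V_plus[OF assms(2,3) _ filterlim_quotient_imp_eventually_scaled[OF lim, of 2]] by simp
  qed
  {
    assume "\<exists>r>0. filterlim (\<lambda>n. (min_modulus f ^^ n) r) at_top sequentially"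
    then obtain R where R: "admissible_radius f R"
      using admissible_radius_if_min_modulus_iterates[OF cont] by blast
    interpret transcendental_growth f R using assms(1) R by unfold_locales
    note UF = component_facts[OF assms(2)]
    show meets: "U \<inter> V_plus f \<noteq> {}" by (rule unbounded_meets_V_plus[OF UF(1,2) assms(3)])
    show "(baker_domain f U \<or> preimage_of_baker_domain f U) \<or> wandering_domain f U"
      by (rule wandering_or_baker[OF assms(2,3)])
    show "U \<subseteq> V_plus f" if "1 < Liminf at_top (\<lambda>r. ereal (max_min_modulus f r / r))"
      using less_Liminf_imp_eventually_scaled[OF that] subset_V_plus[OF assms(2,3)] by metis
  }
  {
    assume lim: "filterlim (\<lambda>r. max_min_modulus f r / r) at_top at_top"
    show "wandering_domain f U" "U \<subseteq> V_plus f" by (rule linear[OF lim])+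
  }
  assume lim: "filterlim (\<lambda>r. ln (max_min_modulus f r) / ln r) at_top at_top"
  \<comment> \<open>Logarithmic growth implies the superlinear condition, so only the inclusion in
    \<open>Z_plus f\<close> is new.\<close>
  note lin = log_growth_imp_linear_growth[OF cont lim]
  show "wandering_domain f U" "U \<subseteq> V_plus f" by (rule linear[OF lin])+
  obtain R where "transcendental_growth f R" using growth[OF lin] by blast
  then interpret transcendental_growth f R .
  show "V_plus f \<subseteq> Z_plus f" by (rule V_plus_subset_Z_plus[OF lim])
qed

end
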